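(* Let $p\ge1$ and let $w\in A_{p,q}$ be a weight on $\mathbb{R}^n$, with $q<\infty$ satisfying $1/p-1/q=1/n$. Then, for any Lipschitz function $f$ on $\mathbb{R}^n$ with compact support, $$\left(\int_{\mathbb{R}^n}(|f(x)|w(x))^q\,dx\right)^{1/q}\le c\,[w]_{A_{p,q}}^{1/n'}\left(\int_{\mathbb{R}^n}(|\nabla f(x)|w(x))^p\,dx\right)^{1/p},$$ where the constant $c$ is independent of $w$ and $f$.
   Context: A weight is a non-negative locally integrable function on $\mathbb{R}^n$. Primes denote dual exponents: $1/p+1/p'=1$, and $1/n+1/n'=1$, so $1/n'=1-1/n$. Cubes have sides parallel to the axes. For $1<p\le q<\infty$, a weight $w$ belongs to $A_{p,q}$ if $$[w]_{A_{p,q}}=\sup_Q\left(\frac1{|Q|}\int_Q w^q\,dx\right)\left(\frac1{|Q|}\int_Q w^{-p'}\,dx\right)^{q/p'}<\infty,$$ the supremum being over all cubes $Q$. For $1\le q<\infty$, $w\in A_{1,q}$ if there is a constant $c$ with $\frac1{|Q|}\int_Q w^q\,dx\le c\,\inf_Q w^q$ (essential infimum) for all cubes $Q$, and $[w]_{A_{1,q}}$ is the smallest such $c$. *)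

theory Defs
  imports "HOL-Analysis.Analysis"
begin

(* Powers of extended non-negative reals, meant for exponents a > 0 (so that the
   value at \<infinity> is \<infinity>). *)
definition epowr :: "ennreal \<Rightarrow> real \<Rightarrow> ennreal" (infixr "epowr" 80) where
  "x epowr a = (if x = top then top else ennreal (enn2real x powr a))"

definition weight :: "(real ^ 'n \<Rightarrow> real) \<Rightarrow> bool" where
  "weight w \<longleftrightarrow> w \<in> borel_measurable lebesgue \<and> (\<forall>x. 0 \<le> w x) \<and>
     (\<forall>K. compact K \<longrightarrow> w absolutely_integrable_on K)"

definition cubes :: "(real ^ 'n) set set" where
  "cubes = {cbox a (a + l *\<^sub>R One) | a l. 0 < l}"

definition avg :: "(real ^ 'n) set \<Rightarrow> (real ^ 'n \<Rightarrow> ennreal) \<Rightarrow> ennreal" where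
  "avg Q g = set_nn_integral lebesgue Q g / emeasure lebesgue Q"

definition ess_inf_on :: "(real ^ 'n) set \<Rightarrow> (real ^ 'n \<Rightarrow> ennreal) \<Rightarrow> ennreal" where
  "ess_inf_on Q g = Sup {a. AE x\<in>Q in lebesgue. a \<le> g x}"

definition dual_exp :: "real \<Rightarrow> real" where
  "dual_exp p = p / (p - 1)"

(* For p > 1, the negative power of w is the ennreal inverse of the positive power, so
   that it is \<infinity> where w vanishes (whereas 0 powr a = 0 on the reals for every a).
   For p = 1, the infimum ranges over finite constants c only; it is top if there is none,
   and it is attained otherwise. *)
definition A_const :: "real \<Rightarrow> real \<Rightarrow> (real ^ 'n \<Rightarrow> real) \<Rightarrow> ennreal" where
  "A_const p q w =
     (if p = 1
      then Inf {ennreal c | c. 0 \<le> c \<and>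
             (\<forall>Q\<in>cubes. avg Q (\<lambda>x. ennreal (w x powr q))
                         \<le> ennreal c * ess_inf_on Q (\<lambda>x. ennreal (w x powr q)))}
      else (SUP Q\<in>cubes. avg Q (\<lambda>x. ennreal (w x powr q)) *
             avg Q (\<lambda>x. inverse (ennreal (w x powr dual_exp p))) epowr (q / dual_exp p)))"

definition A_class :: "real \<Rightarrow> real \<Rightarrow> (real ^ 'n \<Rightarrow> real) set" where
  "A_class p q = {w. weight w \<and> A_const p q w < top}"

(* The vector of partial derivatives. A Lipschitz function is differentiable almost
   everywhere, so the value 0 for a missing partial derivative plays no role in integrals. *)
definition grad :: "(real ^ 'n \<Rightarrow> real) \<Rightarrow> real ^ 'n \<Rightarrow> real ^ 'n" where
  "grad f x = (\<chi> i. if (\<lambda>t. f (x + t *\<^sub>R axis i 1)) field_differentiable at 0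
                      then deriv (\<lambda>t. f (x + t *\<^sub>R axis i 1)) 0 else 0)"

end

theory Submission
  imports Defs
begin

text \<open>
  The proof combines a pointwise bound by a dyadic fractional integral, a weak-type estimate for that
  integral with the sharp power of the weight constant, and a truncation argument.

  Averages of \<open>\<bar>f\<bar>\<close> over a dyadic cube and over its parent differ in a controlled way: halving one
  coordinate at a time and integrating the gradient along an axis, the average over the cube exceeds
  that over the parent by at most a multiple of \<open>\<ell> powr (1 - n)\<close> times the integral of the gradient over
  the parent, of side \<open>\<ell>\<close>. Telescoping bounds \<open>\<bar>f x\<bar>\<close> by the sum \<open>I x\<close> of these terms over all dyadic cubes
  containing \<open>x\<close> (\<open>abs_le_dyadic_potential\<close>). Along a line this uses that a Lipschitz function is the
  integral of its derivative, which exists almost everywhere (\<open>bilipschitz_derivative\<close>,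
  \<open>lipschitz_increment_le_derivative\<close>).

  Write \<open>u = w powr q\<close>, let \<open>E\<close> be a level set of \<open>f\<close>, let \<open>U\<close> be its \<open>u\<close>-mass, and let \<open>M\<close> be the dyadic maximal
  function of \<open>u\<close> restricted to \<open>E\<close>. Integrating \<open>I\<close> against \<open>u\<close> over \<open>E\<close> and using duality, Hedberg's
  argument bounds the result by \<open>U powr (1 / n)\<close> times the integral of \<open>\<bar>\<nabla>f\<bar>\<close> against \<open>M powr (1 - 1 / n)\<close>
  (\<open>dyadic_potential_duality\<close>). For \<open>p = 1\<close> the \<open>A\<close> condition says that \<open>M\<close> is at most the constant times \<open>u\<close>.
  For \<open>p > 1\<close> Hoelder's inequality leaves a weighted norm of \<open>M\<close>, for which Buckley's bound is linear in the
  constant (\<open>dyadic_maximal_Buckley\<close>). Its proof, after Lerner, composes two maximal operators relative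
  to weighted measures, and Doob's inequality bounds these uniformly in the measure
  (\<open>max_fun_strong_type\<close>). The power \<open>1 - 1 / n\<close> of \<open>M\<close> becomes the power of the weight constant. The
  outcome is the weak-type inequality \<open>weak_type_gradient_bound\<close>.

  Finally, \<open>\<bar>f\<bar>\<close> is cut at the heights \<open>2 powr j\<close>. The weak-type inequality applied to each slice is already the
  strong one at that height, because the gradient of a slice lives only where \<open>\<bar>f\<bar>\<close> lies
  between its two heights. Since \<open>q \<ge> p\<close>, the slices can be summed.

  A weight that vanishes on a set of positive measure vanishes almost everywhere, and for it the
  inequality is trivial. In dimension one the hypotheses on the exponents contradict each other.
\<close>

section \<open>Powers and dyadic sums of extended non-negative reals\<close>

abbreviation nn_sum :: "('a \<Rightarrow> ennreal) \<Rightarrow> ennreal" (binder "\<Sum>\<^sup>+" 10) where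
  "nn_sum f \<equiv> nn_integral (count_space UNIV) f"

abbreviation pow2 :: "int \<Rightarrow> real" where
  "pow2 k \<equiv> 2 powr real_of_int k"

lemma epowr_ennreal: "0 \<le> x \<Longrightarrow> ennreal x epowr a = ennreal (x powr a)"
  by (simp add: epowr_def)

lemma epowr_zero [simp]: "0 epowr a = 0"
  by (simp add: epowr_def)

lemma epowr_top [simp]: "top epowr a = top"
  by (simp add: epowr_def)

lemma epowr_one [simp]: "x epowr 1 = x"
  by (cases x) (auto simp: epowr_ennreal)

lemma one_epowr [simp]: "1 epowr a = 1"
  by (simp add: epowr_def)

lemma epowr_eq_0_iff [simp]: "x epowr a = 0 \<longleftrightarrow> x = 0"
  by (cases x) (auto simp: epowr_ennreal ennreal_eq_0_iff)

lemma epowr_eq_top_iff [simp]: "x epowr a = top \<longleftrightarrow> x = top"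
  by (simp add: epowr_def)

lemma epowr_mono: "0 \<le> a \<Longrightarrow> x \<le> y \<Longrightarrow> x epowr a \<le> y epowr a"
  by (cases x; cases y) (auto simp: epowr_ennreal top_unique intro!: ennreal_leI powr_mono2)

lemma epowr_mult: "(x * y) epowr a = x epowr a * y epowr a"
  by (cases x; cases y; cases "x = 0"; cases "y = 0")
     (auto simp: epowr_ennreal ennreal_mult[symmetric] powr_mult ennreal_mult_top ennreal_top_mult ennreal_eq_0_iff)

lemma epowr_epowr: "(x epowr a) epowr b = x epowr (a * b)"
  by (cases x) (auto simp: epowr_ennreal powr_powr)

lemma epowr_add: "x epowr (a + b) = x epowr a * x epowr b"
  by (cases x) (auto simp: epowr_ennreal powr_add ennreal_mult)

lemma borel_measurable_epowr [measurable (raw)]: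
  assumes [measurable]: "f \<in> borel_measurable M"
  shows "(\<lambda>x. f x epowr a) \<in> borel_measurable M"
  unfolding epowr_def
proof (rule measurable_If)
  have "f -` {top} \<inter> space M \<in> sets M" by measurable
  then show "{x \<in> space M. f x = top} \<in> sets M" by (simp add: vimage_def Int_def conj_commute)
qed measurable

text \<open>One factor \<open>f i epowr (a - 1)\<close> of each summand is dominated by the corresponding power of
  the whole sum.\<close>
lemma sum_epowr_le_epowr_sum:
  fixes f :: "'a \<Rightarrow> ennreal"
  assumes "1 \<le> a"
  shows "(\<Sum>\<^sup>+i. f i epowr a) \<le> (\<Sum>\<^sup>+i. f i) epowr a"
proof -
  let ?S = "\<Sum>\<^sup>+i. f i"
  have le: "f i \<le> ?S" for i by (rule nn_integral_ge_point) simp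
  have "(\<Sum>\<^sup>+i. f i epowr a) = (\<Sum>\<^sup>+i. f i epowr (a - 1) * f i)"
    using epowr_add[of _ "a - 1" 1] by simp
  also have "\<dots> \<le> (\<Sum>\<^sup>+i. ?S epowr (a - 1) * f i)"
    using assms le by (intro nn_integral_mono mult_right_mono epowr_mono) auto
  also have "\<dots> = ?S epowr (a - 1) * ?S" by (rule nn_integral_cmult) simp
  also have "\<dots> = ?S epowr a" using epowr_add[of ?S "a - 1" 1] by simp
  finally show ?thesis .
qed

text \<open>Young's inequality, applied after scaling \<open>f\<close> and \<open>g\<close> by their norms; the degenerate
  values \<open>0\<close> and \<open>top\<close> of the norms are split off because the scaling divides by them.\<close>
lemma nn_integral_Holder:
  assumes p: "1 < p" and q: "1 < q" and pq: "1 / p + 1 / q = 1"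
    and [measurable]: "f \<in> borel_measurable M" "g \<in> borel_measurable M"
  shows "(\<integral>\<^sup>+x. f x * g x \<partial>M)
    \<le> (\<integral>\<^sup>+x. f x epowr p \<partial>M) epowr (1 / p) * (\<integral>\<^sup>+x. g x epowr q \<partial>M) epowr (1 / q)"
    (is "_ \<le> ?X epowr _ * ?Y epowr _")
proof (cases "?X = 0 \<or> ?Y = 0")
  case True
  then have "AE x in M. f x * g x = 0"
    by (auto simp: nn_integral_0_iff_AE elim!: eventually_mono)
  then have "(\<integral>\<^sup>+x. f x * g x \<partial>M) = 0" by (subst nn_integral_0_iff_AE) auto
  then show ?thesis by simp
next
  case nz: False
  show ?thesis
  proof (cases "?X = top \<or> ?Y = top")
    case True
    then have "?X epowr (1 / p) * ?Y epowr (1 / q) = top"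
      using nz by (auto simp: ennreal_mult_eq_top_iff)
    then show ?thesis by simp
  next
    case False
    with nz obtain X Y where X: "?X = ennreal X" "0 < X" and Y: "?Y = ennreal Y" "0 < Y"
      by (cases ?X; cases ?Y) (auto simp: ennreal_eq_0_iff less_le)
    define x where "x = X powr (1 / p)"
    define y where "y = Y powr (1 / q)"
    have xy: "0 < x" "0 < y" "x powr p = X" "y powr q = Y"
      using X Y p q by (auto simp: x_def y_def powr_powr)
    have young: "f t * g t \<le> ennreal (x * y / (p * X)) * f t epowr p + ennreal (x * y / (q * Y)) * g t epowr q" for t
    proof (cases "f t = top \<or> g t = top")
      case True
      then show ?thesis using xy X Y p q by (auto simp: ennreal_mult_top)
    next
      case False
      then obtain a b where ab: "f t = ennreal a" "0 \<le> a" "g t = ennreal b" "0 \<le> b"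
        by (cases "f t"; cases "g t") auto
      have "(a / x) * (b / y) \<le> (a / x) powr p / p + (b / y) powr q / q"
        using p q pq ab xy by (intro Youngs_inequality) auto
      then have "x * y * ((a / x) * (b / y)) \<le> x * y * ((a / x) powr p / p + (b / y) powr q / q)"
        using xy by (intro mult_left_mono) auto
      then have "a * b \<le> x * y / (p * X) * a powr p + x * y / (q * Y) * b powr q"
        using xy ab by (simp add: powr_divide field_simps)
      then show ?thesis using ab p q xy X Y
        by (simp add: epowr_ennreal ennreal_mult[symmetric] ennreal_plus[symmetric] ennreal_leI del: ennreal_plus)
    qed
    have "(\<integral>\<^sup>+x. f x * g x \<partial>M) \<le> (\<integral>\<^sup>+t. ennreal (x * y / (p * X)) * f t epowr p + ennreal (x * y / (q * Y)) * g t epowr q \<partial>M)"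
      by (intro nn_integral_mono young)
    also have "\<dots> = ennreal (x * y / (p * X)) * ?X + ennreal (x * y / (q * Y)) * ?Y"
      by (simp add: nn_integral_add nn_integral_cmult)
    also have "\<dots> = ennreal (x * y * (1 / p + 1 / q))"
      using X Y p q xy
      by (simp add: ennreal_mult[symmetric] ennreal_plus[symmetric] field_simps del: ennreal_plus)
    also have "\<dots> = ?X epowr (1 / p) * ?Y epowr (1 / q)"
      using X Y xy pq by (simp add: epowr_ennreal ennreal_mult[symmetric] x_def y_def)
    finally show ?thesis .
  qed
qed

text \<open>The value of the geometric series with ratio \<open>2 powr (- a)\<close>. All dyadic sums below are
  dominated by their largest term, and this is the factor lost.\<close>
definition geom :: "real \<Rightarrow> real" where "geom a = 1 / (1 - 2 powr (- a))"

lemma geom_pos: "0 < a \<Longrightarrow> 0 < geom a"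
  by (simp add: geom_def powr_less_one)

lemma nn_integral_geometric:
  assumes "0 < a"
  shows "(\<Sum>\<^sup>+i. ennreal (2 powr (- (real i * a)))) = ennreal (geom a)"
proof -
  have "2 powr (- (real i * a)) = (2 powr (- a)) ^ i" for i
    by (simp add: powr_power mult.commute)
  moreover have "(2::real) powr (- a) < 1" using assms by (simp add: powr_less_one)
  ultimately show ?thesis
    by (simp add: nn_integral_count_space_nat suminf_ennreal2 summable_geometric suminf_geometric geom_def)
qed

text \<open>Re-indexing downwards from the last admissible exponent turns the sum into a geometric series.\<close>
lemma nn_integral_dyadic_below:
  assumes a: "0 < a" and x: "0 < x"
  shows "(\<Sum>\<^sup>+j. ennreal (2 powr (real_of_int j * a)) * indicator {j. pow2 j < x} j)
    \<le> ennreal (geom a * x powr a)"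
proof -
  define l where "l = \<lceil>log 2 x\<rceil> - 1"
  have l: "real_of_int l \<le> log 2 x" unfolding l_def by linarith
  have bij: "bij_betw (\<lambda>i::nat. l - int i) UNIV {..l}"
    by (rule bij_betwI[of _ _ _ "\<lambda>j. nat (l - j)"]) auto
  have sub: "j \<le> l" if "pow2 j < x" for j
    using that x by (simp add: less_log_iff[symmetric] l_def) linarith
  have "(\<Sum>\<^sup>+j. ennreal (2 powr (real_of_int j * a)) * indicator {j. pow2 j < x} j)
    \<le> (\<Sum>\<^sup>+j. ennreal (2 powr (real_of_int j * a)) * indicator {..l} j)"
    using sub by (intro nn_integral_mono mult_left_mono) (auto split: split_indicator)
  also have "\<dots> = (\<integral>\<^sup>+j. ennreal (2 powr (real_of_int j * a)) \<partial>count_space {..l})"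
    by (simp add: nn_integral_count_space_indicator)
  also have "\<dots> = (\<Sum>\<^sup>+i. ennreal (2 powr (real_of_int (l - int i) * a)))"
    by (rule nn_integral_bij_count_space[OF bij, symmetric])
  also have "\<dots> = (\<Sum>\<^sup>+i. ennreal (2 powr (l * a)) * ennreal (2 powr (- (real i * a))))"
    by (simp add: ennreal_mult[symmetric] powr_add[symmetric] algebra_simps)
  also have "\<dots> = ennreal (2 powr (l * a)) * ennreal (geom a)"
    using a by (simp add: nn_integral_cmult nn_integral_geometric)
  also have "\<dots> \<le> ennreal (x powr a) * ennreal (geom a)"
  proof (intro mult_right_mono ennreal_leI)
    have "(2::real) powr (l * a) \<le> 2 powr (log 2 x * a)"
      using l a by (intro powr_mono mult_right_mono) auto
    also have "\<dots> = x powr a" using x by (simp add: powr_powr[symmetric])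
    finally show "2 powr (l * a) \<le> x powr a" .
  qed auto
  finally show ?thesis using geom_pos[OF a] by (simp add: ennreal_mult[symmetric] mult.commute)
qed

lemma nn_integral_dyadic_above:
  assumes a: "0 < a" and x: "0 < x"
  shows "(\<Sum>\<^sup>+j. ennreal (2 powr (- (real_of_int j * a))) * indicator {j. x \<le> pow2 j} j)
    \<le> ennreal (geom a * x powr (- a))"
proof -
  define l where "l = \<lceil>log 2 x\<rceil>"
  have l: "log 2 x \<le> l" unfolding l_def by linarith
  have bij: "bij_betw (\<lambda>i::nat. l + int i) UNIV {l..}"
    by (rule bij_betwI[of _ _ _ "\<lambda>j. nat (j - l)"]) auto
  have sub: "l \<le> j" if "x \<le> pow2 j" for j
    using that x by (simp add: log_le_iff[symmetric] l_def ceiling_le_iff)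
  have "(\<Sum>\<^sup>+j. ennreal (2 powr (- (real_of_int j * a))) * indicator {j. x \<le> pow2 j} j)
    \<le> (\<Sum>\<^sup>+j. ennreal (2 powr (- (real_of_int j * a))) * indicator {l..} j)"
    using sub by (intro nn_integral_mono mult_left_mono) (auto split: split_indicator)
  also have "\<dots> = (\<integral>\<^sup>+j. ennreal (2 powr (- (real_of_int j * a))) \<partial>count_space {l..})"
    by (simp add: nn_integral_count_space_indicator)
  also have "\<dots> = (\<Sum>\<^sup>+i. ennreal (2 powr (- (real_of_int (l + int i) * a))))"
    by (rule nn_integral_bij_count_space[OF bij, symmetric])
  also have "\<dots> = (\<Sum>\<^sup>+i. ennreal (2 powr (- (l * a))) * ennreal (2 powr (- (real i * a))))"
    by (simp add: ennreal_mult[symmetric] powr_add[symmetric] algebra_simps)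
  also have "\<dots> = ennreal (2 powr (- (l * a))) * ennreal (geom a)"
    using a by (simp add: nn_integral_cmult nn_integral_geometric)
  also have "\<dots> \<le> ennreal (x powr (- a)) * ennreal (geom a)"
  proof (intro mult_right_mono ennreal_leI)
    have "(2::real) powr (- (l * a)) \<le> 2 powr (log 2 x * (- a))"
      using l a by (intro powr_mono) (auto intro: mult_right_mono)
    also have "\<dots> = (2 powr log 2 x) powr (- a)" by (simp only: powr_powr)
    also have "\<dots> = x powr (- a)" using x by simp
    finally show "2 powr (- (l * a)) \<le> x powr (- a)" .
  qed auto
  finally show ?thesis using geom_pos[OF a] by (simp add: ennreal_mult[symmetric] mult.commute)
qed

section \<open>Lipschitz functions of one variable are integrals of their derivative\<close>

abbreviation lint :: "'a::euclidean_space set \<Rightarrow> ('a \<Rightarrow> ennreal) \<Rightarrow> ennreal" where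
  "lint A f \<equiv> set_nn_integral lborel A f"

text \<open>By outer regularity \<open>N\<close> barely charges more than \<open>E\<close> on some open \<open>U \<supseteq> E\<close>. The intervals inside \<open>U\<close>
  on which \<open>M \<le> N\<close> form a Vitali cover of \<open>E\<close>, so a disjoint countable subfamily exhausts \<open>E\<close> up to a
  Lebesgue null set, which \<open>M\<close> does not see. Summing over that subfamily gives the claim.\<close>
lemma measure_le_by_covering:
  fixes M N :: "real measure"
  assumes sets: "sets M = sets borel" "sets N = sets borel"
    and null: "\<And>A. A \<in> null_sets lborel \<Longrightarrow> A \<in> null_sets M"
    and E: "E \<in> sets borel"
    and outer: "\<And>e. 0 < (e::real) \<Longrightarrow> \<exists>U. open U \<and> E \<subseteq> U \<and> emeasure N (U - E) \<le> ennreal e"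
    and cover: "\<And>x d. x \<in> E \<Longrightarrow> 0 < d \<Longrightarrow>
      \<exists>s t. s < t \<and> x \<in> {s..t} \<and> t - s < d \<and> emeasure M {s..t} \<le> emeasure N {s..t}"
  shows "emeasure M E \<le> emeasure N E"
proof (rule ennreal_le_epsilon)
  fix e :: real assume "0 < e"
  from outer[OF this] obtain U where U: "open U" "E \<subseteq> U" "emeasure N (U - E) \<le> e" by blast
  have [measurable]: "E \<in> sets M" "E \<in> sets N" "U \<in> sets M" "U \<in> sets N"
    using E U(1) by (auto simp: sets)
  define K where "K = {(s, t). s < t \<and> {s..t} \<subseteq> U \<and> emeasure M {s..t} \<le> emeasure N {s..t}}"
  have cb: "cball ((s + t) / 2) ((t - s) / 2) = {s..t}" for s t :: real
    by (simp add: cball_eq_atLeastAtMost field_simps)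
  have "\<exists>i. i \<in> K \<and> x \<in> cball ((fst i + snd i) / 2) ((snd i - fst i) / 2) \<and> (snd i - fst i) / 2 < d"
    if x: "x \<in> E" "0 < d" for x d
  proof -
    obtain r where r: "0 < r" "ball x r \<subseteq> U" using U x by (meson openE subsetD)
    obtain s t where st: "s < t" "x \<in> {s..t}" "t - s < min d r" "emeasure M {s..t} \<le> emeasure N {s..t}"
      using cover[OF x(1), of "min d r"] x r by auto
    have "{s..t} \<subseteq> ball x r" using st by (auto simp: dist_real_def)
    then have "(s, t) \<in> K" using st r by (auto simp: K_def)
    then show ?thesis using st by (intro exI[of _ "(s, t)"]) (auto simp: cb)
  qed
  then obtain C where C: "countable C" "C \<subseteq> K"
    "pairwise (\<lambda>i j. disjnt (cball ((fst i + snd i) / 2) ((snd i - fst i) / 2))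
                            (cball ((fst j + snd j) / 2) ((snd j - fst j) / 2))) C"
    "negligible (E - (\<Union>i\<in>C. cball ((fst i + snd i) / 2) ((snd i - fst i) / 2)))"
  proof (rule Vitali_covering_theorem_cballs
          [of K "\<lambda>i. (snd i - fst i) / 2" E "\<lambda>i. (fst i + snd i) / 2", rotated])
    show "0 < (snd i - fst i) / 2" if "i \<in> K" for i using that by (auto simp: K_def)
  qed (assumption | blast)+
  define W where "W = (\<Union>i\<in>C. {fst i..snd i})"
  have [measurable]: "W \<in> sets M" "W \<in> sets N"
    using C(1) unfolding W_def by (auto simp: sets intro!: sets.countable_UN')
  have disj: "disjoint_family_on (\<lambda>i. {fst i..snd i}) C"
    using C(3) by (auto simp: disjoint_family_on_def pairwise_def disjnt_def cb)
  have "negligible (E - W)" using C(4) by (simp add: W_def cb)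
  moreover have "E - W \<in> sets lborel" using E \<open>W \<in> sets M\<close> by (simp add: sets)
  ultimately have "E - W \<in> null_sets lborel"
    by (simp add: negligible_iff_null_sets null_sets_completion_iff)
  then have "E - W \<in> null_sets M" by (rule null)
  have "emeasure M E \<le> emeasure M (W \<union> (E - W))"
    by (intro emeasure_mono) auto
  also have "\<dots> = emeasure M W"
    using \<open>E - W \<in> null_sets M\<close> by (intro emeasure_Un_null_set) auto
  also have "\<dots> = (\<integral>\<^sup>+i. emeasure M {fst i..snd i} \<partial>count_space C)"
    unfolding W_def using C(1) disj by (intro emeasure_UN_countable) (auto simp: sets)
  also have "\<dots> \<le> (\<integral>\<^sup>+i. emeasure N {fst i..snd i} \<partial>count_space C)"
    using C(2) by (intro nn_integral_mono) (auto simp: K_def)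
  also have "\<dots> = emeasure N W"
    unfolding W_def using C(1) disj by (intro emeasure_UN_countable[symmetric]) (auto simp: sets)
  also have "\<dots> \<le> emeasure N (E \<union> (U - E))"
    using C(2) by (intro emeasure_mono) (auto simp: W_def K_def subset_eq)
  also have "\<dots> \<le> emeasure N E + emeasure N (U - E)"
    by (intro emeasure_subadditive) auto
  also have "\<dots> \<le> emeasure N E + e" using U(3) by (intro add_left_mono)
  finally show "emeasure M E \<le> emeasure N E + ennreal e" .
qed

lemma bilipschitz_homeomorphism:
  fixes F :: "real \<Rightarrow> real"
  assumes L: "0 < L" and lower: "\<And>s t. s \<le> t \<Longrightarrow> L * (t - s) \<le> F t - F s"
    and upper: "\<And>s t. s \<le> t \<Longrightarrow> F t - F s \<le> K * (t - s)"
  shows "bij F" "strict_mono F" "continuous_on UNIV F" "continuous_on UNIV (inv F)"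
proof -
  show sm: "strict_mono F"
  proof (rule strict_monoI)
    fix s t :: real assume "s < t"
    then have "0 < L * (t - s)" using L by simp
    with lower[of s t] \<open>s < t\<close> show "F s < F t" by linarith
  qed
  have lip: "\<bar>F t - F s\<bar> \<le> \<bar>K\<bar> * \<bar>t - s\<bar>" for s t
  proof -
    have *: "\<bar>F t - F s\<bar> \<le> \<bar>K\<bar> * \<bar>t - s\<bar>" if "s \<le> t" for s t
    proof -
      have "F s \<le> F t" using sm that by (simp add: strict_mono_less_eq)
      moreover have "F t - F s \<le> \<bar>K\<bar> * (t - s)"
        using upper[OF that] mult_right_mono[of K "\<bar>K\<bar>" "t - s"] that by (auto intro: order_trans)
      ultimately show ?thesis using that by simp
    qed
    show ?thesis using *[of s t] *[of t s] by (cases "s \<le> t") (auto simp: abs_minus_commute)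
  qed
  have "\<bar>K\<bar>-lipschitz_on UNIV F"
    using lip by (intro lipschitz_onI) (auto simp: dist_real_def abs_minus_commute)
  then show cont: "continuous_on UNIV F" by (rule lipschitz_on_continuous_on)
  have "surj F"
  proof (rule surjI[of _ "\<lambda>y. SOME x. F x = y"])
    fix y :: real
    define R where "R = (\<bar>y\<bar> + \<bar>F 0\<bar>) / L"
    have R: "0 \<le> R" "L * R = \<bar>y\<bar> + \<bar>F 0\<bar>" using L by (auto simp: R_def)
    have "F (-R) \<le> y" "y \<le> F R"
      using lower[of "-R" 0] lower[of 0 R] R by auto
    then obtain x where "F x = y"
      using IVT'[of F "-R" y R] R continuous_on_subset[OF cont] by auto
    then show "F (SOME x. F x = y) = y" by (rule someI)
  qed
  with sm show bij: "bij F" by (simp add: bij_def strict_mono_imp_inj_on)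
  have inv: "F (inv F y) = y" for y using bij by (simp add: bij_is_surj surj_f_inv_f)
  have *: "L * \<bar>a - b\<bar> \<le> \<bar>F a - F b\<bar>" for a b
    using lower[of a b] lower[of b a] by (cases "a \<le> b") (auto simp: abs_if)
  have "(1 / L)-lipschitz_on UNIV (inv F)"
    using L *[of "inv F _" "inv F _"]
    by (intro lipschitz_onI) (auto simp: dist_real_def inv field_simps)
  then show "continuous_on UNIV (inv F)" by (rule lipschitz_on_continuous_on)
qed

text \<open>If the inequality failed on a set of positive measure, the strict excess of \<open>f\<close> over \<open>g\<close>
  on a bounded part of that set would have zero integral.\<close>
lemma AE_le_if_set_integrals_le:
  fixes f g :: "real \<Rightarrow> ennreal"
  assumes [measurable]: "f \<in> borel_measurable borel" "g \<in> borel_measurable borel" "S \<in> sets borel"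
    and fin: "\<And>m::nat. (\<integral>\<^sup>+x\<in>{-real m..real m}. g x \<partial>lborel) < top"
    and le: "\<And>E. E \<in> sets borel \<Longrightarrow> E \<subseteq> S \<Longrightarrow> lint E f \<le> lint E g"
  shows "AE x in lborel. x \<in> S \<longrightarrow> f x \<le> g x"
proof -
  have "AE x in lborel. x \<in> S \<inter> {-real m..real m} \<longrightarrow> f x \<le> g x" for m :: nat
  proof -
    define E where "E = {x \<in> S. g x < f x} \<inter> {-real m..real m}"
    have "{x \<in> S. g x < f x} \<in> sets borel" by measurable
    then have E [measurable]: "E \<in> sets borel" by (auto simp: E_def)
    have "lint E g + (\<integral>\<^sup>+x\<in>E. (f x - g x) \<partial>lborel) = lint E f"
      by (subst nn_integral_add[symmetric])
         (auto intro!: nn_integral_cong simp: E_def add_diff_eq_iff_ennreal less_imp_le split: split_indicator)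
    also have "\<dots> \<le> lint E g + 0" using le[OF E] by (auto simp: E_def)
    finally have sum_le: "lint E g + (\<integral>\<^sup>+x\<in>E. (f x - g x) \<partial>lborel) \<le> lint E g + 0" .
    have "lint E g \<le> (\<integral>\<^sup>+x\<in>{-real m..real m}. g x \<partial>lborel)"
      by (intro nn_integral_mono) (auto simp: E_def split: split_indicator)
    then have "lint E g \<noteq> top" using fin[of m] by auto
    with sum_le have "(\<integral>\<^sup>+x\<in>E. (f x - g x) \<partial>lborel) \<le> 0"
      by (subst (asm) ennreal_add_left_cancel_le) auto
    then have "AE x in lborel. (f x - g x) * indicator E x = 0"
      by (subst (asm) le_zero_eq, subst (asm) nn_integral_0_iff_AE) auto
    then show ?thesis
      by eventually_elim (auto simp: E_def not_less[symmetric] diff_eq_0_iff_ennreal split: split_indicator_asm)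
  qed
  then have "AE x in lborel. \<forall>m::nat. x \<in> S \<inter> {-real m..real m} \<longrightarrow> f x \<le> g x"
    unfolding AE_all_countable by blast
  then show ?thesis
  proof eventually_elim
    case (elim x)
    obtain m :: nat where "\<bar>x\<bar> \<le> m" using real_arch_simple by blast
    then have "x \<in> {-real m..real m}" by auto
    with elim show ?case by blast
  qed
qed

text \<open>Difference quotients over intervals having \<open>x\<close> in their interior give Borel conditions on \<open>x\<close>,
  whereas the derivative uses intervals with \<open>x\<close> as an endpoint; continuity passes from the former
  to the latter.\<close>
lemma straddling_mono_closed:
  fixes f :: "real \<Rightarrow> real"
  assumes cont: "continuous_on UNIV f"
    and mono: "\<And>s t. s < x \<Longrightarrow> x < t \<Longrightarrow> t - s < d \<Longrightarrow> f s \<le> f t"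
    and st: "s \<le> x" "x \<le> t" "t - s < d"
  shows "f s \<le> f t"
proof (rule tendsto_le)
  have "isCont f y" for y using cont by (simp add: continuous_on_eq_continuous_at)
  moreover have "((\<lambda>\<eta>. s - \<eta>) \<longlongrightarrow> s - 0) (at_right 0)" "((\<lambda>\<eta>. t + \<eta>) \<longlongrightarrow> t + 0) (at_right 0)"
    by (intro tendsto_intros)+
  ultimately show "((\<lambda>\<eta>. f (s - \<eta>)) \<longlongrightarrow> f s) (at_right 0)" "((\<lambda>\<eta>. f (t + \<eta>)) \<longlongrightarrow> f t) (at_right 0)"
    using isCont_tendsto_compose[of _ f] by force+
  have "\<forall>\<^sub>F \<eta> in at_right 0. 0 < \<eta> \<and> \<eta> < (d - (t - s)) / 2"
    using st(3) unfolding eventually_at_right_field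
    by (intro exI[of _ "(d - (t - s)) / 2"]) auto
  then show "\<forall>\<^sub>F \<eta> in at_right 0. f (s - \<eta>) \<le> f (t + \<eta>)"
  proof eventually_elim
    case (elim \<eta>)
    then show ?case using st by (intro mono) (auto simp: field_simps)
  qed
qed simp

text \<open>Let \<open>N\<close> be the measure giving an interval the increment of \<open>F\<close> over it, that is, the image of
  Lebesgue measure under the inverse of \<open>F\<close>. It is absolutely continuous, because Lipschitz maps
  preserve null sets; let \<open>h\<close> be its density. If arbitrarily short intervals around the points of \<open>E\<close>
  have slope above \<open>c\<close>, the covering lemma gives \<open>c * |E| \<le> N E\<close>, so \<open>h \<ge> c\<close> almost everywhere on \<open>E\<close>;
  slopes below \<open>c\<close> give the reverse. With \<open>c\<close> running through the rationals, both the upper and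
  the lower derivative of \<open>F\<close> must equal \<open>h\<close> almost everywhere.\<close>
lemma bilipschitz_derivative:
  fixes F :: "real \<Rightarrow> real"
  assumes L: "0 < L" and lower: "\<And>s t. s \<le> t \<Longrightarrow> L * (t - s) \<le> F t - F s"
    and upper: "\<And>s t. s \<le> t \<Longrightarrow> F t - F s \<le> K * (t - s)"
  obtains h :: "real \<Rightarrow> ennreal" where "h \<in> borel_measurable lborel"
    "\<And>s t. s \<le> t \<Longrightarrow> (\<integral>\<^sup>+x\<in>{s..t}. h x \<partial>lborel) = ennreal (F t - F s)"
    "AE x in lborel. \<exists>D. (F has_real_derivative D) (at x) \<and> h x = ennreal D \<and> 0 \<le> D"
proof -
  note F = bilipschitz_homeomorphism[OF L lower upper]
  define G where "G = inv F"
  have FG: "F (G y) = y" and GF: "G (F x) = x" for x y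
    using F(1) by (auto simp: G_def bij_is_surj surj_f_inv_f bij_is_inj)
  have [measurable]: "F \<in> borel_measurable borel" "G \<in> borel_measurable borel"
    using F(3,4) by (auto simp: G_def intro: borel_measurable_continuous_onI)
  define N where "N = distr lborel borel G"
  have sN[simp, measurable_cong]: "sets N = sets borel" and spN[simp]: "space N = UNIV" by (auto simp: N_def)
  have N: "emeasure N A = emeasure lborel (G -` A)" if "A \<in> sets borel" for A
    using that by (simp add: N_def emeasure_distr)
  have Fmono: "F s \<le> F t \<longleftrightarrow> s \<le> t" for s t using F(2) by (simp add: strict_mono_less_eq)
  have NI: "emeasure N {s..t} = ennreal (F t - F s)" if "s \<le> t" for s t
  proof -
    have "G -` {s..t} = {F s..F t}" using Fmono FG GF by (auto simp: vimage_def) (metis)+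
    then show ?thesis using that Fmono by (simp add: N)
  qed
  have nullN: "A \<in> null_sets N" if A: "A \<in> null_sets lborel" for A
  proof -
    have "negligible (F ` A)"
    proof (rule negligible_locally_Lipschitz_image)
      show "negligible A" using A by (simp add: negligible_iff_null_sets null_sets_completionI)
      fix x assume "x \<in> A"
      have "norm (F y - F x) \<le> K * norm (y - x)" for y
        using upper[of x y] upper[of y x] Fmono[of x y] Fmono[of y x]
        by (cases "x \<le> y") (auto simp: abs_if)
      then show "\<exists>T B. open T \<and> x \<in> T \<and> (\<forall>y\<in>A \<inter> T. norm (F y - F x) \<le> B * norm (y - x))"
        by (intro exI[of _ UNIV] exI[of _ K]) auto
    qed simp
    moreover have eq: "F ` A = G -` A" proof (intro set_eqI iffI)
      show "y \<in> G -` A" if "y \<in> F ` A" for y using that GF by auto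
      show "y \<in> F ` A" if "y \<in> G -` A" for y using that FG[of y] by (metis image_eqI vimageD)
    qed
    ultimately have "negligible (G -` A)" by simp
    moreover have "G -` A \<in> sets borel"
      using A measurable_sets[of G borel borel A] by (auto simp: null_sets_def)
    ultimately have "emeasure lborel (G -` A) = 0"
      by (simp add: negligible_iff_null_sets null_sets_completion_iff null_setsD1)
    then show ?thesis using A by (auto simp: null_sets_def N)
  qed
  have "absolutely_continuous lborel N" using nullN by (auto simp: absolutely_continuous_def)
  then obtain h where h[measurable]: "h \<in> borel_measurable lborel" and dens: "density lborel h = N"
    using sigma_finite_measure.Radon_Nikodym[OF sigma_finite_lborel, of N] by auto
  have Nh: "emeasure N A = lint A h" if "A \<in> sets borel" for A
    using that by (simp add: dens[symmetric] emeasure_density)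
  have outN: "\<exists>U. open U \<and> E \<subseteq> U \<and> emeasure N (U - E) \<le> e" if E: "E \<in> sets borel" and e: "0 < e" for E and e::real
  proof -
    have "G -` E \<in> sets borel" using E measurable_sets[of G borel borel E] by simp
    then obtain V where V: "open V" "G -` E \<subseteq> V" "emeasure lborel (V - G -` E) < e"
      using outer_regular_lborel e by metis
    have "open (F -` V)" using F(3) V(1) by (simp add: continuous_on_open_vimage)
    moreover have "E \<subseteq> F -` V" using V(2) GF by (auto simp: vimage_def subset_eq)
    moreover have "emeasure N (F -` V - E) = emeasure lborel (V - G -` E)"
    proof -
      have "G -` (F -` V - E) = V - G -` E" by (auto simp: FG)
      then show ?thesis using E \<open>open (F -` V)\<close> by (subst N) auto
    qed
    ultimately show ?thesis using V(3) by (intro exI[of _ "F -` V"]) auto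
  qed
  have outS: "\<exists>U. open U \<and> E \<subseteq> U \<and> emeasure (scale_measure (ennreal c) lborel) (U - E) \<le> e"
    if E: "E \<in> sets borel" and e: "0 < e" and "0 < c" for E and e c::real
  proof -
    obtain V where V: "open V" "E \<subseteq> V" "emeasure lborel (V - E) < e / c"
      using outer_regular_lborel[OF E, of "e / c"] e \<open>0 < c\<close> by auto
    have "ennreal c * emeasure lborel (V - E) \<le> ennreal c * ennreal (e / c)"
      using V(3) by (intro mult_left_mono) auto
    also have "\<dots> = e" using e \<open>0 < c\<close> by (simp add: ennreal_mult[symmetric])
    finally show ?thesis using V by (intro exI[of _ V]) auto
  qed
  \<comment> \<open>The straddling interval is required to be open around \<open>x\<close>, which makes \<open>U c\<close> and \<open>W c\<close> countable
    intersections of open sets.\<close>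
  define U where "U c = {x. \<forall>n. \<exists>s t. s < x \<and> x < t \<and> t - s < 1 / Suc n \<and> c * (t - s) < F t - F s}" for c :: real
  define W where "W c = {x. \<forall>n. \<exists>s t. s < x \<and> x < t \<and> t - s < 1 / Suc n \<and> F t - F s < c * (t - s)}" for c :: real
  have [measurable]: "U c \<in> sets borel" "W c \<in> sets borel" for c
  proof -
    have "U c = (\<Inter>n. \<Union>(s,t)\<in>{(s,t). t - s < 1 / Suc n \<and> c * (t - s) < F t - F s}. {s<..<t})"
      by (auto simp: U_def; blast)
    also have "\<dots> \<in> sets borel"
      by (intro sets.countable_INT'' borel_open open_UN) auto
    finally show "U c \<in> sets borel" .
    have "W c = (\<Inter>n. \<Union>(s,t)\<in>{(s,t). t - s < 1 / Suc n \<and> F t - F s < c * (t - s)}. {s<..<t})"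
      by (auto simp: W_def; blast)
    also have "\<dots> \<in> sets borel"
      by (intro sets.countable_INT'' borel_open open_UN) auto
    finally show "W c \<in> sets borel" .
  qed
  have Ule: "ennreal c * emeasure lborel E \<le> emeasure N E" if E: "E \<in> sets borel" "E \<subseteq> U c" and c: "0 < c" for E c
  proof -
    have "emeasure (scale_measure (ennreal c) lborel) E \<le> emeasure N E"
    proof (rule measure_le_by_covering[OF _ _ _ E(1) outN])
      fix x d :: real assume x: "x \<in> E" and "0 < d"
      obtain n where "1 / Suc n < d" using \<open>0 < d\<close> nat_approx_posE by (metis inverse_eq_divide)
      then obtain s t where st: "s < x" "x < t" "t - s < d" "c * (t - s) < F t - F s"
      proof -
        have "\<exists>s t. s < x \<and> x < t \<and> t - s < 1 / Suc n \<and> c * (t - s) < F t - F s"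
          using x E(2) unfolding U_def by blast
        then show ?thesis using that \<open>1 / Suc n < d\<close> by (meson less_trans)
      qed
      have "emeasure (scale_measure (ennreal c) lborel) {s..t} \<le> emeasure N {s..t}"
        using st c by (simp add: NI ennreal_mult[symmetric] ennreal_leI)
      then show "\<exists>s t. s < t \<and> x \<in> {s..t} \<and> t - s < d \<and>
          emeasure (scale_measure (ennreal c) lborel) {s..t} \<le> emeasure N {s..t}"
        using st by (intro exI[of _ s] exI[of _ t]) auto
    qed (auto simp: E null_sets_def)
    then show ?thesis by simp
  qed
  have Wle: "emeasure N E \<le> ennreal c * emeasure lborel E" if E: "E \<in> sets borel" "E \<subseteq> W c" and c: "0 < c" for E c
  proof -
    have "emeasure N E \<le> emeasure (scale_measure (ennreal c) lborel) E"
    proof (rule measure_le_by_covering[OF _ _ nullN E(1) outS[OF _ _ c]])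
      fix x d :: real assume x: "x \<in> E" and "0 < d"
      obtain n where "1 / Suc n < d" using \<open>0 < d\<close> nat_approx_posE by (metis inverse_eq_divide)
      then obtain s t where st: "s < x" "x < t" "t - s < d" "F t - F s < c * (t - s)"
      proof -
        have "\<exists>s t. s < x \<and> x < t \<and> t - s < 1 / Suc n \<and> F t - F s < c * (t - s)"
          using x E(2) unfolding W_def by blast
        then show ?thesis using that \<open>1 / Suc n < d\<close> by (meson less_trans)
      qed
      have "emeasure N {s..t} \<le> emeasure (scale_measure (ennreal c) lborel) {s..t}"
        using st c by (simp add: NI ennreal_mult[symmetric] ennreal_leI)
      then show "\<exists>s t. s < t \<and> x \<in> {s..t} \<and> t - s < d \<and>
          emeasure N {s..t} \<le> emeasure (scale_measure (ennreal c) lborel) {s..t}"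
        using st by (intro exI[of _ s] exI[of _ t]) auto
    qed (auto simp: E)
    then show ?thesis by simp
  qed
  have finN: "(\<integral>\<^sup>+x\<in>{-real m..real m}. h x \<partial>lborel) < top" for m
    by (simp add: Nh[symmetric] NI)
  have const: "(\<integral>\<^sup>+x\<in>E. ennreal c \<partial>lborel) = ennreal c * emeasure lborel E" if "E \<in> sets borel" for E c
    using that by (simp add: nn_integral_cmult_indicator)
  have AEU: "AE x in lborel. x \<in> U c \<longrightarrow> ennreal c \<le> h x" if c: "0 < c" for c
    using Ule[OF _ _ c] finN by (intro AE_le_if_set_integrals_le) (auto simp: const Nh[symmetric])
  have AEW: "AE x in lborel. x \<in> W c \<longrightarrow> h x \<le> ennreal c" if c: "0 < c" for c
    using Wle[OF _ _ c] by (intro AE_le_if_set_integrals_le) (auto simp: const Nh[symmetric] ennreal_mult_less_top)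
  have "AE x in lborel. \<forall>c\<in>\<rat>. 0 < c \<longrightarrow> (x \<in> U c \<longrightarrow> ennreal c \<le> h x) \<and> (x \<in> W c \<longrightarrow> h x \<le> ennreal c)"
  proof (subst AE_ball_countable)
    show "countable \<rat>" by (rule countable_rat)
    show "\<forall>c\<in>\<rat>. AE x in lborel. 0 < c \<longrightarrow> (x \<in> U c \<longrightarrow> ennreal c \<le> h x) \<and> (x \<in> W c \<longrightarrow> h x \<le> ennreal c)"
    proof
      fix c :: real
      show "AE x in lborel. 0 < c \<longrightarrow> (x \<in> U c \<longrightarrow> ennreal c \<le> h x) \<and> (x \<in> W c \<longrightarrow> h x \<le> ennreal c)"
      proof (cases "0 < c")
        case True
        show ?thesis using AEU[OF True] AEW[OF True] by eventually_elim auto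
      qed simp
    qed
  qed
  moreover have "AE x in lborel. h x \<noteq> \<infinity>"
  proof -
    have "AE x in lborel. \<forall>m::nat. h x * indicator {-real m..real m} x \<noteq> \<infinity>"
      unfolding AE_all_countable
    proof
      fix m :: nat
      show "AE x in lborel. h x * indicator {-real m..real m} x \<noteq> \<infinity>"
        using finN[of m] by (intro nn_integral_noteq_infinite) auto
    qed
    then show ?thesis
    proof eventually_elim
      case (elim x)
      obtain m :: nat where "\<bar>x\<bar> \<le> m" using real_arch_simple by blast
      then have "x \<in> {-real m..real m}" by auto
      with elim[rule_format, of m] show ?case by auto
    qed
  qed
  ultimately have "AE x in lborel. \<exists>D. (F has_real_derivative D) (at x) \<and> h x = ennreal D \<and> 0 \<le> D"
  proof eventually_elim
    case (elim x)
    then obtain D where D: "h x = ennreal D" "0 \<le> D" by (cases "h x") auto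
    have U: "c \<le> D" if "c \<in> \<rat>" "0 < c" "x \<in> U c" for c
      using elim(1) that D by (auto simp: ennreal_le_iff)
    have W: "D \<le> c" if "c \<in> \<rat>" "0 < c" "x \<in> W c" for c
      using elim(1) that D by (auto simp: ennreal_le_iff)
    have "(F has_real_derivative D) (at x)"
      unfolding has_field_derivative_iff Lim_at
    proof (intro allI impI)
      fix e :: real assume e: "0 < e"
      obtain c1 where c1: "c1 \<in> \<rat>" "D < c1" "c1 < D + e" using Rats_dense_in_real[of D "D + e"] e by auto
      then have "x \<notin> U c1" using U[of c1] D by auto
      then obtain n1 where n1: "\<And>s t. s < x \<Longrightarrow> x < t \<Longrightarrow> t - s < 1 / Suc n1 \<Longrightarrow> F t - F s \<le> c1 * (t - s)"
        unfolding U_def mem_Collect_eq not_all not_ex by (metis not_less)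
      have up: "F t - F s \<le> c1 * (t - s)" if "s \<le> x" "x \<le> t" "t - s < 1 / Suc n1" for s t
      proof -
        have "c1 * s - F s \<le> c1 * t - F t"
        proof (rule straddling_mono_closed[of "\<lambda>x. c1 * x - F x" x "1 / Suc n1"])
          show "continuous_on UNIV (\<lambda>x. c1 * x - F x)" using F(3) by (intro continuous_intros)
          show "c1 * s - F s \<le> c1 * t - F t" if "s < x" "x < t" "t - s < 1 / Suc n1" for s t
            using n1[OF that] by (simp add: algebra_simps)
        qed (use that in auto)
        then show ?thesis by (simp add: algebra_simps)
      qed
      obtain c0 d0 where c0: "D - e < c0" "c0 < D + e" and d0: "0 < d0"
        and lo: "\<And>s t. s \<le> x \<Longrightarrow> x \<le> t \<Longrightarrow> t - s < d0 \<Longrightarrow> c0 * (t - s) \<le> F t - F s"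
      proof (cases "D < e")
        case True
        have "0 * (t - s) \<le> F t - F s" if "s \<le> x" "x \<le> t" for s t using that Fmono[of s t] by simp
        then show ?thesis using True that[of 0 1] D e by auto
      next
        case False
        obtain c where c: "c \<in> \<rat>" "D - e < c" "c < D" using Rats_dense_in_real[of "D - e" "D"] e by auto
        then have "x \<notin> W c" using W[of c] False by auto
        then obtain n where n: "\<And>s t. s < x \<Longrightarrow> x < t \<Longrightarrow> t - s < 1 / Suc n \<Longrightarrow> c * (t - s) \<le> F t - F s"
          unfolding W_def mem_Collect_eq not_all not_ex by (metis not_less)
        have "c * (t - s) \<le> F t - F s" if "s \<le> x" "x \<le> t" "t - s < 1 / Suc n" for s t
        proof -
          have "F s - c * s \<le> F t - c * t"
          proof (rule straddling_mono_closed[of "\<lambda>x. F x - c * x" x "1 / Suc n"])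
            show "continuous_on UNIV (\<lambda>x. F x - c * x)" using F(3) by (intro continuous_intros)
            show "F s - c * s \<le> F t - c * t" if "s < x" "x < t" "t - s < 1 / Suc n" for s t
              using n[OF that] by (simp add: algebra_simps)
          qed (use that in auto)
          then show ?thesis by (simp add: algebra_simps)
        qed
        then show ?thesis using that[of c "1 / Suc n"] c e by auto
      qed
      have "dist ((F y - F x) / (y - x)) D < e" if y: "0 < dist y x" "dist y x < min (1 / Suc n1) d0" for y
      proof -
        have *: "c0 * r \<le> a \<Longrightarrow> a \<le> c1 * r \<Longrightarrow> 0 < r \<Longrightarrow> dist (a / r) D < e" for a r
        proof -
          assume a: "c0 * r \<le> a" "a \<le> c1 * r" "0 < r"
          then have "c0 \<le> a / r" "a / r \<le> c1" by (auto simp: field_simps)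
          then show ?thesis using c0 c1 by (auto simp: dist_real_def abs_less_iff)
        qed
        show ?thesis
        proof (cases "x < y")
          case True
          then show ?thesis using y up[of x y] lo[of x y] by (intro *) (auto simp: dist_real_def)
        next
          case False
          then have "y < x" using y by auto
          then have "dist ((F x - F y) / (x - y)) D < e"
            using y up[of y x] lo[of y x] by (intro *) (auto simp: dist_real_def)
          moreover have "(F x - F y) / (x - y) = (F y - F x) / (y - x)"
            by (metis minus_diff_eq minus_divide_divide)
          ultimately show ?thesis by simp
        qed
      qed
      then show "\<exists>d>0. \<forall>y. 0 < dist y x \<and> dist y x < d \<longrightarrow> dist ((F y - F x) / (y - x)) D < e"
        using d0 by (intro exI[of _ "min (1 / Suc n1) d0"]) auto
    qed
    with D show ?case by blast
  qed
  moreover have "(\<integral>\<^sup>+x\<in>{s..t}. h x \<partial>lborel) = ennreal (F t - F s)" if "s \<le> t" for s t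
    using NI[OF that] by (simp add: Nh)
  ultimately show ?thesis using that h by blast
qed

text \<open>Adding a large multiple of the identity makes \<open>f\<close> bi-Lipschitz, which changes the derivative
  by a constant only.\<close>
lemma lipschitz_increment_le_derivative:
  fixes f :: "real \<Rightarrow> real"
  assumes lip: "C-lipschitz_on UNIV f" and ab: "a \<le> b"
  shows "ennreal \<bar>f b - f a\<bar> \<le> (\<integral>\<^sup>+x\<in>{a..b}. ennreal \<bar>if f field_differentiable at x then deriv f x else 0\<bar> \<partial>lborel)"
proof -
  define L where "L = C + 1"
  have C: "0 \<le> C" using lip by (rule lipschitz_on_nonneg)
  have l: "\<bar>f t - f s\<bar> \<le> C * (t - s)" if "s \<le> t" for s t
    using lipschitz_onD[OF lip, of t s] that by (simp add: dist_real_def)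
  define F where "F x = f x + (C + L) * x" for x
  obtain h where h[measurable]: "h \<in> borel_measurable lborel"
    and int: "\<And>s t. s \<le> t \<Longrightarrow> (\<integral>\<^sup>+x\<in>{s..t}. h x \<partial>lborel) = ennreal (F t - F s)"
    and der: "AE x in lborel. \<exists>D. (F has_real_derivative D) (at x) \<and> h x = ennreal D \<and> 0 \<le> D"
  proof (rule bilipschitz_derivative[of L F "C + (C + L)"])
    show "0 < L" using C by (simp add: L_def)
    show "L * (t - s) \<le> F t - F s" "F t - F s \<le> (C + (C + L)) * (t - s)" if "s \<le> t" for s t
      using l[OF that] by (auto simp: F_def algebra_simps abs_le_iff)
  qed blast
  let ?d = "\<lambda>x. \<bar>if f field_differentiable at x then deriv f x else 0\<bar>"
  let ?D = "\<integral>\<^sup>+x\<in>{a..b}. ennreal (?d x) \<partial>lborel"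
  define M where "M = C + L"
  have M: "0 \<le> M" using C by (simp add: M_def L_def)
  define k where "k x = ennreal \<bar>enn2real (h x) - M\<bar>" for x
  have [measurable]: "k \<in> borel_measurable lborel" unfolding k_def by measurable
  have AE: "AE x in lborel. ennreal (?d x) = k x \<and> h x \<le> k x + ennreal M \<and> ennreal M \<le> k x + h x"
    using der
  proof eventually_elim
    case (elim x)
    then obtain D where D: "(F has_real_derivative D) (at x)" "h x = ennreal D" "0 \<le> D" by blast
    have "((\<lambda>x. F x - M * x) has_real_derivative (D - M)) (at x)"
      using D(1) by (auto intro!: derivative_eq_intros)
    then have "(f has_real_derivative (D - M)) (at x)" by (simp add: F_def M_def)
    then have "?d x = \<bar>D - M\<bar>" by (auto simp: field_differentiable_def dest: DERIV_imp_deriv)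
    moreover have "ennreal D \<le> ennreal \<bar>D - M\<bar> + ennreal M"  "ennreal M \<le> ennreal \<bar>D - M\<bar> + ennreal D"
      using D M by (auto simp: ennreal_plus[symmetric] simp del: ennreal_plus intro!: ennreal_leI)
    ultimately show ?case using D by (simp add: k_def)
  qed
  have Mint: "(\<integral>\<^sup>+x\<in>{a..b}. ennreal M \<partial>lborel) = ennreal (M * (b - a))"
    using ab M by (simp add: nn_integral_cmult_indicator ennreal_mult)
  have Fab: "F b - F a = f b - f a + M * (b - a)"
    by (simp add: F_def M_def algebra_simps)
  have pos: "0 \<le> F b - F a" "0 \<le> M * (b - a)"
  proof -
    show "0 \<le> M * (b - a)" using ab M by simp
    have "0 \<le> L * (b - a)" using ab C by (simp add: L_def)
    then show "0 \<le> F b - F a" using l[OF ab] by (auto simp: F_def algebra_simps abs_le_iff)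
  qed
  have *: "ennreal (F b - F a) \<le> (\<integral>\<^sup>+x\<in>{a..b}. k x \<partial>lborel) + ennreal (M * (b - a))"
    
  proof -
    from AE have "AE x in lborel. h x * indicator {a..b} x \<le> k x * indicator {a..b} x + ennreal M * indicator {a..b} x"
      by eventually_elim (auto split: split_indicator)
    from nn_integral_mono_AE[OF this] show ?thesis
      by (subst (asm) nn_integral_add) (auto simp: int[OF ab] Mint)
  qed
  have **: "ennreal (M * (b - a)) \<le> (\<integral>\<^sup>+x\<in>{a..b}. k x \<partial>lborel) + ennreal (F b - F a)"
    
  proof -
    from AE have "AE x in lborel. ennreal M * indicator {a..b} x \<le> k x * indicator {a..b} x + h x * indicator {a..b} x"
      by eventually_elim (auto split: split_indicator)
    from nn_integral_mono_AE[OF this] show ?thesis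
      by (subst (asm) nn_integral_add) (auto simp: int[OF ab] Mint)
  qed  have eq: "(\<integral>\<^sup>+x\<in>{a..b}. ennreal (?d x) \<partial>lborel) = (\<integral>\<^sup>+x\<in>{a..b}. k x \<partial>lborel)"
    using AE by (intro nn_integral_cong_AE) auto
  show ?thesis
  proof (cases "(\<integral>\<^sup>+x\<in>{a..b}. k x \<partial>lborel) = top")
    case False
    then obtain d where d: "(\<integral>\<^sup>+x\<in>{a..b}. k x \<partial>lborel) = ennreal d" "0 \<le> d"
      by (cases "\<integral>\<^sup>+x\<in>{a..b}. k x \<partial>lborel") auto
    have "F b - F a \<le> d + M * (b - a)" "M * (b - a) \<le> d + (F b - F a)"
      using * ** d pos by (auto simp: ennreal_plus[symmetric] ennreal_le_iff simp del: ennreal_plus)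
    then show ?thesis unfolding eq d(1) using Fab by (intro ennreal_leI) auto
  qed (simp add: eq)
qed

section \<open>The gradient of a Lipschitz function\<close>

text \<open>A Cauchy criterion with countably many quantifiers, so that the set of points where a partial
  derivative exists is Borel.\<close>
lemma field_differentiable_iff_rational_Cauchy:
  fixes g :: "real \<Rightarrow> real"
  assumes cont: "continuous_on UNIV g"
  shows "g field_differentiable at 0 \<longleftrightarrow>
    (\<forall>m::nat. \<exists>k::nat. \<forall>h\<in>{h\<in>\<rat>. h \<noteq> 0 \<and> \<bar>h\<bar> < 1 / Suc k}. \<forall>h'\<in>{h\<in>\<rat>. h \<noteq> 0 \<and> \<bar>h\<bar> < 1 / Suc k}.
       \<bar>(g h - g 0) / h - (g h' - g 0) / h'\<bar> \<le> 1 / Suc m)" (is "_ \<longleftrightarrow> ?C")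
proof
  assume "g field_differentiable at 0"
  then obtain D where "(g has_field_derivative D) (at 0)" by (auto simp: field_differentiable_def)
  then have D: "(\<lambda>h. (g h - g 0) / h) \<midarrow>0\<rightarrow> D" by (simp add: has_field_derivative_iff)
  show ?C
  proof
    fix m :: nat
    obtain d where d: "0 < d" "\<And>h. h \<noteq> 0 \<Longrightarrow> \<bar>h\<bar> < d \<Longrightarrow> \<bar>(g h - g 0) / h - D\<bar> < (1 / Suc m) / 2"
      using LIM_D[OF D, of "(1 / Suc m) / 2"] by auto
    obtain k where k: "1 / Suc k < d" using d(1) nat_approx_posE by (metis inverse_eq_divide)
    show "\<exists>k::nat. \<forall>h\<in>{h\<in>\<rat>. h \<noteq> 0 \<and> \<bar>h\<bar> < 1 / Suc k}. \<forall>h'\<in>{h\<in>\<rat>. h \<noteq> 0 \<and> \<bar>h\<bar> < 1 / Suc k}.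
       \<bar>(g h - g 0) / h - (g h' - g 0) / h'\<bar> \<le> 1 / Suc m"
    proof (intro exI[of _ k] ballI)
      fix h h' assume "h \<in> {h\<in>\<rat>. h \<noteq> 0 \<and> \<bar>h\<bar> < 1 / Suc k}" "h' \<in> {h\<in>\<rat>. h \<noteq> 0 \<and> \<bar>h\<bar> < 1 / Suc k}"
      then have "\<bar>(g h - g 0) / h - D\<bar> < (1 / Suc m) / 2" "\<bar>(g h' - g 0) / h' - D\<bar> < (1 / Suc m) / 2"
        using d(2)[of h] d(2)[of h'] k by auto
      moreover have "\<bar>a - b\<bar> \<le> e" if "\<bar>a - D\<bar> < e / 2" "\<bar>b - D\<bar> < e / 2" for a b e
        using that by linarith
      ultimately show "\<bar>(g h - g 0) / h - (g h' - g 0) / h'\<bar> \<le> 1 / Suc m" by blast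
    qed
  qed
next
  assume C: ?C
  define q where "q h = (g h - g 0) / h" for h
  define H where "H k = {h\<in>\<rat>. h \<noteq> 0 \<and> \<bar>h\<bar> < 1 / real (Suc k)}" for k
  have C': "\<exists>k. \<forall>h\<in>H k. \<forall>h'\<in>H k. \<bar>q h - q h'\<bar> \<le> 1 / Suc m" for m
    using C unfolding q_def H_def by blast
  have small: "1 / real (Suc n) \<in> H k" if "k < n" for k n
    using that by (auto simp: H_def field_simps)
  have "Cauchy (\<lambda>n. q (1 / Suc n))"
    unfolding Cauchy_def
  proof (intro allI impI)
    fix e :: real assume "0 < e"
    then obtain m where m: "1 / Suc m < e" using nat_approx_posE by (metis inverse_eq_divide)
    obtain k where k: "\<forall>h\<in>H k. \<forall>h'\<in>H k. \<bar>q h - q h'\<bar> \<le> 1 / Suc m" using C' by blast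
    have "dist (q (1 / Suc n)) (q (1 / Suc n')) < e" if "n \<ge> Suc k" "n' \<ge> Suc k" for n n'
      using k small[of k n] small[of k n'] that m unfolding dist_real_def
      by (meson le_less_trans less_eq_Suc_le)
    then show "\<exists>M. \<forall>m\<ge>M. \<forall>n\<ge>M. dist (q (1 / Suc m)) (q (1 / Suc n)) < e" by blast
  qed
  then obtain D where D: "(\<lambda>n. q (1 / Suc n)) \<longlonglongrightarrow> D"
    using Cauchy_convergent_iff convergent_def by blast
  have "q \<midarrow>0\<rightarrow> D"
  proof (rule LIM_I)
    fix e :: real assume "0 < e"
    then obtain m where m: "1 / Suc m < e" using nat_approx_posE by (metis inverse_eq_divide)
    obtain k where k: "\<forall>h\<in>H k. \<forall>h'\<in>H k. \<bar>q h - q h'\<bar> \<le> 1 / Suc m" using C' by blast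
    have rat: "\<bar>q h - D\<bar> \<le> 1 / Suc m" if h: "h \<in> H k" for h
    proof (rule tendsto_upperbound)
      show "(\<lambda>n. \<bar>q h - q (1 / Suc n)\<bar>) \<longlonglongrightarrow> \<bar>q h - D\<bar>" by (intro tendsto_intros D)
      show "\<forall>\<^sub>F n in sequentially. \<bar>q h - q (1 / Suc n)\<bar> \<le> 1 / Suc m"
        using k h small by (intro eventually_sequentiallyI[of "Suc k"]) auto
    qed simp
    have real: "\<bar>q h - D\<bar> \<le> 1 / Suc m" if h: "h \<noteq> 0" "\<bar>h\<bar> < 1 / Suc k" for h
    proof -
      define U where "U = {-1 / Suc k<..<1 / Suc k} - {0::real}"
      have contq: "continuous_on U q"
        unfolding q_def U_def by (intro continuous_intros continuous_on_subset[OF cont]) auto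
      have "open U" "h \<in> U" using h by (auto simp: U_def)
      then have "isCont q h" using contq by (simp add: continuous_on_eq_continuous_at)
      moreover have "h \<in> closure (U \<inter> \<rat>)"
        using \<open>open U\<close> \<open>h \<in> U\<close> Rats_closure_real 
        by (metis Int_UNIV_right closure_subset inf_commute open_Int_closure_subset subsetD)
      then obtain x where x: "\<And>n. x n \<in> U \<inter> \<rat>" "x \<longlonglongrightarrow> h"
        unfolding closure_sequential by blast
      ultimately have "(\<lambda>n. q (x n)) \<longlonglongrightarrow> q h" using isCont_tendsto_compose by blast
      then have "(\<lambda>n. \<bar>q (x n) - D\<bar>) \<longlonglongrightarrow> \<bar>q h - D\<bar>" by (intro tendsto_intros)
      moreover have "\<bar>q (x n) - D\<bar> \<le> 1 / Suc m" for n
        using x(1)[of n] by (intro rat) (auto simp: U_def H_def)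
      ultimately show ?thesis by (intro tendsto_upperbound) auto
    qed
    show "\<exists>r>0. \<forall>h. h \<noteq> 0 \<and> norm (h - 0) < r \<longrightarrow> norm (q h - D) < e"
      using real m by (intro exI[of _ "1 / Suc k"]) (auto intro: le_less_trans)
  qed
  then have "(g has_field_derivative D) (at 0)" by (simp add: has_field_derivative_iff q_def[abs_def])
  then show "g field_differentiable at 0" by (auto simp: field_differentiable_def)
qed

lemma borel_measurable_grad_nth:
  fixes f :: "real ^ 'n \<Rightarrow> real"
  assumes cont: "continuous_on UNIV f"
  shows "(\<lambda>x. grad f x $ i) \<in> borel_measurable borel"
proof -
  let ?e = "axis i 1 :: real ^ 'n"
  define q where "q h x = (f (x + h *\<^sub>R ?e) - f x) / h" for h x
  define H where "H k = {h\<in>\<rat>. h \<noteq> 0 \<and> \<bar>h\<bar> < 1 / real (Suc k)}" for k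
  have H: "countable (H k)" for k
    unfolding H_def by (rule countable_subset[OF _ countable_rat]) auto
  have "continuous_on UNIV (\<lambda>x. f (x + h *\<^sub>R ?e))" for h
    by (intro continuous_on_compose2[OF cont] continuous_intros) auto
  then have [measurable]: "(\<lambda>x. f (x + h *\<^sub>R ?e)) \<in> borel_measurable borel" "f \<in> borel_measurable borel" for h
    using cont by (auto intro: borel_measurable_continuous_onI)
  have [measurable]: "q h \<in> borel_measurable borel" for h unfolding q_def by measurable
  define P where "P = {x. \<forall>m. \<exists>k. \<forall>h\<in>H k. \<forall>h'\<in>H k. \<bar>q h x - q h' x\<bar> \<le> 1 / Suc m}"
  have "P = (\<Inter>m. \<Union>k. {x. \<forall>h\<in>H k. \<forall>h'\<in>H k. \<bar>q h x - q h' x\<bar> \<le> 1 / Suc m})" by (auto simp: P_def)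
  also have "\<dots> \<in> sets borel"
  proof -
    have "{x. \<forall>h\<in>H k. \<forall>h'\<in>H k. \<bar>q h x - q h' x\<bar> \<le> 1 / Suc m} \<in> sets borel" for k m :: nat
    proof -
    have "(\<Inter>h\<in>H k. \<Inter>h'\<in>H k. {x. \<bar>q h x - q h' x\<bar> \<le> 1 / Suc m}) \<in> sets borel"
      if "H k \<noteq> {}"
      using that by (intro sets.countable_INT' H image_subsetI) measurable
    moreover have "H k \<noteq> {}"
      using Rats_dense_in_real[of 0 "1 / Suc k"] by (force simp: H_def)
    moreover have "(\<Inter>h\<in>H k. \<Inter>h'\<in>H k. {x. \<bar>q h x - q h' x\<bar> \<le> 1 / Suc m})
        = {x. \<forall>h\<in>H k. \<forall>h'\<in>H k. \<bar>q h x - q h' x\<bar> \<le> 1 / Suc m}" by auto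
    ultimately show ?thesis by simp
    qed
    then show ?thesis by auto
  qed
  finally have [measurable]: "P \<in> sets borel" .
  have contg: "continuous_on UNIV (\<lambda>t. f (x + t *\<^sub>R ?e))" for x
    by (intro continuous_on_compose2[OF cont] continuous_intros) auto
  have diff: "(\<lambda>t. f (x + t *\<^sub>R ?e)) field_differentiable at 0 \<longleftrightarrow> x \<in> P" for x
    unfolding field_differentiable_iff_rational_Cauchy[OF contg] P_def q_def H_def by simp
  have lim: "deriv (\<lambda>t. f (x + t *\<^sub>R ?e)) 0 = lim (\<lambda>n. q (1 / Suc n) x)" if "x \<in> P" for x
  proof -
    have "((\<lambda>t. f (x + t *\<^sub>R ?e)) has_field_derivative deriv (\<lambda>t. f (x + t *\<^sub>R ?e)) 0) (at 0)"
      using that by (simp add: diff[symmetric] DERIV_deriv_iff_field_differentiable)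
    then have "(\<lambda>h. q h x) \<midarrow>0\<rightarrow> deriv (\<lambda>t. f (x + t *\<^sub>R ?e)) 0"
      by (simp add: has_field_derivative_iff q_def)
    then have "(\<lambda>n. q (1 / Suc n) x) \<longlonglongrightarrow> deriv (\<lambda>t. f (x + t *\<^sub>R ?e)) 0"
    proof (rule filterlim_compose)
      show "filterlim (\<lambda>n. 1 / real (Suc n)) (at 0) sequentially"
        using LIMSEQ_inverse_real_of_nat by (intro filterlim_atI) (auto simp: inverse_eq_divide)
    qed
    then show ?thesis by (rule limI[symmetric])
  qed
  have "(\<lambda>x. grad f x $ i) = (\<lambda>x. if x \<in> P then lim (\<lambda>n. q (1 / Suc n) x) else 0)"
    by (auto simp: grad_def diff lim fun_eq_iff)
  also have "\<dots> \<in> borel_measurable borel" by measurable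
  finally show ?thesis .
qed

lemma borel_measurable_norm_grad:
  fixes f :: "real ^ 'n \<Rightarrow> real"
  assumes cont: "continuous_on UNIV f"
  shows "(\<lambda>x. norm (grad f x)) \<in> borel_measurable borel"
  unfolding norm_vec_def L2_set_def using borel_measurable_grad_nth[OF cont] by measurable

lemma grad_nth_along_axis:
  "grad f (x + t *\<^sub>R axis i 1) $ i =
     (if (\<lambda>s. f (x + s *\<^sub>R axis i 1)) field_differentiable at t then deriv (\<lambda>s. f (x + s *\<^sub>R axis i 1)) t else 0)"
proof -
  let ?g = "\<lambda>s. f (x + s *\<^sub>R axis i 1)"
  have "(\<lambda>s. f (x + t *\<^sub>R axis i 1 + s *\<^sub>R axis i 1)) = (\<lambda>s. ?g (s + t))"
    by (simp add: algebra_simps scaleR_add_left)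
  moreover have "((\<lambda>s. ?g (s + t)) has_field_derivative D) (at 0) \<longleftrightarrow> (?g has_field_derivative D) (at t)" for D
    using DERIV_shift[of ?g D 0 t] by simp
  ultimately show ?thesis by (simp add: grad_def field_differentiable_def deriv_def)
qed

text \<open>The restriction of \<open>f\<close> to a line parallel to an axis is Lipschitz, and its derivative is a component of
  the gradient, with the same value \<open>0\<close> where it does not exist.\<close>
lemma axis_increment_le_grad:
  fixes f :: "real ^ 'n \<Rightarrow> real"
  assumes lip: "C-lipschitz_on UNIV f" and h: "0 \<le> h"
  shows "ennreal \<bar>f (x + h *\<^sub>R axis i 1) - f x\<bar>
      \<le> (\<integral>\<^sup>+t\<in>{0..h}. ennreal (norm (grad f (x + t *\<^sub>R axis i 1))) \<partial>lborel)"
proof -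
  have "C-lipschitz_on UNIV (\<lambda>t. f (x + t *\<^sub>R axis i 1))"
  proof (rule lipschitz_onI)
    fix s t :: real
    have "dist (f (x + s *\<^sub>R axis i 1)) (f (x + t *\<^sub>R axis i 1)) \<le> C * dist (x + s *\<^sub>R axis i 1) (x + t *\<^sub>R axis i 1)"
      by (intro lipschitz_onD[OF lip]) auto
    also have "dist (x + s *\<^sub>R axis i 1) (x + t *\<^sub>R axis i 1) = dist s t"
      by (simp add: dist_norm scaleR_diff_left[symmetric])
    finally show "dist (f (x + s *\<^sub>R axis i 1)) (f (x + t *\<^sub>R axis i 1)) \<le> C * dist s t" .
  qed (rule lipschitz_on_nonneg[OF lip])
  from lipschitz_increment_le_derivative[OF this h]
  have "ennreal \<bar>f (x + h *\<^sub>R axis i 1) - f x\<bar> \<le>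
      (\<integral>\<^sup>+t\<in>{0..h}. ennreal \<bar>grad f (x + t *\<^sub>R axis i 1) $ i\<bar> \<partial>lborel)"
    by (simp add: grad_nth_along_axis)
  also have "\<dots> \<le> (\<integral>\<^sup>+t\<in>{0..h}. ennreal (norm (grad f (x + t *\<^sub>R axis i 1))) \<partial>lborel)"
    by (intro nn_integral_mono mult_right_mono ennreal_leI component_le_norm_cart) auto
  finally show ?thesis .
qed

text \<open>The part of \<open>\<bar>y\<bar>\<close> between the heights \<open>s\<close> and \<open>2 * s\<close>, lowered to start at \<open>0\<close>.\<close>
definition band :: "real \<Rightarrow> real \<Rightarrow> real" where
  "band s y = min (max (\<bar>y\<bar> - s) 0) s"

text \<open>Where \<open>\<bar>f\<bar> \<le> s\<close> or \<open>\<bar>f\<bar> \<ge> 2 * s\<close>, the band function attains its minimum or maximum, so each of its partial derivatives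
  that exists is \<open>0\<close>. In between it coincides near the point with \<open>\<bar>f\<bar> - s\<close>, and differentiability of the band
  function gives that of \<open>f\<close>. Hence the estimate holds at every point, not just almost everywhere.\<close>
lemma norm_grad_band_le:
  fixes f :: "real ^ 'n \<Rightarrow> real"
  assumes cont: "continuous_on UNIV f" and s: "0 < s"
  shows "norm (grad (\<lambda>x. band s (f x)) x) \<le> norm (grad f x) * indicator {x. s < \<bar>f x\<bar> \<and> \<bar>f x\<bar> < 2 * s} x"
proof -
  have comp: "\<bar>grad (\<lambda>x. band s (f x)) x $ i\<bar> \<le> \<bar>grad f x $ i\<bar> * indicator {x. s < \<bar>f x\<bar> \<and> \<bar>f x\<bar> < 2 * s} x" for i
  proof -
    define g where "g t = f (x + t *\<^sub>R axis i 1)" for t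
    have g0: "g 0 = f x" by (simp add: g_def)
    have "continuous_on UNIV g"
      unfolding g_def by (intro continuous_on_compose2[OF cont] continuous_intros) auto
    then have "isCont g 0" by (simp add: continuous_on_eq_continuous_at)
    then have lim: "(g \<longlongrightarrow> g 0) (nhds 0)" by (simp add: continuous_within tendsto_at_iff_tendsto_nhds isCont_def)
    show ?thesis
    proof (cases "(\<lambda>t. band s (g t)) field_differentiable at 0")
      case True
      then obtain D where D: "((\<lambda>t. band s (g t)) has_real_derivative D) (at 0)"
        by (auto simp: field_differentiable_def)
      have gr: "grad (\<lambda>x. band s (f x)) x $ i = D"
        using True DERIV_imp_deriv[OF D] by (simp add: grad_def g_def)
      have gf: "grad f x $ i = D'" if "(g has_real_derivative D') (at 0)" for D'
        using that DERIV_imp_deriv[OF that] unfolding grad_def g_def field_differentiable_def by auto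
      consider "\<bar>f x\<bar> \<le> s" | "2 * s \<le> \<bar>f x\<bar>" | "s < f x" "f x < 2 * s" | "s < - f x" "- f x < 2 * s" by linarith
      then show ?thesis
      proof cases
        case 1
        have "D = 0" by (rule DERIV_local_min[OF D, of 1]) (use 1 s in \<open>auto simp: g0 band_def\<close>)
        then show ?thesis by (simp add: gr)
      next
        case 2
        have "D = 0" by (rule DERIV_local_max[OF D, of 1]) (use 2 s in \<open>auto simp: g0 band_def\<close>)
        then show ?thesis by (simp add: gr)
      next
        case 3
        then have "\<forall>\<^sub>F t in nhds 0. s < g t" "\<forall>\<^sub>F t in nhds 0. g t < 2 * s"
          using lim by (auto intro!: order_tendstoD simp: g0)
        then have "\<forall>\<^sub>F t in nhds 0. g t = band s (g t) + s"
          by eventually_elim (use s in \<open>auto simp: band_def\<close>)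
        moreover have "((\<lambda>t. band s (g t) + s) has_real_derivative D) (at 0)"
          using D by (auto intro!: derivative_eq_intros)
        ultimately have "(g has_real_derivative D) (at 0)"
          by (subst DERIV_cong_ev[OF refl _ refl]) auto
        with gf 3 s show ?thesis by (auto simp: gr)
      next
        case 4
        then have "\<forall>\<^sub>F t in nhds 0. g t < - s" "\<forall>\<^sub>F t in nhds 0. - 2 * s < g t"
          using lim by (auto intro!: order_tendstoD simp: g0)
        then have "\<forall>\<^sub>F t in nhds 0. g t = - (band s (g t) + s)"
          by eventually_elim (use s in \<open>auto simp: band_def\<close>)
        moreover have "((\<lambda>t. - (band s (g t) + s)) has_real_derivative - D) (at 0)"
          using D by (auto intro!: derivative_eq_intros)
        ultimately have "(g has_real_derivative - D) (at 0)"
          by (subst DERIV_cong_ev[OF refl _ refl]) auto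
        with gf 4 s show ?thesis by (auto simp: gr)
      qed
    qed (simp add: grad_def g_def)
  qed
  show ?thesis
  proof (cases "s < \<bar>f x\<bar> \<and> \<bar>f x\<bar> < 2 * s")
    case True
    then show ?thesis using comp by (auto intro!: norm_le_componentwise_cart)
  next
    case False
    then have "grad (\<lambda>x. band s (f x)) x $ i = 0" for i using comp[of i] by auto
    then have "grad (\<lambda>x. band s (f x)) x = 0" by (simp add: vec_eq_iff)
    then show ?thesis by simp
  qed
qed

section \<open>Maximal functions of nested partitions\<close>

text \<open>A map \<open>c\<close> with countably many values partitions the space into its fibres; this is the integral over
  the fibre containing \<open>x\<close>.\<close>
definition fibre_int :: "'a measure \<Rightarrow> ('a \<Rightarrow> 'b) \<Rightarrow> ('a \<Rightarrow> ennreal) \<Rightarrow> 'a \<Rightarrow> ennreal" where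
  "fibre_int M c f x = (\<integral>\<^sup>+y. f y * indicator (c -` {c x}) y \<partial>M)"

text \<open>The maximal function of a sequence of partitions. Since \<open>0 / 0 = 0\<close> in \<^typ>\<open>ennreal\<close>, null fibres do not contribute.\<close>
definition max_fun :: "'a measure \<Rightarrow> (int \<Rightarrow> 'a \<Rightarrow> 'b) \<Rightarrow> ('a \<Rightarrow> ennreal) \<Rightarrow> 'a \<Rightarrow> ennreal" where
  "max_fun M c f x = (SUP k. fibre_int M (c k) f x / fibre_int M (c k) (\<lambda>_. 1) x)"

lemma fibre_int_cong: "c x = c y \<Longrightarrow> fibre_int M c f x = fibre_int M c f y"
  by (simp add: fibre_int_def)

lemma fibre_int_mono: "(\<And>x. f x \<le> g x) \<Longrightarrow> fibre_int M c f x \<le> fibre_int M c g x"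
  unfolding fibre_int_def by (intro nn_integral_mono mult_right_mono) auto

lemma fibre_int_le: "fibre_int M c f x \<le> (\<integral>\<^sup>+y. f y \<partial>M)"
  unfolding fibre_int_def by (intro nn_integral_mono) (auto split: split_indicator)

context
  fixes M :: "'a measure" and c :: "'a \<Rightarrow> 'b :: countable"
  assumes c: "c \<in> M \<rightarrow>\<^sub>M count_space UNIV"
begin

lemma fibre_sets [measurable]: "(indicator (c -` {m}) :: 'a \<Rightarrow> ennreal) \<in> borel_measurable M"
proof -
  have [measurable]: "c -` {m} \<inter> space M \<in> sets M" using c by (rule measurable_sets) auto
  have "(indicator (c -` {m} \<inter> space M) :: 'a \<Rightarrow> ennreal) \<in> borel_measurable M" by measurable
  then show ?thesis by (rule measurable_cong[THEN iffD1, rotated]) (auto split: split_indicator)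
qed

lemma borel_measurable_fibre_int [measurable]: "fibre_int M c f \<in> borel_measurable M"
proof -
  have "fibre_int M c f = (\<lambda>x. (\<lambda>m. \<integral>\<^sup>+y. f y * indicator (c -` {m}) y \<partial>M) (c x))"
    by (simp add: fibre_int_def fun_eq_iff)
  also have "\<dots> \<in> borel_measurable M"
    by (rule measurable_compose[OF c]) simp
  finally show ?thesis .
qed

lemma nn_integral_fibres:
  assumes [measurable]: "f \<in> borel_measurable M"
  shows "(\<integral>\<^sup>+x. f x \<partial>M) = (\<Sum>\<^sup>+m. (\<integral>\<^sup>+x. f x * indicator (c -` {m}) x \<partial>M))"
proof -
  have "(\<Sum>\<^sup>+m. (\<integral>\<^sup>+x. f x * indicator (c -` {m}) x \<partial>M))
      = (\<integral>\<^sup>+x. (\<Sum>\<^sup>+m. f x * indicator (c -` {m}) x) \<partial>M)"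
    by (subst nn_integral_count_space_nn_integral) auto
  also have "\<dots> = (\<integral>\<^sup>+x. f x \<partial>M)"
  proof (intro nn_integral_cong)
    fix x
    have "(\<Sum>\<^sup>+m. f x * indicator (c -` {m}) x) = (\<Sum>\<^sup>+m. f x * indicator {c x} m)"
      by (intro nn_integral_cong) (auto split: split_indicator)
    then show "(\<Sum>\<^sup>+m. f x * indicator (c -` {m}) x) = f x"
      by (simp add: nn_integral_cmult_indicator)
  qed
  finally show ?thesis by simp
qed

text \<open>Both sides are the sum over the fibres of the product of the two integrals.\<close>
lemma fibre_int_duality:
  assumes [measurable]: "f \<in> borel_measurable M" "g \<in> borel_measurable M"
  shows "(\<integral>\<^sup>+x. f x * fibre_int M c g x \<partial>M) = (\<integral>\<^sup>+x. g x * fibre_int M c f x \<partial>M)"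
proof -
  have *: "(\<integral>\<^sup>+x. f x * fibre_int M c g x \<partial>M) =
    (\<Sum>\<^sup>+m. (\<integral>\<^sup>+x. f x * indicator (c -` {m}) x \<partial>M) * (\<integral>\<^sup>+x. g x * indicator (c -` {m}) x \<partial>M))"
    if [measurable]: "f \<in> borel_measurable M" for f g
  proof -
    have "(\<integral>\<^sup>+x. f x * fibre_int M c g x * indicator (c -` {m}) x \<partial>M) =
        (\<integral>\<^sup>+x. f x * indicator (c -` {m}) x * (\<integral>\<^sup>+x. g x * indicator (c -` {m}) x \<partial>M) \<partial>M)" for m
      by (intro nn_integral_cong) (auto simp: fibre_int_def split: split_indicator)
    then show ?thesis
      by (subst nn_integral_fibres) (auto simp: nn_integral_multc)
  qed
  show ?thesis by (simp add: * mult.commute)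
qed

lemma nn_integral_saturated_mono:
  assumes [measurable]: "f \<in> borel_measurable M" "g \<in> borel_measurable M" "S \<in> sets M"
    and sat: "\<And>x y. x \<in> S \<Longrightarrow> y \<in> space M \<Longrightarrow> c x = c y \<Longrightarrow> y \<in> S"
    and le: "\<And>x. x \<in> S \<Longrightarrow> fibre_int M c f x \<le> fibre_int M c g x"
  shows "(\<integral>\<^sup>+x\<in>S. f x \<partial>M) \<le> (\<integral>\<^sup>+x\<in>S. g x \<partial>M)"
proof -
  have "(\<integral>\<^sup>+x. f x * indicator S x * indicator (c -` {m}) x \<partial>M)
     \<le> (\<integral>\<^sup>+x. g x * indicator S x * indicator (c -` {m}) x \<partial>M)" for m
  proof (cases "\<exists>x\<in>S. c x = m")
    case True
    then obtain x where x: "x \<in> S" "c x = m" by blast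
    have "(\<integral>\<^sup>+x. h x * indicator S x * indicator (c -` {m}) x \<partial>M) = fibre_int M c h x" for h
      unfolding fibre_int_def using sat[OF x(1)] x(2)
      by (intro nn_integral_cong) (auto split: split_indicator)
    then show ?thesis using le[OF x(1)] by simp
  next
    case False
    then have "(\<integral>\<^sup>+x. f x * indicator S x * indicator (c -` {m}) x \<partial>M) = (\<integral>\<^sup>+x. 0 \<partial>M)"
      by (intro nn_integral_cong) (auto split: split_indicator)
    then show ?thesis by simp
  qed
  then have "(\<Sum>\<^sup>+m. (\<integral>\<^sup>+x. f x * indicator S x * indicator (c -` {m}) x \<partial>M))
     \<le> (\<Sum>\<^sup>+m. (\<integral>\<^sup>+x. g x * indicator S x * indicator (c -` {m}) x \<partial>M))"
    by (rule nn_integral_mono)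
  then show ?thesis by (subst (1 2) nn_integral_fibres) auto
qed

end

lemma ennreal_less_divide_imp:
  fixes t a b :: ennreal
  assumes "t < a / b" shows "t * b \<le> a"
proof (cases "b = 0 \<or> b = top")
  case False
  have "t * b \<le> a / b * b" using assms by (intro mult_right_mono) auto
  also have "\<dots> = a" using False by (simp add: ennreal_divide_times less_top)
  finally show ?thesis .
qed (use assms in auto)

text \<open>The largest \<open>j\<close> with \<open>2 powr j < v\<close> already contributes enough; for \<open>v = top\<close> the sum diverges.\<close>
lemma epowr_le_dyadic_sum:
  assumes r: "0 < r"
  shows "v epowr r \<le> (\<Sum>\<^sup>+j. ennreal (2 powr (real_of_int (j + 1) * r)) * indicator {j. ennreal (pow2 j) < v} j)"
    (is "_ \<le> ?S v")
proof -
  have ge: "ennreal (2 powr (real_of_int (j + 1) * r)) \<le> ?S v" if "ennreal (pow2 j) < v" for j v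
    using nn_integral_ge_point[of j UNIV "\<lambda>j. ennreal (2 powr (real_of_int (j + 1) * r)) * indicator {j. ennreal (pow2 j) < v} j"] that
    by simp
  show ?thesis
  proof (cases v)
    case (real y)
    show ?thesis
    proof (cases "y = 0")
      case False
      with real have y: "0 < y" by simp
      define j where "j = \<lceil>log 2 y\<rceil> - 1"
      have j: "real_of_int j < log 2 y" "log 2 y \<le> j + 1" unfolding j_def by linarith+
      have "pow2 j < y" using j y by (simp add: less_log_iff[symmetric])
      then have 1: "ennreal (pow2 j) < v" using real by (simp add: ennreal_less_iff)
      have "y \<le> 2 powr (real_of_int (j + 1))" using j y by (simp add: log_le_iff[symmetric])
      then have "y powr r \<le> (2 powr (real_of_int (j + 1))) powr r" using y r by (intro powr_mono2) auto
      also have "\<dots> = 2 powr (real_of_int (j + 1) * r)" by (rule powr_powr)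
      finally have "v epowr r \<le> ennreal (2 powr (real_of_int (j + 1) * r))"
        using real by (simp add: epowr_ennreal ennreal_leI)
      with ge[OF 1] show ?thesis by simp
    qed (simp add: real)
  next
    case top
    have "?S top = top"
    proof (rule ccontr)
      assume "?S top \<noteq> top"
      then obtain b where b: "?S top = ennreal b" "0 \<le> b" by (cases "?S top") auto
      obtain n where n: "b < (2 powr r) ^ n" using real_arch_pow[of "2 powr r" b] r by auto
      have "ennreal (2 powr (real_of_int (int n - 1 + 1) * r)) \<le> ?S top" by (rule ge) simp
      moreover have "2 powr (real_of_int (int n - 1 + 1) * r) = (2 powr r) ^ n"
        by (simp add: powr_power mult.commute)
      ultimately show False using b n by (simp add: ennreal_le_iff)
    qed
    then show ?thesis using top by simp
  qed
qed

context
  fixes M :: "'a measure" and c :: "int \<Rightarrow> 'a \<Rightarrow> 'b :: countable"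
  assumes c: "\<And>k. c k \<in> M \<rightarrow>\<^sub>M count_space UNIV"
    and nested: "\<And>k l x y. c k x = c k y \<Longrightarrow> k \<le> l \<Longrightarrow> c l x = c l y"
begin

lemma borel_measurable_max_fun [measurable]: "max_fun M c f \<in> borel_measurable M"
  unfolding max_fun_def
  by (intro borel_measurable_SUP borel_measurable_divide_ennreal borel_measurable_fibre_int c) auto

text \<open>A stopping-time argument. Among the generations up to \<open>K\<close>, each point of the level set has a coarsest
  one whose average exceeds \<open>t\<close>. By nestedness the points with a given coarsest generation form a union
  of fibres of that generation, and on each of these fibres \<open>t\<close> times the measure is at most the
  integral of \<open>f\<close>. The level sets for the various \<open>K\<close> increase to the full one.\<close>
lemma max_fun_weak_type:
  assumes [measurable]: "f \<in> borel_measurable M"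
  shows "t * emeasure M {x \<in> space M. t < max_fun M c f x} \<le> (\<integral>\<^sup>+x. f x \<partial>M)"
proof -
  define P where "P k = {x \<in> space M. t < fibre_int M (c k) f x / fibre_int M (c k) (\<lambda>_. 1) x}" for k
  have [measurable]: "fibre_int M (c k) g \<in> borel_measurable M" for k g
    by (rule borel_measurable_fibre_int[OF c])
  have [measurable]: "P k \<in> sets M" for k unfolding P_def by measurable
  have step: "t * emeasure M (\<Union>n. P (int K - int n)) \<le> (\<integral>\<^sup>+x. f x \<partial>M)" for K :: nat
  proof -
    \<comment> \<open>\<open>D n\<close> consists of the points whose coarsest generation with large average is \<open>K - n\<close>.\<close>
    define D where "D = disjointed (\<lambda>n. P (int K - int n))"
    have [measurable]: "D n \<in> sets M" for n
      using sets.range_disjointed_sets[of "\<lambda>n. P (int K - int n)" M] \<open>\<And>k. P k \<in> sets M\<close>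
      unfolding D_def by blast
    have disj: "disjoint_family D" unfolding D_def by (rule disjoint_family_disjointed)
    have Dle: "t * emeasure M (D n) \<le> (\<integral>\<^sup>+x\<in>D n. f x \<partial>M)" for n
    proof -
      have "(\<integral>\<^sup>+x\<in>D n. t \<partial>M) \<le> (\<integral>\<^sup>+x\<in>D n. f x \<partial>M)"
      proof (rule nn_integral_saturated_mono[OF c[of "int K - int n"]])
        fix x y assume x: "x \<in> D n" and y: "y \<in> space M" and eq: "c (int K - int n) x = c (int K - int n) y"
        have "c (int K - int m) x = c (int K - int m) y" if "m \<le> n" for m
          using that by (intro nested[OF eq]) auto
        then have "x \<in> P (int K - int m) \<longleftrightarrow> y \<in> P (int K - int m)" if "m \<le> n" for m
          using fibre_int_cong[of "c (int K - int m)" x y] that x y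
          by (auto simp: P_def D_def disjointed_def)
        with x show "y \<in> D n" by (auto simp: D_def disjointed_def)
      next
        fix x assume "x \<in> D n"
        then have "x \<in> P (int K - int n)" by (auto simp: D_def disjointed_def)
        then have "t * fibre_int M (c (int K - int n)) (\<lambda>_. 1) x \<le> fibre_int M (c (int K - int n)) f x"
          unfolding P_def by (auto intro: ennreal_less_divide_imp)
        then show "fibre_int M (c (int K - int n)) (\<lambda>_. t) x \<le> fibre_int M (c (int K - int n)) f x"
          using fibre_sets[OF c] by (simp add: fibre_int_def nn_integral_cmult)
      qed auto
      then show ?thesis by (simp add: nn_integral_cmult_indicator)
    qed
    have "t * emeasure M (\<Union>n. P (int K - int n)) = t * emeasure M (\<Union>n. D n)"
      by (simp add: D_def UN_disjointed_eq)
    also have "\<dots> = (\<Sum>n. t * emeasure M (D n))"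
      using disj by (subst suminf_emeasure[symmetric]) auto
    also have "\<dots> \<le> (\<Sum>n. \<integral>\<^sup>+x\<in>D n. f x \<partial>M)"
      by (intro suminf_le Dle) auto
    also have "\<dots> = (\<integral>\<^sup>+x\<in>(\<Union>n. D n). f x \<partial>M)"
      using disj by (intro nn_integral_disjoint_family[symmetric]) auto
    also have "\<dots> \<le> (\<integral>\<^sup>+x. f x \<partial>M)"
      by (intro nn_integral_mono) (auto split: split_indicator)
    finally show ?thesis .
  qed
  define A where "A K = (\<Union>n. P (int K - int n))" for K :: nat
  have "incseq A"
  proof (rule incseq_SucI)
    fix K
    have "P (int K - int n) \<subseteq> A (Suc K)" for n
      unfolding A_def by (rule subset_trans[OF _ UN_upper[of "Suc n"]]) auto
    then show "A K \<subseteq> A (Suc K)" by (auto simp: A_def)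
  qed
  have "{x \<in> space M. t < max_fun M c f x} = (\<Union>K. A K)"
  proof (intro set_eqI iffI)
    fix x assume "x \<in> {x \<in> space M. t < max_fun M c f x}"
    then obtain k where "x \<in> P k" by (auto simp: max_fun_def less_SUP_iff P_def)
    moreover have "k = int (nat \<bar>k\<bar>) - int (nat (\<bar>k\<bar> - k))" by auto
    ultimately show "x \<in> (\<Union>K. A K)" unfolding A_def by (metis UN_I UNIV_I)
  qed (auto simp: A_def P_def max_fun_def less_SUP_iff)
  moreover have "emeasure M (\<Union>K. A K) = (SUP K. emeasure M (A K))"
  proof (rule SUP_emeasure_incseq[OF _ \<open>incseq A\<close>, symmetric])
    have "A K \<in> sets M" for K unfolding A_def by auto
    then show "range A \<subseteq> sets M" by blast
  qed
  ultimately have "t * emeasure M {x \<in> space M. t < max_fun M c f x} = (SUP K. t * emeasure M (A K))"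
    by (simp add: SUP_mult_left_ennreal)
  also have "\<dots> \<le> (\<integral>\<^sup>+x. f x \<partial>M)" unfolding A_def by (intro SUP_least step)
  finally show ?thesis .
qed

text \<open>The part of \<open>f\<close> below height \<open>t\<close> has averages at most \<open>t\<close>, so only the part above \<open>t\<close> can lift the
  maximal function beyond \<open>2 * t\<close>.\<close>
lemma max_fun_weak_type_truncated:
  assumes [measurable]: "f \<in> borel_measurable M"
  shows "ennreal t * emeasure M {x \<in> space M. ennreal (2 * t) < max_fun M c f x}
    \<le> (\<integral>\<^sup>+x. f x * indicator {x. ennreal t < f x} x \<partial>M)"
proof (cases "0 < t")
  case True
  define g where "g x = f x * indicator {x. ennreal t < f x} x" for x
  have [measurable]: "g \<in> borel_measurable M" unfolding g_def by measurable
  have le: "max_fun M c f x \<le> max_fun M c g x + ennreal t" for x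
    unfolding max_fun_def
  proof (rule SUP_least)
    fix k
    let ?I = "\<lambda>f. fibre_int M (c k) f x"
    have [measurable]: "(indicator (c k -` {m}) :: 'a \<Rightarrow> ennreal) \<in> borel_measurable M" for m
      by (rule fibre_sets[OF c])
    have "?I f \<le> ?I (\<lambda>x. g x + ennreal t)"
      by (rule fibre_int_mono) (auto simp: g_def split: split_indicator)
    also have "\<dots> = ?I g + ennreal t * ?I (\<lambda>_. 1)"
      unfolding fibre_int_def distrib_right mult_1
      by (subst nn_integral_add) (auto simp: nn_integral_cmult)
    finally have "?I f / ?I (\<lambda>_. 1) \<le> ?I g / ?I (\<lambda>_. 1) + ennreal t * ?I (\<lambda>_. 1) / ?I (\<lambda>_. 1)"
      by (simp add: add_divide_distrib_ennreal[symmetric] divide_right_mono_ennreal)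
    also have "ennreal t * ?I (\<lambda>_. 1) / ?I (\<lambda>_. 1) \<le> ennreal t"
      by (cases "?I (\<lambda>_. 1) = 0 \<or> ?I (\<lambda>_. 1) = top") (auto simp: mult_divide_eq_ennreal)
    finally show "?I f / ?I (\<lambda>_. 1) \<le> (SUP k. fibre_int M (c k) g x / fibre_int M (c k) (\<lambda>_. 1) x) + ennreal t"
      by (rule order_trans[OF _ add_right_mono[OF SUP_upper]]) auto
  qed
  have sub: "{x \<in> space M. ennreal (2 * t) < max_fun M c f x} \<subseteq> {x \<in> space M. ennreal t < max_fun M c g x}"
  proof clarify
    fix x assume "ennreal (2 * t) < max_fun M c f x"
    then have "ennreal t + ennreal t < max_fun M c g x + ennreal t"
      using le[of x] True by (auto simp: ennreal_plus[symmetric] simp del: ennreal_plus)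
    then show "ennreal t < max_fun M c g x" 
      by (meson add_right_mono leD leI)
  qed
  have [measurable]: "max_fun M c g \<in> borel_measurable M" by (rule borel_measurable_max_fun)
  have "ennreal t * emeasure M {x \<in> space M. ennreal (2 * t) < max_fun M c f x}
     \<le> ennreal t * emeasure M {x \<in> space M. ennreal t < max_fun M c g x}"
    by (intro mult_left_mono emeasure_mono sub) auto
  also have "\<dots> \<le> (\<integral>\<^sup>+x. g x \<partial>M)" by (rule max_fun_weak_type) simp
  finally show ?thesis by (simp add: g_def)
qed (simp add: ennreal_neg)

text \<open>Doob's maximal inequality. Integrating the truncated weak-type bound over the dyadic levels leaves
  a geometric sum, whose constant does not depend on the measure. This uniformity is what allows
  the weighted estimates further down.\<close>
lemma max_fun_strong_type:
  assumes f [measurable]: "f \<in> borel_measurable M" and r: "1 < r"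
  shows "(\<integral>\<^sup>+x. max_fun M c f x epowr r \<partial>M) \<le> ennreal (2 powr (2 * r) * geom (r - 1)) * (\<integral>\<^sup>+x. f x epowr r \<partial>M)"
proof -
  have [measurable]: "max_fun M c f \<in> borel_measurable M" by (rule borel_measurable_max_fun)
  let ?w = "\<lambda>j. 2 powr (real_of_int (j + 1) * r)"
  let ?t = "\<lambda>j. pow2 j / 2"
  have level: "ennreal (?w j) * emeasure M {x \<in> space M. ennreal (pow2 j) < max_fun M c f x}
     \<le> (\<integral>\<^sup>+x. ennreal (?w j / ?t j) * (f x * indicator {x. ennreal (?t j) < f x} x) \<partial>M)" for j
  proof -
    have "ennreal (?w j) * emeasure M {x \<in> space M. ennreal (pow2 j) < max_fun M c f x}
      = ennreal (?w j / ?t j) * (ennreal (?t j) * emeasure M {x \<in> space M. ennreal (2 * ?t j) < max_fun M c f x})"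
      by (simp add: mult.assoc[symmetric] ennreal_mult[symmetric])
    also have "\<dots> \<le> ennreal (?w j / ?t j) * (\<integral>\<^sup>+x. f x * indicator {x. ennreal (?t j) < f x} x \<partial>M)"
      by (intro mult_left_mono max_fun_weak_type_truncated) auto
    finally show ?thesis by (simp add: nn_integral_cmult)
  qed
  have sum: "(\<Sum>\<^sup>+j. ennreal (?w j / ?t j) * (v * indicator {j. ennreal (?t j) < v} j))
      \<le> ennreal (2 powr (2 * r) * geom (r - 1)) * v epowr r" for v
  proof (cases v)
    case (real y)
    show ?thesis
    proof (cases "y = 0")
      case False
      with real have y: "0 < y" by simp
      have "(\<Sum>\<^sup>+j. ennreal (?w j / ?t j) * (v * indicator {j. ennreal (?t j) < v} j))
        = (\<Sum>\<^sup>+j. ennreal (2 powr (r + 1) * y) * (ennreal (2 powr (real_of_int j * (r - 1))) * indicator {j. pow2 j < 2 * y} j))"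
      proof (intro nn_integral_cong)
        fix j :: int
        have "?w j / ?t j * y = 2 powr (r + 1) * y * 2 powr (real_of_int j * (r - 1))"
          by (simp add: powr_add powr_diff distrib_right right_diff_distrib)
        then show "ennreal (?w j / ?t j) * (v * indicator {j. ennreal (?t j) < v} j)
          = ennreal (2 powr (r + 1) * y) * (ennreal (2 powr (real_of_int j * (r - 1))) * indicator {j. pow2 j < 2 * y} j)"
          using y unfolding real by (auto simp: ennreal_mult[symmetric] ennreal_less_iff split: split_indicator)
      qed
      also have "\<dots> = ennreal (2 powr (r + 1) * y) * (\<Sum>\<^sup>+j. ennreal (2 powr (real_of_int j * (r - 1))) * indicator {j. pow2 j < 2 * y} j)"
        by (rule nn_integral_cmult) simp
      also have "\<dots> \<le> ennreal (2 powr (r + 1) * y) * ennreal (geom (r - 1) * (2 * y) powr (r - 1))"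
        using r y by (intro mult_left_mono nn_integral_dyadic_below) auto
      also have "\<dots> = ennreal (2 powr (2 * r) * geom (r - 1) * y powr r)"
      proof -
        have "2 powr (r + 1) * y * (geom (r - 1) * (2 * y) powr (r - 1))
           = (2 powr (r + 1) * 2 powr (r - 1)) * geom (r - 1) * (y powr 1 * y powr (r - 1))"
          using y by (simp add: powr_mult)
        also have "\<dots> = 2 powr (2 * r) * geom (r - 1) * y powr r"
          unfolding powr_add[symmetric] by simp
        finally show ?thesis using y r geom_pos[of "r - 1"] by (simp add: ennreal_mult[symmetric])
      qed
      also have "\<dots> = ennreal (2 powr (2 * r) * geom (r - 1)) * v epowr r"
        using y r geom_pos[of "r - 1"] unfolding real by (simp add: epowr_ennreal ennreal_mult)
      finally show ?thesis .
    qed (simp add: real)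
  next
    case top
    then show ?thesis using r geom_pos[of "r - 1"] by (simp add: ennreal_mult_top)
  qed
  have "(\<integral>\<^sup>+x. max_fun M c f x epowr r \<partial>M)
    \<le> (\<integral>\<^sup>+x. (\<Sum>\<^sup>+j. ennreal (?w j) * indicator {j. ennreal (pow2 j) < max_fun M c f x} j) \<partial>M)"
    using r by (intro nn_integral_mono epowr_le_dyadic_sum) auto
  also have "\<dots> = (\<integral>\<^sup>+x. (\<Sum>\<^sup>+j. ennreal (?w j) * indicator {x \<in> space M. ennreal (pow2 j) < max_fun M c f x} x) \<partial>M)"
    by (intro nn_integral_cong) (auto split: split_indicator)
  also have "\<dots> = (\<Sum>\<^sup>+j. ennreal (?w j) * emeasure M {x \<in> space M. ennreal (pow2 j) < max_fun M c f x})"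
    by (subst nn_integral_count_space_nn_integral) (auto simp: nn_integral_cmult_indicator)
  also have "\<dots> \<le> (\<Sum>\<^sup>+j. (\<integral>\<^sup>+x. ennreal (?w j / ?t j) * (f x * indicator {x. ennreal (?t j) < f x} x) \<partial>M))"
    by (intro nn_integral_mono level)
  also have "\<dots> = (\<integral>\<^sup>+x. (\<Sum>\<^sup>+j. ennreal (?w j / ?t j) * (f x * indicator {x. ennreal (?t j) < f x} x)) \<partial>M)"
    by (subst nn_integral_count_space_nn_integral) auto
  also have "\<dots> = (\<integral>\<^sup>+x. (\<Sum>\<^sup>+j. ennreal (?w j / ?t j) * (f x * indicator {j. ennreal (?t j) < f x} j)) \<partial>M)"
    by (intro nn_integral_cong) (auto split: split_indicator)
  also have "\<dots> \<le> (\<integral>\<^sup>+x. ennreal (2 powr (2 * r) * geom (r - 1)) * f x epowr r \<partial>M)"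
    by (intro nn_integral_mono sum)
  also have "\<dots> = ennreal (2 powr (2 * r) * geom (r - 1)) * (\<integral>\<^sup>+x. f x epowr r \<partial>M)"
    by (rule nn_integral_cmult) simp
  finally show ?thesis .
qed

end

section \<open>Dyadic cubes and the pointwise bound by a fractional integral\<close>

text \<open>Compare \<open>F\<close> on \<open>A\<close> with \<open>F\<close> on the translate of \<open>A\<close> inside \<open>B - A\<close>. The error is an integral of \<open>G\<close> along the
  segment between the two points; by Tonelli and translation invariance it integrates to at most
  \<open>h\<close> times the integral of \<open>G\<close> over \<open>B\<close>.\<close>
lemma translate_half_le:
  fixes F G :: "'a::euclidean_space \<Rightarrow> ennreal"
  assumes [measurable]: "F \<in> borel_measurable borel" "G \<in> borel_measurable borel" "A \<in> sets borel" "B \<in> sets borel"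
    and h: "0 \<le> h" and AB: "A \<subseteq> B"
    and shift: "\<And>y. y \<in> A \<Longrightarrow> y + \<tau> *\<^sub>R e \<in> B - A"
    and path: "\<And>y t. y \<in> A \<Longrightarrow> t \<in> {0..h} \<Longrightarrow> y + (s + t) *\<^sub>R e \<in> B"
    and le: "\<And>y. y \<in> A \<Longrightarrow> F y \<le> F (y + \<tau> *\<^sub>R e) + (\<integral>\<^sup>+t\<in>{0..h}. G (y + (s + t) *\<^sub>R e) \<partial>lborel)"
  shows "2 * lint A F \<le> lint B F + ennreal h * lint B G"
proof -
  have trans: "(\<integral>\<^sup>+y. g (y + v) \<partial>lborel) = (\<integral>\<^sup>+y. g y \<partial>lborel)"
    if [measurable]: "g \<in> borel_measurable borel" for g :: "'a \<Rightarrow> ennreal" and v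
  proof -
    have "(\<integral>\<^sup>+y. g y \<partial>lborel) = (\<integral>\<^sup>+y. g y \<partial>distr lborel borel ((+) v))"
      by (simp add: lborel_distr_plus)
    also have "\<dots> = (\<integral>\<^sup>+y. g (v + y) \<partial>lborel)" by (subst nn_integral_distr) auto
    finally show ?thesis by (simp add: add.commute)
  qed
  have "lint A F \<le>
      (\<integral>\<^sup>+y. F (y + \<tau> *\<^sub>R e) * indicator A y + (\<integral>\<^sup>+t. G (y + (s + t) *\<^sub>R e) * indicator A y * indicator {0..h} t \<partial>lborel) \<partial>lborel)"
    using le by (intro nn_integral_mono) (auto split: split_indicator)
  also have "\<dots> = (\<integral>\<^sup>+y. F (y + \<tau> *\<^sub>R e) * indicator A y \<partial>lborel)
      + (\<integral>\<^sup>+y. (\<integral>\<^sup>+t. G (y + (s + t) *\<^sub>R e) * indicator A y * indicator {0..h} t \<partial>lborel) \<partial>lborel)"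
    by (rule nn_integral_add) measurable
  also have "(\<integral>\<^sup>+y. (\<integral>\<^sup>+t. G (y + (s + t) *\<^sub>R e) * indicator A y * indicator {0..h} t \<partial>lborel) \<partial>lborel)
      = (\<integral>\<^sup>+t. (\<integral>\<^sup>+y. G (y + (s + t) *\<^sub>R e) * indicator A y * indicator {0..h} t \<partial>lborel) \<partial>lborel)"
    by (rule lborel_pair.Fubini') measurable
  also have "\<dots> \<le> (\<integral>\<^sup>+t. (\<integral>\<^sup>+y. G (y + (s + t) *\<^sub>R e) * indicator B (y + (s + t) *\<^sub>R e) \<partial>lborel) * indicator {0..h} t \<partial>lborel)"
  proof (intro nn_integral_mono)
    fix t :: real
    show "(\<integral>\<^sup>+y. G (y + (s + t) *\<^sub>R e) * indicator A y * indicator {0..h} t \<partial>lborel)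
      \<le> (\<integral>\<^sup>+y. G (y + (s + t) *\<^sub>R e) * indicator B (y + (s + t) *\<^sub>R e) \<partial>lborel) * indicator {0..h} t"
      using path by (cases "t \<in> {0..h}") (auto intro!: nn_integral_mono split: split_indicator)
  qed
  also have "\<dots> = (\<integral>\<^sup>+t. lint B G * indicator {0..h} t \<partial>lborel)"
    using trans[of "\<lambda>y. G y * indicator B y"] by simp
  also have "\<dots> = ennreal h * lint B G"
    using h by (subst nn_integral_cmult_indicator) (auto simp: mult.commute)
  also have "(\<integral>\<^sup>+y. F (y + \<tau> *\<^sub>R e) * indicator A y \<partial>lborel)
      \<le> (\<integral>\<^sup>+y. F (y + \<tau> *\<^sub>R e) * indicator (B - A) (y + \<tau> *\<^sub>R e) \<partial>lborel)"
    using shift by (intro nn_integral_mono) (auto split: split_indicator)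
  also have "\<dots> = lint (B - A) F"
    using trans[of "\<lambda>y. F y * indicator (B - A) y"] by simp
  finally have "lint A F \<le> lint (B - A) F + ennreal h * lint B G"
    by (auto simp: add_right_mono)
  then have "2 * lint A F
      \<le> lint A F + lint (B - A) F + ennreal h * lint B G"
    by (simp add: mult_2 add.assoc add_left_mono)
  also have "lint A F + lint (B - A) F = lint B F"
    using AB by (subst nn_integral_add[symmetric]) (auto intro!: nn_integral_cong split: split_indicator)
  finally show ?thesis .
qed

text \<open>The index of the half-open dyadic cube of side \<open>2 powr k\<close> containing \<open>x\<close>; its fibres are these cubes.\<close>
definition dyad :: "int \<Rightarrow> real ^ 'n \<Rightarrow> int ^ 'n" where
  "dyad k x = (\<chi> i. \<lfloor>x $ i / pow2 k\<rfloor>)"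

lemma measurable_dyad: "dyad k \<in> borel \<rightarrow>\<^sub>M count_space UNIV"
proof -
  have "dyad k -` {m} \<inter> space borel \<in> sets borel" for m :: "int ^ 'n"
  proof -
    have "dyad k -` {m} = (\<Inter>i. {x. \<lfloor>x $ i / pow2 k\<rfloor> = m $ i})"
      by (auto simp: dyad_def vec_eq_iff)
    also have "\<dots> \<in> sets borel" by (intro sets.countable_INT') auto
    finally show ?thesis by simp
  qed
  then show ?thesis by (subst measurable_count_space_eq_countable) auto
qed

lemma floor_half_scale: "\<lfloor>x / pow2 (k + int d)\<rfloor> = \<lfloor>x / pow2 k\<rfloor> div 2 ^ d"
proof -
  have "x / pow2 (k + int d) = (x / pow2 k) / real_of_int (2 ^ d)"
    by (simp add: powr_add powr_realpow)
  then show ?thesis by (simp only: floor_divide_real_eq_div zero_le_power zero_le_numeral)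
qed

lemma dyad_nested: "dyad k x = dyad k y \<Longrightarrow> k \<le> l \<Longrightarrow> dyad l x = dyad l y"
  using floor_half_scale[of _ k "nat (l - k)"] by (simp add: dyad_def vec_eq_iff)

text \<open>The box around \<open>x\<close> that is dyadic of generation \<open>k\<close> in the coordinates from \<open>S\<close> and of the coarser generation
  \<open>k + 1\<close> in the others. It interpolates between a dyadic cube and its parent.\<close>
definition dyad_mix :: "'n set \<Rightarrow> int \<Rightarrow> real ^ 'n \<Rightarrow> (real ^ 'n) set" where
  "dyad_mix S k x = {y. dyad (k + 1) y = dyad (k + 1) x \<and>
     (\<forall>i\<in>S. \<lfloor>y $ i / pow2 k\<rfloor> = \<lfloor>x $ i / pow2 k\<rfloor>)}"

lemma dyad_mix_sets [measurable]: "dyad_mix S k x \<in> sets borel"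
proof -
  have "dyad_mix S k x = dyad (k + 1) -` {dyad (k + 1) x} \<inter>
      {y. \<forall>i\<in>S. \<lfloor>y $ i / pow2 k\<rfloor> = \<lfloor>x $ i / pow2 k\<rfloor>}"
    by (auto simp: dyad_mix_def)
  moreover have "dyad (k + 1) -` {dyad (k + 1) x} \<inter> space borel \<in> sets borel"
    by (rule measurable_sets[OF measurable_dyad]) simp
  moreover have "{y \<in> space borel. \<forall>i\<in>S. \<lfloor>y $ i / pow2 k\<rfloor> = \<lfloor>x $ i / pow2 k\<rfloor>} \<in> sets borel"
    by (intro sets.sets_Collect_finite_All) auto
  ultimately show ?thesis by auto
qed

lemma dyad_mix_empty: "dyad_mix {} k x = dyad (k + 1) -` {dyad (k + 1) x}"
  by (auto simp: dyad_mix_def)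

lemma dyad_mix_UNIV: "dyad_mix UNIV k x = dyad k -` {dyad k x}"
proof -
  have "dyad (k + 1) y = dyad (k + 1) x" if "dyad k y = dyad k x" for y
    by (rule dyad_nested[OF that]) simp
  moreover have "dyad k y = dyad k x \<longleftrightarrow> (\<forall>i. \<lfloor>y $ i / pow2 k\<rfloor> = \<lfloor>x $ i / pow2 k\<rfloor>)" for y
    unfolding dyad_def vec_eq_iff vec_lambda_beta ..
  ultimately show ?thesis unfolding dyad_mix_def vimage_def by blast
qed

text \<open>Fixing one more coordinate at the finer scale keeps one half of the box. The other half is a
  translate of it by \<open>h = 2 powr k\<close> in direction \<open>i\<close>, upwards or downwards according to the parity of the coordinate
  index, and lies in the same box.\<close>
lemma dyad_mix_halving:
  fixes f :: "real ^ 'n \<Rightarrow> real"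
  assumes lip: "C-lipschitz_on UNIV f" and i: "i \<notin> S"
  defines "F \<equiv> \<lambda>y. ennreal \<bar>f y\<bar>" and "G \<equiv> \<lambda>y. ennreal (norm (grad f y))"
  shows "2 * lint (dyad_mix (insert i S) k x) F
    \<le> lint (dyad_mix S k x) F + ennreal (pow2 k) * lint (dyad_mix S k x) G"
proof -
  define h where "h = pow2 k"
  have h: "0 < h" by (simp add: h_def)
  have cont: "continuous_on UNIV f" using lip by (rule lipschitz_on_continuous_on)
  have [measurable]: "F \<in> borel_measurable borel" "G \<in> borel_measurable borel"
    using borel_measurable_norm_grad[OF cont] borel_measurable_continuous_onI[OF cont]
    by (auto simp: F_def G_def)
  have h2: "\<lfloor>r / pow2 (k + 1)\<rfloor> = \<lfloor>r / h\<rfloor> div 2" for r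
    using floor_half_scale[of r k 1] by (simp add: h_def)
  have mix: "y \<in> dyad_mix T k x \<longleftrightarrow> (\<forall>j. \<lfloor>y $ j / h\<rfloor> div 2 = \<lfloor>x $ j / h\<rfloor> div 2) \<and> (\<forall>j\<in>T. \<lfloor>y $ j / h\<rfloor> = \<lfloor>x $ j / h\<rfloor>)" for y T
    unfolding dyad_mix_def mem_Collect_eq dyad_def vec_eq_iff vec_lambda_beta h2 h_def[symmetric] ..
  have move: "y + r *\<^sub>R axis i 1 \<in> dyad_mix S k x"
    if y: "y \<in> dyad_mix S k x" and "\<lfloor>(y $ i + r) / h\<rfloor> div 2 = \<lfloor>x $ i / h\<rfloor> div 2" for y r
  proof -
    have "(y + r *\<^sub>R axis i 1) $ j = (if j = i then y $ i + r else y $ j)" for j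
      by (simp add: axis_def)
    then show ?thesis using that i unfolding mix by auto
  qed
  have sub: "dyad_mix (insert i S) k x \<subseteq> dyad_mix S k x" by (auto simp: mix)
  have fl: "\<lfloor>r / h\<rfloor> = m \<longleftrightarrow> m * h \<le> r \<and> r < (m + 1) * h" for r m
    using h by (simp add: floor_eq_iff field_simps)
  define a where "a = \<lfloor>x $ i / h\<rfloor>"
  \<comment> \<open>An even index means the lower of the two halves.
    The segment starts at \<open>y + s *\<^sub>R axis i 1\<close> and one of its endpoints is \<open>y\<close>.\<close>
  define \<tau> where "\<tau> = (if even a then h else - h)"
  define s where "s = (if even a then 0 else - h)"
  have yi: "a * h \<le> y $ i" "y $ i < (a + 1) * h" if "y \<in> dyad_mix (insert i S) k x" for y
    using that fl[of "y $ i" a] by (auto simp: mix a_def)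
  have fl2: "\<lfloor>r / h\<rfloor> div 2 = a div 2"
    if "(if even a then a else a - 1) * h \<le> r" "r < ((if even a then a else a - 1) + 2) * h" for r
  proof -
    let ?b = "if even a then a else a - 1"
    have "?b \<le> \<lfloor>r / h\<rfloor>" "\<lfloor>r / h\<rfloor> < ?b + 2"
      using that h by (auto simp: le_floor_iff floor_less_iff field_simps)
    then show ?thesis by (cases "even a") (auto elim!: evenE oddE)
  qed
  show ?thesis unfolding h_def[symmetric]
  proof (rule translate_half_le[where \<tau> = \<tau> and s = s and e = "axis i 1"])
    fix y assume y: "y \<in> dyad_mix (insert i S) k x"
    then have yS: "y \<in> dyad_mix S k x" using sub by blast
    show "y + \<tau> *\<^sub>R axis i 1 \<in> dyad_mix S k x - dyad_mix (insert i S) k x"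
    proof
      show "y + \<tau> *\<^sub>R axis i 1 \<in> dyad_mix S k x"
        using yi[OF y] h unfolding a_def[symmetric]
        by (intro move[OF yS]) (auto simp: a_def[symmetric] \<tau>_def algebra_simps intro!: fl2)
      have "(y + \<tau> *\<^sub>R axis i 1) $ i = y $ i + \<tau>" by simp
      moreover have "\<lfloor>(y $ i + \<tau>) / h\<rfloor> \<noteq> a"
        using yi[OF y] h by (auto simp: fl \<tau>_def algebra_simps)
      ultimately show "y + \<tau> *\<^sub>R axis i 1 \<notin> dyad_mix (insert i S) k x"
        by (auto simp: mix a_def)
    qed
    show "y + (s + t) *\<^sub>R axis i 1 \<in> dyad_mix S k x" if "t \<in> {0..h}" for t
      using yi[OF y] h that
      by (intro move[OF yS]) (auto simp: a_def[symmetric] s_def algebra_simps intro!: fl2)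
    have "\<bar>f y\<bar> \<le> \<bar>f (y + \<tau> *\<^sub>R axis i 1)\<bar> + \<bar>f (y + s *\<^sub>R axis i 1 + h *\<^sub>R axis i 1) - f (y + s *\<^sub>R axis i 1)\<bar>"
      by (auto simp: \<tau>_def s_def)
    then have "F y \<le> F (y + \<tau> *\<^sub>R axis i 1) + ennreal \<bar>f (y + s *\<^sub>R axis i 1 + h *\<^sub>R axis i 1) - f (y + s *\<^sub>R axis i 1)\<bar>"
      by (auto simp: F_def ennreal_plus[symmetric] ennreal_leI simp del: ennreal_plus)
    also have "\<dots> \<le> F (y + \<tau> *\<^sub>R axis i 1) + (\<integral>\<^sup>+t\<in>{0..h}. G (y + s *\<^sub>R axis i 1 + t *\<^sub>R axis i 1) \<partial>lborel)"
      unfolding G_def using h by (intro add_left_mono axis_increment_le_grad[OF lip]) auto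
    finally show "F y \<le> F (y + \<tau> *\<^sub>R axis i 1) + (\<integral>\<^sup>+t\<in>{0..h}. G (y + (s + t) *\<^sub>R axis i 1) \<partial>lborel)"
      by (simp add: scaleR_add_left add.assoc)
  qed (use h sub in auto)
qed

text \<open>A one-sided Poincare inequality for a dyadic cube and its parent, obtained by halving one
  coordinate after the other.\<close>
lemma dyad_parent_le:
  fixes f :: "real ^ 'n \<Rightarrow> real"
  assumes lip: "C-lipschitz_on UNIV f"
  defines "F \<equiv> \<lambda>y. ennreal \<bar>f y\<bar>" and "G \<equiv> \<lambda>y. ennreal (norm (grad f y))"
  shows "2 ^ CARD('n) * fibre_int lborel (dyad k) F x
    \<le> fibre_int lborel (dyad (k + 1)) F x + 2 ^ CARD('n) * (ennreal (pow2 k) * fibre_int lborel (dyad (k + 1)) G x)"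
proof -
  let ?H = "ennreal (pow2 k) * lint (dyad_mix {} k x) G"
  have "2 ^ card S * lint (dyad_mix S k x) F \<le> lint (dyad_mix {} k x) F + 2 ^ card S * ?H"
    for S :: "'n set"
  proof (induction S rule: finite_induct[OF finite])
    case (2 i S)
    have "lint (dyad_mix S k x) G \<le> lint (dyad_mix {} k x) G"
      by (intro nn_integral_mono) (auto simp: dyad_mix_def split: split_indicator)
    then have "2 * lint (dyad_mix (insert i S) k x) F \<le> lint (dyad_mix S k x) F + ?H"
      using dyad_mix_halving[OF lip 2(2), of k x] unfolding F_def G_def
      by (meson add_left_mono mult_left_mono order_trans zero_le)
    then have "2 ^ card S * (2 * lint (dyad_mix (insert i S) k x) F)
        \<le> 2 ^ card S * (lint (dyad_mix S k x) F + ?H)"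
      by (rule mult_left_mono) simp
    also have "\<dots> \<le> (lint (dyad_mix {} k x) F + 2 ^ card S * ?H) + 2 ^ card S * ?H"
      unfolding distrib_left using 2(3) by (intro add_right_mono)
    also have "\<dots> = lint (dyad_mix {} k x) F + (2 ^ card S + 2 ^ card S) * ?H"
      by (simp only: distrib_right add.assoc)
    also have "2 ^ card S + 2 ^ card S = (2 ^ card (insert i S) :: ennreal)" using 2(1,2) by (simp add: mult_2)
    also have "2 ^ card S * (2 * lint (dyad_mix (insert i S) k x) F)
        = 2 ^ card (insert i S) * lint (dyad_mix (insert i S) k x) F"
      using 2(1,2) by (simp add: mult.assoc mult.left_commute)
    finally show ?case .
  qed simp
  from this[of UNIV] show ?thesis by (simp add: dyad_mix_empty dyad_mix_UNIV fibre_int_def)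
qed

lemma dyad_cell_eq: "dyad k -` {m} = {y. \<forall>i. m $ i * pow2 k \<le> y $ i \<and> y $ i < (m $ i + 1) * pow2 k}"
  by (simp add: set_eq_iff dyad_def vec_eq_iff floor_eq_iff pos_le_divide_eq pos_divide_less_eq)

definition dyad_cube :: "int \<Rightarrow> int ^ 'n \<Rightarrow> (real ^ 'n) set" where
  "dyad_cube k m = cbox (\<chi> i. m $ i * pow2 k) ((\<chi> i. m $ i * pow2 k) + pow2 k *\<^sub>R One)"

lemma One_nth: "(One :: real ^ 'n) $ i = 1"
proof -
  have "(One :: real ^ 'n) \<bullet> axis i 1 = 1"
    using inner_sum_left_Basis[of "axis i (1::real)" "\<lambda>_. 1"] by (simp add: axis_in_Basis_iff)
  then show ?thesis by (simp only: cart_eq_inner_axis)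
qed

lemma cube_corner_nth: "(a + l *\<^sub>R One :: real ^ 'n) $ i = a $ i + l"
  by (simp only: vector_add_component vector_scaleR_component One_nth real_scaleR_def mult_1_right)

lemma dyad_subset_cube: "dyad k -` {m} \<subseteq> dyad_cube k m"
  unfolding dyad_cell_eq dyad_cube_def
  by (auto simp: mem_box_cart cube_corner_nth distrib_right less_imp_le simp del: vector_add_component sum_component)

lemma prod_cube_side: "(\<Prod>b\<in>(Basis :: (real ^ 'n) set). (a + l *\<^sub>R One - a) \<bullet> b) = l ^ CARD('n)"
proof -
  have "(\<Prod>b\<in>(Basis :: (real ^ 'n) set). (a + l *\<^sub>R One - a) \<bullet> b) = (\<Prod>b\<in>(Basis :: (real ^ 'n) set). l)"
    by (intro prod.cong) auto
  then show ?thesis by simp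
qed

lemma emeasure_cube:
  fixes a :: "real ^ 'n"
  assumes "0 \<le> l"
  shows "emeasure lborel (cbox a (a + l *\<^sub>R One)) = ennreal (l ^ CARD('n))"
    "emeasure lborel (box a (a + l *\<^sub>R One)) = ennreal (l ^ CARD('n))"
proof -
  have "\<forall>b\<in>Basis. a \<bullet> b \<le> (a + l *\<^sub>R One) \<bullet> b" using assms by (simp add: inner_add_left)
  then show "emeasure lborel (cbox a (a + l *\<^sub>R One)) = ennreal (l ^ CARD('n))"
    "emeasure lborel (box a (a + l *\<^sub>R One)) = ennreal (l ^ CARD('n))"
    using prod_cube_side[of a l] by (simp_all add: emeasure_lborel_cbox_eq emeasure_lborel_box_eq)
qed

lemma emeasure_dyad_cube:
  "emeasure lborel (dyad_cube k m :: (real ^ 'n) set) = ennreal (2 powr (real_of_int k * CARD('n)))"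
  by (simp add: dyad_cube_def emeasure_cube powr_power mult.commute)

lemma fibre_int_one_dyad:
  fixes x :: "real ^ 'n"
  shows "fibre_int lborel (dyad k) (\<lambda>_. 1) x = ennreal (2 powr (real_of_int k * CARD('n)))"
proof -
  define m where "m = dyad k x"
  have meas: "dyad k -` {m} \<in> sets lborel"
    using measurable_sets[OF measurable_dyad, of "{m}" k] by simp
  have "emeasure lborel (dyad k -` {m}) \<le> emeasure lborel (dyad_cube k m)"
    by (intro emeasure_mono dyad_subset_cube) (simp add: dyad_cube_def)
  moreover have "box (\<chi> i. m $ i * pow2 k) ((\<chi> i. m $ i * pow2 k) + pow2 k *\<^sub>R One)
      \<subseteq> dyad k -` {m}" (is "?B \<subseteq> _")
    unfolding dyad_cell_eq by (auto simp: mem_box_cart cube_corner_nth distrib_right less_imp_le simp del: vector_add_component sum_component)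
  then have "emeasure lborel ?B \<le> emeasure lborel (dyad k -` {m})"
    using meas by (intro emeasure_mono)
  ultimately show ?thesis
    using meas unfolding emeasure_dyad_cube
    by (simp add: fibre_int_def m_def[symmetric] emeasure_cube powr_power antisym mult.commute)
qed

lemma dist_same_dyad:
  fixes x y :: "real ^ 'n"
  assumes "dyad k x = dyad k y"
  shows "dist x y \<le> CARD('n) * pow2 k"
proof -
  have "\<bar>(x - y) $ i\<bar> \<le> pow2 k" for i
  proof -
    have "\<lfloor>x $ i / 2 powr k\<rfloor> = \<lfloor>y $ i / 2 powr k\<rfloor>"
      using assms by (simp add: dyad_def vec_eq_iff)
    then have "\<bar>x $ i / 2 powr k - y $ i / 2 powr k\<bar> \<le> 1" by linarith
    then show ?thesis by (simp add: diff_divide_distrib[symmetric] abs_divide divide_le_eq)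
  qed
  then have "(\<Sum>i\<in>UNIV. \<bar>(x - y) $ i\<bar>) \<le> (\<Sum>i\<in>(UNIV :: 'n set). pow2 k)"
    by (intro sum_mono)
  then show ?thesis using norm_le_l1_cart[of "x - y"] by (simp add: dist_norm)
qed

text \<open>The average of \<open>\<bar>f\<bar>\<close> over a dyadic cube exceeds that over its parent by at most a multiple of
  the scaled integral of the gradient over the parent. Telescoping gives the estimate: at fine scales
  the averages approach \<open>\<bar>f x\<bar>\<close>, and at coarse scales they vanish because \<open>f\<close> is integrable.
  A single dyadic grid suffices here, since the estimate only compares nested cubes.\<close>
lemma abs_le_dyadic_potential:
  fixes f :: "real ^ 'n \<Rightarrow> real"
  assumes lip: "C-lipschitz_on UNIV f" and fin: "(\<integral>\<^sup>+y. ennreal \<bar>f y\<bar> \<partial>lborel) < top"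
  shows "ennreal \<bar>f x\<bar> \<le> 2 ^ (CARD('n) - 1) *
    (\<Sum>\<^sup>+k. ennreal (2 powr (real_of_int k * (1 - real CARD('n)))) * fibre_int lborel (dyad k) (\<lambda>y. ennreal (norm (grad f y))) x)"
proof -
  let ?n = "real CARD('n)"
  define F where "F = (\<lambda>y. ennreal \<bar>f y\<bar>)"
  define G where "G = (\<lambda>y. ennreal (norm (grad f y)))"
  define av where "av k = ennreal (2 powr (- (real_of_int k * ?n))) * fibre_int lborel (dyad k) F x" for k
  define J where "J k = ennreal (2 powr (real_of_int k * (1 - ?n))) * fibre_int lborel (dyad k) G x" for k
  define S where "S = (\<Sum>\<^sup>+k. J k)"
  let ?c = "2 ^ (CARD('n) - 1) :: ennreal"
  have C: "0 \<le> C" using lip by (rule lipschitz_on_nonneg)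
  have c2: "2 ^ CARD('n) = ennreal (2 powr ?n)" "?c = ennreal (2 powr (?n - 1))"
  proof -
    have "(2 :: ennreal) ^ d = ennreal (2 powr real d)" for d
      by (metis ennreal_numeral ennreal_power powr_realpow zero_less_numeral zero_le_numeral)
    then show "2 ^ CARD('n) = ennreal (2 powr ?n)" "?c = ennreal (2 powr (?n - 1))"
      by (simp_all add: of_nat_diff Suc_le_eq)
  qed
  have step: "av k \<le> av (k + 1) + ?c * J (k + 1)" for k
  proof -
    have "ennreal (2 powr (- (real_of_int (k + 1) * ?n))) * (2 ^ CARD('n) * fibre_int lborel (dyad k) F x)
      \<le> ennreal (2 powr (- (real_of_int (k + 1) * ?n))) * (fibre_int lborel (dyad (k + 1)) F x
           + 2 ^ CARD('n) * (ennreal (pow2 k) * fibre_int lborel (dyad (k + 1)) G x))"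
      unfolding F_def G_def by (intro mult_left_mono dyad_parent_le[OF lip]) simp
    moreover have "ennreal (2 powr (- (real_of_int (k + 1) * ?n))) * (2 ^ CARD('n) * fibre_int lborel (dyad k) F x) = av k"
      unfolding av_def c2 mult.assoc[symmetric]
      by (simp add: ennreal_mult[symmetric] powr_add[symmetric] algebra_simps)
    moreover have "ennreal (2 powr (- (real_of_int (k + 1) * ?n))) * (2 ^ CARD('n) * (ennreal (pow2 k) * fibre_int lborel (dyad (k + 1)) G x))
        = ?c * J (k + 1)"
      unfolding J_def c2 mult.assoc[symmetric]
      by (simp add: ennreal_mult[symmetric] powr_add[symmetric] algebra_simps)
    ultimately show ?thesis by (simp add: distrib_left av_def)
  qed
  have tele: "av k \<le> av (k + int N) + ?c * (\<Sum>j\<in>{k<..k + int N}. J j)" for k N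
  proof (induction N)
    case (Suc N)
    have "{k<..k + int (Suc N)} = insert (k + int N + 1) {k<..k + int N}" by auto
    then have *: "(\<Sum>j\<in>{k<..k + int (Suc N)}. J j) = J (k + int N + 1) + (\<Sum>j\<in>{k<..k + int N}. J j)" by simp
    have "av k \<le> (av (k + int N + 1) + ?c * J (k + int N + 1)) + ?c * (\<Sum>j\<in>{k<..k + int N}. J j)"
      using Suc step[of "k + int N"] by (meson add_right_mono order_trans)
    also have "\<dots> = av (k + int (Suc N)) + ?c * (\<Sum>j\<in>{k<..k + int (Suc N)}. J j)"
      unfolding * by (simp add: distrib_left add.assoc add.commute[of 1])
    finally show ?case .
  qed simp
  have sumS: "(\<Sum>j\<in>A. J j) \<le> S" if "finite A" for A
  proof -
    have "(\<Sum>j\<in>A. J j) = (\<integral>\<^sup>+j. J j \<partial>count_space A)" using that by (simp add: nn_integral_count_space_finite)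
    also have "\<dots> \<le> S" unfolding S_def by (subst nn_integral_count_space_indicator) (auto intro!: nn_integral_mono split: split_indicator)
    finally show ?thesis .
  qed
  obtain B where B: "(\<integral>\<^sup>+y. F y \<partial>lborel) = ennreal B" "0 \<le> B" using fin by (cases "\<integral>\<^sup>+y. F y \<partial>lborel") (auto simp: F_def)
  have avle: "av k \<le> ennreal (2 powr (- (real_of_int k * ?n)) * B)" for k
  proof -
    have "av k \<le> ennreal (2 powr (- (real_of_int k * ?n))) * ennreal B"
      unfolding av_def B(1)[symmetric] by (intro mult_left_mono fibre_int_le) auto
    then show ?thesis using B(2) by (simp add: ennreal_mult)
  qed
  have start: "F x \<le> av k + ennreal (C * ?n * pow2 k)" for k
  proof -
    let ?e = "C * ?n * pow2 k" and ?v = "2 powr (- (real_of_int k * ?n))"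
    have e: "0 \<le> ?e" using C by simp
    have cont: "continuous_on UNIV f" using lip by (rule lipschitz_on_continuous_on)
    have [measurable]: "F \<in> borel_measurable borel" "(indicator (dyad k -` {dyad k x}) :: _ \<Rightarrow> ennreal) \<in> borel_measurable borel"
      using borel_measurable_continuous_onI[OF cont] fibre_sets[OF measurable_dyad] by (auto simp: F_def)
    have "F x * fibre_int lborel (dyad k) (\<lambda>_. 1) x = (\<integral>\<^sup>+y. F x * indicator (dyad k -` {dyad k x}) y \<partial>lborel)"
      by (simp add: fibre_int_def nn_integral_cmult)
    also have "\<dots> \<le> (\<integral>\<^sup>+y. F y * indicator (dyad k -` {dyad k x}) y + ennreal ?e * indicator (dyad k -` {dyad k x}) y \<partial>lborel)"
    proof (intro nn_integral_mono)
      fix y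
      have "F x \<le> F y + ennreal ?e" if "dyad k y = dyad k x"
      proof -
        have "\<bar>f x - f y\<bar> \<le> C * dist x y" using lipschitz_onD[OF lip, of x y] by (simp add: dist_real_def)
        also have "\<dots> \<le> ?e" using dist_same_dyad[OF that[symmetric]] C by (simp add: mult.assoc mult_left_mono)
        finally have "\<bar>f x\<bar> \<le> \<bar>f y\<bar> + ?e" by linarith
        then show ?thesis using e by (simp add: F_def ennreal_plus[symmetric] ennreal_leI del: ennreal_plus)
      qed
      then show "F x * indicator (dyad k -` {dyad k x}) y \<le> F y * indicator (dyad k -` {dyad k x}) y + ennreal ?e * indicator (dyad k -` {dyad k x}) y"
        by (auto split: split_indicator)
    qed
    also have "\<dots> = fibre_int lborel (dyad k) F x + ennreal ?e * fibre_int lborel (dyad k) (\<lambda>_. 1) x"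
      by (simp add: fibre_int_def nn_integral_add nn_integral_cmult)
    finally have "ennreal ?v * (F x * ennreal (2 powr (real_of_int k * ?n)))
        \<le> ennreal ?v * (fibre_int lborel (dyad k) F x + ennreal ?e * ennreal (2 powr (real_of_int k * ?n)))"
      unfolding fibre_int_one_dyad by (intro mult_left_mono) auto
    moreover have "ennreal ?v * ennreal (2 powr (real_of_int k * ?n)) = 1"
      by (simp add: ennreal_mult[symmetric] powr_add[symmetric])
    moreover have "ennreal ?v * (a * ennreal (2 powr (real_of_int k * ?n))) = a * (ennreal ?v * ennreal (2 powr (real_of_int k * ?n)))" for a
      by (rule mult.left_commute)
    ultimately show ?thesis by (simp only: av_def distrib_left mult_1_right)
  qed
  have bound: "F x \<le> ennreal (2 powr (- (real m * ?n)) * B) + ennreal (C * ?n * 2 powr (- real m)) + ?c * S" for m :: nat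
  proof -
    have "F x \<le> av (- int m) + ennreal (C * ?n * 2 powr (- real m))" using start[of "- int m"] by simp
    also have "av (- int m) \<le> av (int m) + ?c * S"
      using tele[of "- int m" "2 * m"] sumS[of "{- int m<..- int m + int (2 * m)}"]
      by (simp add: add_left_mono mult_left_mono order_trans)
    also have "av (int m) \<le> ennreal (2 powr (- (real m * ?n)) * B)" using avle[of "int m"] by simp
    finally show ?thesis by (simp add: add_ac add_mono)
  qed
  have "F x \<le> ennreal 0 + ennreal 0 + ?c * S"
  proof (rule LIMSEQ_le_const)
    have *: "(\<lambda>m. 2 powr (- (real m * a))) \<longlonglongrightarrow> 0" if "0 < a" for a :: real
    proof -
      have "2 powr (- (real m * a)) = (2 powr (- a)) ^ m" for m by (simp add: powr_power mult.commute)
      moreover have "(\<lambda>m. (2 powr (- a)) ^ m) \<longlonglongrightarrow> 0"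
        using that by (intro LIMSEQ_power_zero) (simp add: powr_less_one)
      ultimately show ?thesis by simp
    qed
    have "(\<lambda>m. 2 powr (- (real m * ?n)) * B) \<longlonglongrightarrow> 0" "(\<lambda>m. C * ?n * 2 powr (- real m)) \<longlonglongrightarrow> 0"
      using tendsto_mult_right[OF *[of ?n], of B] tendsto_mult_left[OF *[of 1], of "C * ?n"] by simp_all
    then show "(\<lambda>m. ennreal (2 powr (- (real m * ?n)) * B) + ennreal (C * ?n * 2 powr (- real m)) + ?c * S)
        \<longlonglongrightarrow> ennreal 0 + ennreal 0 + ?c * S"
      by (intro tendsto_add tendsto_ennrealI tendsto_const)
  qed (use bound in auto)
  then show ?thesis by (simp add: F_def G_def S_def J_def)
qed

section \<open>Duality and Buckley's bound\<close>

lemma measurable_dyad_lebesgue: "dyad k \<in> lebesgue \<rightarrow>\<^sub>M count_space UNIV"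
  by (intro measurable_completion) (simp add: measurable_dyad)

lemma fibre_int_lebesgue: "fibre_int lebesgue c f x = fibre_int lborel c f x"
  by (simp add: fibre_int_def nn_integral_completion)

lemma fibre_int_density:
  assumes "c \<in> M \<rightarrow>\<^sub>M count_space (UNIV :: 'b :: countable set)" 
    and [measurable]: "u \<in> borel_measurable M" "f \<in> borel_measurable M"
  shows "fibre_int (density M u) c f x = fibre_int M c (\<lambda>y. u y * f y) x"
proof -
  note [measurable] = fibre_sets[OF assms(1)]
  show ?thesis by (simp add: fibre_int_def nn_integral_density mult.assoc)
qed

text \<open>The two bounds balance at the scale \<open>2 powr k = (U / V) powr (1 / n)\<close>. Below it the second bound is used and above
  it the first, and both geometric sums are comparable to their value there.\<close>
lemma dyadic_sum_interpolation:
  fixes a :: "int \<Rightarrow> ennreal"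
  assumes n: "1 < n" and U: "U < top"
    and aU: "\<And>k. a k \<le> ennreal (2 powr (real_of_int k * (1 - n))) * U"
    and aV: "\<And>k. a k \<le> ennreal (pow2 k) * V"
  shows "(\<Sum>\<^sup>+k. a k) \<le> ennreal (geom 1 + geom (n - 1)) * (U epowr (1 / n) * V epowr (1 - 1 / n))"
proof -
  have g: "0 < geom 1" "0 < geom (n - 1)" using n by (auto intro: geom_pos)
  consider "U = 0 \<or> V = 0" | "U \<noteq> 0" "V = top" | "U \<noteq> 0" "V \<noteq> 0" "V \<noteq> top" by blast
  then show ?thesis
  proof cases
    case 1
    then have "a k = 0" for k using aU[of k] aV[of k] by auto
    then show ?thesis by simp
  next
    case 2
    then show ?thesis using g by (simp add: ennreal_mult_top)
  next
    case 3
    with U obtain s t where s: "U = ennreal s" "0 < s" and t: "V = ennreal t" "0 < t"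
      by (cases U; cases V) (auto simp: ennreal_eq_0_iff less_le)
    define x where "x = (s / t) powr (1 / n)"
    have x: "0 < x" using s t by (simp add: x_def)
    have "a k \<le> ennreal t * (ennreal (2 powr (real_of_int k * 1)) * indicator {k. pow2 k < x} k)
        + ennreal s * (ennreal (2 powr (- (real_of_int k * (n - 1)))) * indicator {k. x \<le> pow2 k} k)" for k
      using aU[of k] aV[of k] by (auto simp: s t mult.commute algebra_simps split: split_indicator)
    then have "(\<Sum>\<^sup>+k. a k)
      \<le> (\<Sum>\<^sup>+k. ennreal t * (ennreal (2 powr (real_of_int k * 1)) * indicator {k. pow2 k < x} k)
        + ennreal s * (ennreal (2 powr (- (real_of_int k * (n - 1)))) * indicator {k. x \<le> pow2 k} k))"
      by (rule nn_integral_mono)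
    also have "\<dots> = ennreal t * (\<Sum>\<^sup>+k. ennreal (2 powr (real_of_int k * 1)) * indicator {k. pow2 k < x} k)
        + ennreal s * (\<Sum>\<^sup>+k. ennreal (2 powr (- (real_of_int k * (n - 1)))) * indicator {k. x \<le> pow2 k} k)"
      by (subst nn_integral_add) (auto simp: nn_integral_cmult)
    also have "\<dots> \<le> ennreal t * ennreal (geom 1 * x powr 1) + ennreal s * ennreal (geom (n - 1) * x powr (- (n - 1)))"
      using n x by (intro add_mono mult_left_mono nn_integral_dyadic_below nn_integral_dyadic_above) auto
    also have "\<dots> = ennreal (t * (geom 1 * x powr 1) + s * (geom (n - 1) * x powr (- (n - 1))))"
      using s t g by (simp add: ennreal_mult[symmetric] ennreal_plus[symmetric] less_imp_le del: ennreal_plus)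
    also have "t * (geom 1 * x powr 1) + s * (geom (n - 1) * x powr (- (n - 1)))
        = (geom 1 + geom (n - 1)) * (s powr (1 / n) * t powr (1 - 1 / n))"
    proof -
      have 1: "t * x = s powr (1 / n) * t powr (1 - 1 / n)"
        using s t by (simp add: x_def powr_divide powr_diff)
      have "x powr (- (n - 1)) = (s / t) powr (1 / n - 1)"
        using n by (simp add: x_def powr_powr field_simps)
      also have "\<dots> = s powr (1 / n) / s * (t / t powr (1 / n))"
        using s t by (simp add: powr_divide powr_diff)
      finally have 2: "s * x powr (- (n - 1)) = s powr (1 / n) * t powr (1 - 1 / n)"
        using s t by (simp add: powr_diff)
      have "t * (geom 1 * x powr 1) + s * (geom (n - 1) * x powr (- (n - 1)))
          = geom 1 * (t * x) + geom (n - 1) * (s * x powr (- (n - 1)))" using x by simp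
      then show ?thesis unfolding 1 2 by (simp only: distrib_right)
    qed
    finally show ?thesis using s t g by (simp add: epowr_ennreal ennreal_mult[symmetric] del: ennreal_plus)
  qed
qed

text \<open>Duality moves the fractional integral from \<open>G\<close> to the weight \<open>u\<close>, where Hedberg's argument applies: the
  integral of \<open>u\<close> over a dyadic cube is at most the total mass, and at most the volume of the cube
  times the maximal function. The previous lemma interpolates between these bounds.\<close>
lemma dyadic_potential_duality:
  fixes u G :: "real ^ 'n \<Rightarrow> ennreal"
  assumes [measurable]: "u \<in> borel_measurable lebesgue" "G \<in> borel_measurable lebesgue"
    and n: "2 \<le> CARD('n)" and fin: "(\<integral>\<^sup>+x. u x \<partial>lebesgue) < top"
  shows "(\<integral>\<^sup>+x. u x * (\<Sum>\<^sup>+k. ennreal (2 powr (real_of_int k * (1 - real CARD('n)))) * fibre_int lebesgue (dyad k) G x) \<partial>lebesgue)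
    \<le> ennreal (geom 1 + geom (real CARD('n) - 1)) * ((\<integral>\<^sup>+x. u x \<partial>lebesgue) epowr (1 / real CARD('n))
        * (\<integral>\<^sup>+y. G y * max_fun lebesgue dyad u y epowr (1 - 1 / real CARD('n)) \<partial>lebesgue))"
proof -
  let ?n = "real CARD('n)" and ?c = "\<lambda>k. ennreal (2 powr (real_of_int k * (1 - real CARD('n))))"
  note meas = measurable_dyad_lebesgue
  have [measurable]: "fibre_int lebesgue (dyad k) f \<in> borel_measurable lebesgue" for k :: int and f :: "real ^ 'n \<Rightarrow> ennreal"
    by (rule borel_measurable_fibre_int[OF meas])
  have [measurable]: "max_fun lebesgue dyad u \<in> borel_measurable lebesgue"
    by (rule borel_measurable_max_fun[OF meas dyad_nested])
  have "(\<integral>\<^sup>+x. u x * (\<Sum>\<^sup>+k. ?c k * fibre_int lebesgue (dyad k) G x) \<partial>lebesgue)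
      = (\<integral>\<^sup>+x. (\<Sum>\<^sup>+k. u x * (?c k * fibre_int lebesgue (dyad k) G x)) \<partial>lebesgue)"
    by (simp add: nn_integral_cmult)
  also have "\<dots> = (\<Sum>\<^sup>+k. (\<integral>\<^sup>+x. u x * (?c k * fibre_int lebesgue (dyad k) G x) \<partial>lebesgue))"
    by (subst nn_integral_count_space_nn_integral) auto
  also have "\<dots> = (\<Sum>\<^sup>+k. (\<integral>\<^sup>+x. G x * (?c k * fibre_int lebesgue (dyad k) u x) \<partial>lebesgue))"
    using fibre_int_duality[OF meas, of u G]
    by (simp add: mult.left_commute[of _ "ennreal _"] nn_integral_cmult)
  also have "\<dots> = (\<integral>\<^sup>+x. (\<Sum>\<^sup>+k. G x * (?c k * fibre_int lebesgue (dyad k) u x)) \<partial>lebesgue)"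
    by (subst nn_integral_count_space_nn_integral) auto
  also have "\<dots> = (\<integral>\<^sup>+x. G x * (\<Sum>\<^sup>+k. ?c k * fibre_int lebesgue (dyad k) u x) \<partial>lebesgue)"
    by (simp add: nn_integral_cmult)
  also have "\<dots> \<le> (\<integral>\<^sup>+x. G x * (ennreal (geom 1 + geom (?n - 1)) * ((\<integral>\<^sup>+x. u x \<partial>lebesgue) epowr (1 / ?n)
        * max_fun lebesgue dyad u x epowr (1 - 1 / ?n))) \<partial>lebesgue)"
  proof (rule nn_integral_mono, rule mult_left_mono, rule dyadic_sum_interpolation[OF _ fin])
    fix x :: "real ^ 'n" and k :: int
    let ?I = "fibre_int lebesgue (dyad k) u x"
    show "?c k * ?I \<le> ?c k * (\<integral>\<^sup>+x. u x \<partial>lebesgue)"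
      by (intro mult_left_mono fibre_int_le) simp
    have one: "fibre_int lebesgue (dyad k) (\<lambda>_. 1) x = ennreal (2 powr (real_of_int k * ?n))"
      by (simp add: fibre_int_lebesgue fibre_int_one_dyad)
    have "?I = ?I / ennreal (2 powr (real_of_int k * ?n)) * ennreal (2 powr (real_of_int k * ?n))"
      by (simp add: ennreal_divide_times)
    also have "\<dots> \<le> max_fun lebesgue dyad u x * ennreal (2 powr (real_of_int k * ?n))"
      unfolding max_fun_def one[symmetric] by (intro mult_right_mono SUP_upper) auto
    finally have "?c k * ?I \<le> ?c k * (max_fun lebesgue dyad u x * ennreal (2 powr (real_of_int k * ?n)))"
      by (rule mult_left_mono) simp
    also have "\<dots> = ennreal (2 powr (real_of_int k * (1 - ?n)) * 2 powr (real_of_int k * ?n)) * max_fun lebesgue dyad u x"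
      by (simp add: ennreal_mult mult_ac)
    also have "2 powr (real_of_int k * (1 - ?n)) * 2 powr (real_of_int k * ?n) = pow2 k"
      by (simp add: powr_add[symmetric] algebra_simps)
    finally show "?c k * ?I \<le> ennreal (pow2 k) * max_fun lebesgue dyad u x" .
  qed (use n in auto)
  also have "\<dots> = ennreal (geom 1 + geom (?n - 1)) * ((\<integral>\<^sup>+x. u x \<partial>lebesgue) epowr (1 / ?n)
        * (\<integral>\<^sup>+y. G y * max_fun lebesgue dyad u y epowr (1 - 1 / ?n) \<partial>lebesgue))"
    by (simp add: mult.left_commute[of "G _"] nn_integral_cmult)
  finally show ?thesis .
qed

text \<open>Buckley's bound with the sharp power of the \<open>A\<close> constant, following Lerner. With \<open>Mu\<close> the maximal
  function of the indicator of \<open>E\<close> with respect to the measure \<open>u dx\<close>, the average of \<open>u\<close> over the part of \<open>E\<close> in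
  a cube \<open>Q\<close> is at most
  \<open>A\<close> times the power \<open>1 / (r - 1)\<close> of the average, with respect to \<open>\<sigma> dx\<close>, of \<open>Mu powr (r - 1) / \<sigma>\<close> over \<open>Q\<close>. The left-hand side
  is therefore controlled by applying two maximal operators one after the other, each with respect to
  its own measure, where Doob's inequality costs nothing in terms of \<open>A\<close>.\<close>
lemma dyadic_maximal_Buckley:
  fixes u \<sigma> :: "real ^ 'n \<Rightarrow> ennreal"
  assumes [measurable]: "u \<in> borel_measurable lebesgue" "\<sigma> \<in> borel_measurable lebesgue"
    and r: "1 < r" and A: "A < top"
    and dual: "AE x in lebesgue. 0 < u x \<and> u x < top \<and> 0 < \<sigma> x \<and> \<sigma> x * u x epowr (r - 1) = 1"
    and A_le: "\<And>k x. (fibre_int lebesgue (dyad k) u x / fibre_int lebesgue (dyad k) (\<lambda>_. 1) x) *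
        (fibre_int lebesgue (dyad k) \<sigma> x / fibre_int lebesgue (dyad k) (\<lambda>_. 1) x) epowr (1 / (r - 1)) \<le> A"
    and [measurable]: "E \<in> sets lebesgue"
  defines "C \<equiv> \<lambda>s. ennreal (2 powr (2 * s) * geom (s - 1))"
  shows "(\<integral>\<^sup>+x. max_fun lebesgue dyad (\<lambda>x. u x * indicator E x) x epowr r * \<sigma> x \<partial>lebesgue)
    \<le> C (r / (r - 1)) * C r * (A epowr r * (\<integral>\<^sup>+x. u x * indicator E x \<partial>lebesgue))"
proof -
  note meas = measurable_dyad_lebesgue
  have measd: "dyad k \<in> density lebesgue v \<rightarrow>\<^sub>M count_space UNIV" for k and v :: "real ^ 'n \<Rightarrow> ennreal"
    using meas by simp
  have [measurable]: "fibre_int lebesgue (dyad k) f \<in> borel_measurable lebesgue" for k :: int and f :: "real ^ 'n \<Rightarrow> ennreal"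
    by (rule borel_measurable_fibre_int[OF meas])
  have [measurable]: "max_fun (density lebesgue v) dyad f \<in> borel_measurable lebesgue" 
      "max_fun lebesgue dyad f \<in> borel_measurable lebesgue" for v f :: "real ^ 'n \<Rightarrow> ennreal"
  proof -
    have "max_fun (density lebesgue v) dyad f \<in> borel_measurable (density lebesgue v)"
      by (rule borel_measurable_max_fun[OF measd dyad_nested])
    then show "max_fun (density lebesgue v) dyad f \<in> borel_measurable lebesgue" by simp
    show "max_fun lebesgue dyad f \<in> borel_measurable lebesgue"
      by (rule borel_measurable_max_fun[OF meas dyad_nested])
  qed
  note [measurable] = fibre_sets[OF meas]
  define Mu where "Mu = max_fun (density lebesgue u) dyad (indicator E)"
  \<comment> \<open>Almost everywhere \<open>u x epowr (r - 1)\<close> is the reciprocal of \<open>\<sigma> x\<close>.\<close>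
  define H where "H x = Mu x epowr (r - 1) * u x epowr (r - 1)" for x
  define M\<sigma> where "M\<sigma> = max_fun (density lebesgue \<sigma>) dyad H"
  have [measurable]: "Mu \<in> borel_measurable lebesgue" by (simp add: Mu_def)
  have [measurable]: "H \<in> borel_measurable lebesgue" unfolding H_def by measurable
  have [measurable]: "M\<sigma> \<in> borel_measurable lebesgue" by (simp add: M\<sigma>_def)
  let ?I = "\<lambda>k f x. fibre_int lebesgue (dyad k) f x"
  have pos: "?I k f x \<noteq> 0" if f: "AE x in lebesgue. 0 < f x" and [measurable]: "f \<in> borel_measurable lebesgue" for k f x
  proof
    assume "?I k f x = 0"
    then have "AE y in lebesgue. f y * indicator (dyad k -` {dyad k x}) y = 0"
      by (simp add: fibre_int_def nn_integral_0_iff_AE)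
    with f have "AE y in lebesgue. (1 :: ennreal) * indicator (dyad k -` {dyad k x}) y = 0"
      by eventually_elim (auto split: split_indicator)
    then have "?I k (\<lambda>_. 1) x = 0"
      by (simp add: fibre_int_def nn_integral_0_iff_AE)
    then show False by (simp add: fibre_int_lebesgue fibre_int_one_dyad)
  qed
  have u0: "AE x in lebesgue. 0 < u x" and \<sigma>0: "AE x in lebesgue. 0 < \<sigma> x"
    using dual by (auto elim: eventually_mono)
  have key: "?I k (\<lambda>x. u x * indicator E x) x / ?I k (\<lambda>_. 1) x \<le> A * M\<sigma> x epowr (1 / (r - 1))" for k x
  proof -
    define v where "v = 2 powr (real_of_int k * CARD('n))"
    have v: "0 < v" "?I k (\<lambda>_. 1) x = ennreal v" by (simp_all add: v_def fibre_int_lebesgue fibre_int_one_dyad)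
    have bs: "?I k u x \<noteq> 0" "?I k \<sigma> x \<noteq> 0" by (rule pos[OF u0], simp, rule pos[OF \<sigma>0], simp)
    have "?I k u x / ennreal v * (?I k \<sigma> x / ennreal v) epowr (1 / (r - 1)) < top"
      using A_le[of k x] A unfolding v(2) by (rule le_less_trans)
    then have "?I k u x < top" "?I k \<sigma> x < top"
    proof -
      assume *: "?I k u x / ennreal v * (?I k \<sigma> x / ennreal v) epowr (1 / (r - 1)) < top"
      have "?I k u x / ennreal v \<noteq> 0" "(?I k \<sigma> x / ennreal v) epowr (1 / (r - 1)) \<noteq> 0" using bs by auto
      with * have "?I k u x / ennreal v \<noteq> top" "(?I k \<sigma> x / ennreal v) epowr (1 / (r - 1)) \<noteq> top"
        by (metis ennreal_mult_eq_top_iff less_irrefl)+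
      then have "?I k u x / ennreal v \<noteq> top" "?I k \<sigma> x / ennreal v \<noteq> top" by simp_all
      then show "?I k u x < top" "?I k \<sigma> x < top"
        using v(1) by (auto simp: ennreal_divide_eq_top_iff less_top[symmetric])
    qed
    then obtain b s where b: "?I k u x = ennreal b" "0 < b" and s: "?I k \<sigma> x = ennreal s" "0 < s"
      using bs by (cases "?I k u x"; cases "?I k \<sigma> x") (auto simp: ennreal_eq_0_iff less_le)
    obtain \<alpha> where \<alpha>: "A = ennreal \<alpha>" "0 \<le> \<alpha>" using A by (cases A) auto
    have "?I k (\<lambda>x. u x * indicator E x) x \<le> ?I k u x"
      by (rule fibre_int_mono) (auto split: split_indicator)
    then obtain a where a: "?I k (\<lambda>x. u x * indicator E x) x = ennreal a" "0 \<le> a"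
      unfolding b(1) by (cases "?I k (\<lambda>x. u x * indicator E x) x") (auto simp: top_unique)
    have cond: "b / v * (s / v) powr (1 / (r - 1)) \<le> \<alpha>"
      using A_le[of k x] b s v \<alpha> by (simp add: divide_ennreal epowr_ennreal ennreal_mult[symmetric] ennreal_le_iff)
    have Mu_ge: "ennreal (a / b) \<le> Mu y" if "dyad k y = dyad k x" for y
    proof -
      have "fibre_int (density lebesgue u) (dyad k) (indicator E) y / fibre_int (density lebesgue u) (dyad k) (\<lambda>_. 1) y \<le> Mu y"
        unfolding Mu_def max_fun_def by (rule SUP_upper) simp
      moreover have "fibre_int (density lebesgue u) (dyad k) (indicator E) y = ennreal a"
        "fibre_int (density lebesgue u) (dyad k) (\<lambda>_. 1) y = ennreal b"
        using a(1) b(1) fibre_int_cong[of "dyad k" y x, OF that]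
        by (simp_all add: fibre_int_density[OF meas])
      ultimately show ?thesis using a b by (simp add: divide_ennreal)
    qed
    have "ennreal ((a / b) powr (r - 1)) * ennreal v = (\<integral>\<^sup>+y. ennreal ((a / b) powr (r - 1)) * indicator (dyad k -` {dyad k x}) y \<partial>lebesgue)"
      using v(2) by (simp add: nn_integral_cmult fibre_int_def)
    also have "\<dots> \<le> (\<integral>\<^sup>+y. Mu y epowr (r - 1) * indicator (dyad k -` {dyad k x}) y \<partial>lebesgue)"
    proof (intro nn_integral_mono)
      fix y
      have "ennreal ((a / b) powr (r - 1)) \<le> Mu y epowr (r - 1)" if "dyad k y = dyad k x"
        using epowr_mono[OF _ Mu_ge[OF that], of "r - 1"] r a b by (simp add: epowr_ennreal)
      then show "ennreal ((a / b) powr (r - 1)) * indicator (dyad k -` {dyad k x}) y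
          \<le> Mu y epowr (r - 1) * indicator (dyad k -` {dyad k x}) y" by (auto split: split_indicator)
    qed
    also have "\<dots> = (\<integral>\<^sup>+y. \<sigma> y * H y * indicator (dyad k -` {dyad k x}) y \<partial>lebesgue)"
      using dual
    proof (intro nn_integral_cong_AE, eventually_elim)
      case (elim y)
      have "\<sigma> y * H y = Mu y epowr (r - 1) * (\<sigma> y * u y epowr (r - 1))"
        by (simp add: H_def mult.left_commute)
      then show ?case using elim by simp
    qed
    also have "\<dots> = fibre_int (density lebesgue \<sigma>) (dyad k) H x"
      by (subst fibre_int_density[OF meas]) (simp_all add: fibre_int_def)
    finally have "ennreal ((a / b) powr (r - 1) * v / s) \<le> fibre_int (density lebesgue \<sigma>) (dyad k) H x / ennreal s"
      using v(1) s by (simp add: ennreal_mult[symmetric] divide_ennreal[symmetric] divide_right_mono_ennreal)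
    also have "ennreal s = fibre_int (density lebesgue \<sigma>) (dyad k) (\<lambda>_. 1) x"
      by (simp add: fibre_int_density[OF meas] s)
    also have "fibre_int (density lebesgue \<sigma>) (dyad k) H x / fibre_int (density lebesgue \<sigma>) (dyad k) (\<lambda>_. 1) x \<le> M\<sigma> x"
      unfolding M\<sigma>_def max_fun_def by (rule SUP_upper) simp
    finally have M\<sigma>_ge: "ennreal ((a / b) powr (r - 1) * v / s) \<le> M\<sigma> x" .
    have "a / v \<le> \<alpha> * ((a / b) powr (r - 1) * v / s) powr (1 / (r - 1))"
    proof -
      have "((a / b) powr (r - 1) * v / s) powr (1 / (r - 1)) = (a / b) * (v / s) powr (1 / (r - 1))"
        using a b v s r by (simp add: powr_mult powr_divide powr_powr)
      moreover have "a / v = (b / v * (s / v) powr (1 / (r - 1))) * ((a / b) * (v / s) powr (1 / (r - 1)))"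
        using b v s by (simp add: powr_divide)
      moreover have "\<dots> \<le> \<alpha> * ((a / b) * (v / s) powr (1 / (r - 1)))"
        using cond a b by (intro mult_right_mono) auto
      ultimately show ?thesis by simp
    qed
    then have "ennreal (a / v) \<le> A * ennreal ((a / b) powr (r - 1) * v / s) epowr (1 / (r - 1))"
      using \<alpha> v s by (simp add: epowr_ennreal ennreal_mult[symmetric] ennreal_leI)
    also have "\<dots> \<le> A * M\<sigma> x epowr (1 / (r - 1))"
      using r M\<sigma>_ge by (intro mult_left_mono epowr_mono) auto
    finally show ?thesis using a v by (simp add: divide_ennreal)
  qed
  have "max_fun lebesgue dyad (\<lambda>x. u x * indicator E x) x epowr r \<le> A epowr r * M\<sigma> x epowr (r / (r - 1))" for x
  proof -
    have "max_fun lebesgue dyad (\<lambda>x. u x * indicator E x) x \<le> A * M\<sigma> x epowr (1 / (r - 1))"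
      unfolding max_fun_def by (intro SUP_least key)
    then have "max_fun lebesgue dyad (\<lambda>x. u x * indicator E x) x epowr r \<le> (A * M\<sigma> x epowr (1 / (r - 1))) epowr r"
      using r by (intro epowr_mono) auto
    then show ?thesis by (simp add: epowr_mult epowr_epowr)
  qed
  then have "(\<integral>\<^sup>+x. max_fun lebesgue dyad (\<lambda>x. u x * indicator E x) x epowr r * \<sigma> x \<partial>lebesgue)
      \<le> (\<integral>\<^sup>+x. A epowr r * (\<sigma> x * M\<sigma> x epowr (r / (r - 1))) \<partial>lebesgue)"
    by (intro nn_integral_mono) (simp add: mult.commute mult.left_commute mult_left_mono)
  also have "\<dots> = A epowr r * (\<integral>\<^sup>+x. M\<sigma> x epowr (r / (r - 1)) \<partial>density lebesgue \<sigma>)"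
    by (simp add: nn_integral_cmult nn_integral_density)
  also have "\<dots> \<le> A epowr r * (C (r / (r - 1)) * (\<integral>\<^sup>+x. H x epowr (r / (r - 1)) \<partial>density lebesgue \<sigma>))"
    unfolding M\<sigma>_def C_def using r
    by (intro mult_left_mono max_fun_strong_type[OF measd dyad_nested]) auto
  also have "(\<integral>\<^sup>+x. H x epowr (r / (r - 1)) \<partial>density lebesgue \<sigma>) = (\<integral>\<^sup>+x. \<sigma> x * H x epowr (r / (r - 1)) \<partial>lebesgue)"
    by (simp add: nn_integral_density)
  also have "\<dots> = (\<integral>\<^sup>+x. u x * Mu x epowr r \<partial>lebesgue)"
    using dual
  proof (intro nn_integral_cong_AE, eventually_elim)
    case (elim x)
    have "H x epowr (r / (r - 1)) = Mu x epowr r * (u x epowr (r - 1) * u x)"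
      using r epowr_add[of "u x" "r - 1" 1] by (simp add: H_def epowr_mult epowr_epowr)
    then have "\<sigma> x * H x epowr (r / (r - 1)) = (\<sigma> x * u x epowr (r - 1)) * (u x * Mu x epowr r)"
      by (simp add: mult_ac)
    then show ?case using elim by simp
  qed
  also have "\<dots> = (\<integral>\<^sup>+x. Mu x epowr r \<partial>density lebesgue u)" by (simp add: nn_integral_density)
  finally have 1: "(\<integral>\<^sup>+x. max_fun lebesgue dyad (\<lambda>x. u x * indicator E x) x epowr r * \<sigma> x \<partial>lebesgue)
      \<le> A epowr r * (C (r / (r - 1)) * (\<integral>\<^sup>+x. Mu x epowr r \<partial>density lebesgue u))" .
  have 2: "(\<integral>\<^sup>+x. Mu x epowr r \<partial>density lebesgue u) \<le> C r * (\<integral>\<^sup>+x. indicator E x epowr r \<partial>density lebesgue u)"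
    unfolding Mu_def C_def using r
    by (intro max_fun_strong_type[OF measd dyad_nested]) auto
  have 3: "(\<integral>\<^sup>+x. indicator E x epowr r \<partial>density lebesgue u) = (\<integral>\<^sup>+x. u x * indicator E x \<partial>lebesgue)"
    by (subst nn_integral_density) (auto intro!: nn_integral_cong split: split_indicator)
  have "A epowr r * (C (r / (r - 1)) * (\<integral>\<^sup>+x. Mu x epowr r \<partial>density lebesgue u))
      \<le> A epowr r * (C (r / (r - 1)) * (C r * (\<integral>\<^sup>+x. u x * indicator E x \<partial>lebesgue)))"
    using 2 unfolding 3 by (intro mult_left_mono) auto
  with 1 have "(\<integral>\<^sup>+x. max_fun lebesgue dyad (\<lambda>x. u x * indicator E x) x epowr r * \<sigma> x \<partial>lebesgue)
      \<le> A epowr r * (C (r / (r - 1)) * (C r * (\<integral>\<^sup>+x. u x * indicator E x \<partial>lebesgue)))"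
    by (rule order_trans)
  then show ?thesis by (simp only: mult_ac)
qed

section \<open>Weights in the \<open>A\<close> classes\<close>

lemma avg_mono:
  assumes "\<And>x. g x \<le> h x"
  shows "avg Q g \<le> avg Q h"
  unfolding avg_def using assms by (intro divide_right_mono_ennreal nn_integral_mono mult_right_mono) auto

lemma dyad_cube_in_cubes: "dyad_cube k m \<in> cubes"
  unfolding dyad_cube_def cubes_def mem_Collect_eq
  by (intro exI[of _ "\<chi> i. m $ i * 2 powr real_of_int k"] exI[of _ "2 powr real_of_int k"]) simp

lemma emeasure_lebesgue_cube:
  assumes "(Q :: (real ^ 'n) set) \<in> cubes"
  shows "0 < emeasure lebesgue Q" "emeasure lebesgue Q < top" "Q \<in> sets lebesgue"
proof -
  obtain a :: "real ^ 'n" and l where Q: "Q = cbox a (a + l *\<^sub>R One)" "0 < l"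
    using assms by (auto simp: cubes_def)
  then have "emeasure lebesgue Q = ennreal (l ^ CARD('n))" by (simp add: emeasure_cube)
  then show "0 < emeasure lebesgue Q" "emeasure lebesgue Q < top" using Q(2) by auto
  show "Q \<in> sets lebesgue" using Q by auto
qed

lemma fibre_avg_le:
  "fibre_int lebesgue (dyad k) g x / fibre_int lebesgue (dyad k) (\<lambda>_. 1) x \<le> avg (dyad_cube k (dyad k x)) g"
proof -
  have "emeasure lebesgue (dyad_cube k (dyad k x)) = fibre_int lebesgue (dyad k) (\<lambda>_. 1) x"
    using emeasure_dyad_cube[of k "dyad k x"] by (simp add: dyad_cube_def fibre_int_lebesgue fibre_int_one_dyad)
  moreover have "fibre_int lebesgue (dyad k) g x \<le> set_nn_integral lebesgue (dyad_cube k (dyad k x)) g"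
    unfolding fibre_int_def using dyad_subset_cube[of k "dyad k x"]
    by (intro nn_integral_mono) (auto split: split_indicator)
  ultimately show ?thesis unfolding avg_def by (auto intro: divide_right_mono_ennreal)
qed

definition centred_cube :: "real \<Rightarrow> (real ^ 'n) set" where
  "centred_cube r = cbox (- r *\<^sub>R One) (- r *\<^sub>R One + (2 * r) *\<^sub>R One)"

lemma centred_cube_in_cubes: "0 < r \<Longrightarrow> centred_cube r \<in> cubes"
  unfolding cubes_def centred_cube_def mem_Collect_eq
  by (intro exI[of _ "- r *\<^sub>R One"] exI[of _ "2 * r"]) auto

lemma mem_centred_cube: "x \<in> centred_cube r \<longleftrightarrow> (\<forall>i. \<bar>x $ i\<bar> \<le> r)"
  unfolding centred_cube_def mem_box_cart cube_corner_nth vector_scaleR_component One_nth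
  by (auto simp: abs_le_iff minus_le_iff)

lemma avg_eq_0_imp_AE:
  assumes Q: "Q \<in> cubes" and [measurable]: "g \<in> borel_measurable lebesgue" and "avg Q g = 0"
  shows "AE x\<in>Q in lebesgue. g x = 0"
proof -
  note [measurable] = emeasure_lebesgue_cube(3)[OF Q]
  have "set_nn_integral lebesgue Q g = 0"
    using assms(3) emeasure_lebesgue_cube[OF Q] by (auto simp: avg_def)
  then have "AE x in lebesgue. g x * indicator Q x = 0" by (subst (asm) nn_integral_0_iff_AE) auto
  then show ?thesis by eventually_elim (auto split: split_indicator_asm)
qed

lemma not_AE_False_cube: "Q \<in> cubes \<Longrightarrow> \<not> (AE x\<in>Q in lebesgue. False)"
  using emeasure_lebesgue_cube[of Q] AE_iff_null_sets[of Q lebesgue] by auto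

context
  fixes p q :: real and w :: "real ^ 'n \<Rightarrow> real"
  assumes w: "w \<in> A_class p q"
begin

lemma A_class_measurable: "w \<in> borel_measurable lebesgue"
  using w by (auto simp: A_class_def weight_def)

lemma A_class_nonneg: "0 \<le> w x"
  using w by (auto simp: A_class_def weight_def)

lemma A_const_finite: "A_const p q w < top"
  using w by (auto simp: A_class_def)

text \<open>The infimum defining the constant and the supremum defining the essential infimum are both
  attained along sequences, so only countably many exceptional null sets occur.\<close>
lemma A_one_AE_le:
  assumes p: "p = 1" and Q: "Q \<in> cubes"
  shows "AE x\<in>Q in lebesgue. avg Q (\<lambda>x. ennreal (w x powr q)) \<le> A_const p q w * ennreal (w x powr q)"
proof -
  let ?u = "\<lambda>x. ennreal (w x powr q)"
  define S where "S = {ennreal c | c. 0 \<le> c \<and> (\<forall>Q\<in>cubes. avg Q ?u \<le> ennreal c * ess_inf_on Q ?u)}"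
  have A: "A_const p q w = Inf S" by (simp add: A_const_def p S_def)
  then have "S \<noteq> {}" using A_const_finite by auto
  then obtain c :: "nat \<Rightarrow> ennreal" where c: "range c \<subseteq> S" "Inf S = (INF i. c i)"
    using ennreal_Inf_countable_INF by metis
  define T where "T = {a. AE x\<in>Q in lebesgue. a \<le> ?u x}"
  have "0 \<in> T" by (simp add: T_def)
  then obtain t :: "nat \<Rightarrow> ennreal" where t: "range t \<subseteq> T" "Sup T = (SUP i. t i)"
    using ennreal_Sup_countable_SUP[of T] by auto
  have "AE x in lebesgue. \<forall>i. x \<in> Q \<longrightarrow> t i \<le> ?u x"
    using t(1) unfolding AE_all_countable T_def by auto
  then show ?thesis
  proof eventually_elim
    case (elim x)
    show ?case
    proof
      assume x: "x \<in> Q"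
      have "ess_inf_on Q ?u \<le> ?u x"
        using elim x unfolding ess_inf_on_def T_def[symmetric] t(2) by (intro SUP_least) auto
      then have le: "avg Q ?u \<le> c i * ?u x" for i
      proof -
        have "c i \<in> S" using c(1) by blast
        then have "avg Q ?u \<le> c i * ess_inf_on Q ?u" using Q by (auto simp: S_def)
        also have "\<dots> \<le> c i * ?u x" using \<open>ess_inf_on Q ?u \<le> ?u x\<close> by (rule mult_left_mono) simp
        finally show ?thesis .
      qed
      show "avg Q ?u \<le> A_const p q w * ?u x"
      proof (cases "?u x = 0")
        case False
        have "avg Q ?u / ?u x \<le> c i" for i
        proof -
          have "avg Q ?u / ?u x \<le> c i * ?u x / ?u x" by (intro divide_right_mono_ennreal le)
          then show ?thesis using False by (simp add: mult_divide_eq_ennreal)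
        qed
        then have "avg Q ?u / ?u x \<le> A_const p q w" unfolding A c(2) by (intro INF_greatest) auto
        then have "avg Q ?u / ?u x * ?u x \<le> A_const p q w * ?u x" by (rule mult_right_mono) simp
        then show ?thesis using False by (simp add: ennreal_divide_times less_top)
      qed (use le[of 0] in simp)
    qed
  qed
qed

lemma A_pq_le:
  assumes "p \<noteq> 1" and Q: "Q \<in> cubes"
  shows "avg Q (\<lambda>x. ennreal (w x powr q)) * avg Q (\<lambda>x. inverse (ennreal (w x powr dual_exp p))) epowr (q / dual_exp p)
    \<le> A_const p q w"
  using assms by (auto simp: A_const_def intro!: SUP_upper2[of Q])

lemma avg_power_finite:
  assumes Q: "Q \<in> cubes"
  shows "avg Q (\<lambda>x. ennreal (w x powr q)) < top"
proof (cases "p = 1")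
  case True
  show ?thesis
  proof (rule ccontr)
    assume "\<not> ?thesis"
    then have top: "avg Q (\<lambda>x. ennreal (w x powr q)) = top" by (metis top.not_eq_extremum)
    have "AE x\<in>Q in lebesgue. False"
      using A_one_AE_le[OF True Q]
    proof eventually_elim
      case (elim x)
      have "A_const p q w * ennreal (w x powr q) < top"
        using A_const_finite by (simp add: ennreal_mult_less_top)
      with elim show ?case unfolding top by (auto simp: top_unique)
    qed
    with not_AE_False_cube[OF Q] show False by simp
  qed
next
  case False
  note [measurable] = A_class_measurable
  show ?thesis
  proof (rule ccontr)
    assume "\<not> ?thesis"
    then have top: "avg Q (\<lambda>x. ennreal (w x powr q)) = top" by (metis top.not_eq_extremum)
    let ?s = "\<lambda>x. inverse (ennreal (w x powr dual_exp p))"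
    have "top * avg Q ?s epowr (q / dual_exp p) < top"
      using A_pq_le[OF False Q] A_const_finite unfolding top by (rule le_less_trans)
    then have "avg Q ?s = 0" by (auto simp: ennreal_top_mult split: if_splits)
    then have "AE x\<in>Q in lebesgue. ?s x = 0" by (intro avg_eq_0_imp_AE Q) auto
    then have "AE x\<in>Q in lebesgue. False" by eventually_elim auto
    with not_AE_False_cube[OF Q] show False by simp
  qed
qed

lemma avg_power_eq_0:
  assumes Q: "Q \<in> cubes" and nz: "\<not> (AE x\<in>Q in lebesgue. 0 < w x)"
  shows "avg Q (\<lambda>x. ennreal (w x powr q)) = 0"
proof (cases "p = 1")
  case True
  show ?thesis
  proof (rule ccontr)
    assume neq: "\<not> ?thesis"
    have "AE x\<in>Q in lebesgue. 0 < w x"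
      using A_one_AE_le[OF True Q]
    proof eventually_elim
      case (elim x)
      show ?case
      proof
        assume "x \<in> Q"
        with elim neq have "ennreal (w x powr q) \<noteq> 0" by auto
        then show "0 < w x" using A_class_nonneg[of x] by (cases "w x = 0") auto
      qed
    qed
    with nz show False by simp
  qed
next
  case False
  note [measurable] = A_class_measurable emeasure_lebesgue_cube(3)[OF Q]
  let ?s = "\<lambda>x. inverse (ennreal (w x powr dual_exp p))"
  have "avg Q ?s = top"
  proof (rule ccontr)
    assume "avg Q ?s \<noteq> top"
    then have "(\<integral>\<^sup>+x. ?s x * indicator Q x \<partial>lebesgue) \<noteq> \<infinity>"
      using emeasure_lebesgue_cube[OF Q] by (auto simp: avg_def ennreal_top_divide split: if_splits)
    then have "AE x in lebesgue. ?s x * indicator Q x \<noteq> \<infinity>" by (intro nn_integral_noteq_infinite) auto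
    then have "AE x\<in>Q in lebesgue. 0 < w x"
    proof eventually_elim
      case (elim x)
      then show ?case using A_class_nonneg[of x] by (cases "w x = 0") auto
    qed
    with nz show False by simp
  qed
  then have "avg Q (\<lambda>x. ennreal (w x powr q)) * top < top"
    using A_pq_le[OF False Q] A_const_finite by (auto intro: le_less_trans)
  then show ?thesis by (auto simp: ennreal_mult_top split: if_splits)
qed

text \<open>If \<open>w\<close> vanishes on a set of positive measure, then every cube meeting that set in positive measure
  has average \<open>0\<close>, and such cubes exhaust the space.\<close>
lemma A_class_positive_or_zero:
  "(AE x in lebesgue. 0 < w x) \<or> (AE x in lebesgue. w x = 0)"
proof (cases "AE x in lebesgue. 0 < w x")
  case False
  note [measurable] = A_class_measurable
  define B :: "nat \<Rightarrow> (real ^ 'n) set" where "B j = centred_cube (real (Suc j))" for j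
  have BQ: "B j \<in> cubes" for j unfolding B_def by (rule centred_cube_in_cubes) simp
  have Bmem: "x \<in> B j \<longleftrightarrow> (\<forall>i. \<bar>x $ i\<bar> \<le> Suc j)" for x j
    unfolding B_def by (rule mem_centred_cube)
  have big: "\<exists>j0. \<forall>j\<ge>j0. x \<in> B j" for x
  proof -
    obtain j0 :: nat where j0: "norm x \<le> j0" using real_arch_simple by blast
    have "x \<in> B j" if "j \<ge> j0" for j
      unfolding Bmem
    proof
      fix i
      have "real j0 \<le> real (Suc j)" using that by simp
      then show "\<bar>x $ i\<bar> \<le> real (Suc j)" using component_le_norm_cart[of x i] j0 by linarith
    qed
    then show ?thesis by blast
  qed
  have "\<exists>j. \<not> (AE x\<in>B j in lebesgue. 0 < w x)"
  proof (rule ccontr)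
    assume "\<not> ?thesis"
    then have "AE x in lebesgue. \<forall>j. x \<in> B j \<longrightarrow> 0 < w x" unfolding AE_all_countable by blast
    then have "AE x in lebesgue. 0 < w x"
    proof eventually_elim
      case (elim x)
      then show ?case using big[of x] by blast
    qed
    with False show False by simp
  qed
  then obtain j0 where j0: "\<not> (AE x\<in>B j0 in lebesgue. 0 < w x)" by blast
  have zero: "AE x\<in>B j in lebesgue. w x = 0" if "j0 \<le> j" for j
  proof -
    have "B j0 \<subseteq> B j"
    proof
      fix x assume "x \<in> B j0"
      then have x: "\<bar>x $ i\<bar> \<le> Suc j0" for i by (simp only: Bmem)
      have "real (Suc j0) \<le> real (Suc j)" using that by simp
      then show "x \<in> B j" unfolding Bmem using x order_trans by blast
    qed
    have "\<not> (AE x\<in>B j in lebesgue. 0 < w x)"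
    proof (rule contrapos_nn[OF j0])
      assume "AE x\<in>B j in lebesgue. 0 < w x"
      then show "AE x\<in>B j0 in lebesgue. 0 < w x"
        by (rule eventually_mono) (use \<open>B j0 \<subseteq> B j\<close> in blast)
    qed
    from avg_eq_0_imp_AE[OF BQ _ avg_power_eq_0[OF BQ this]]
    have "AE x\<in>B j in lebesgue. ennreal (w x powr q) = 0" by simp
    then show ?thesis
    proof eventually_elim
      case (elim x)
      then show ?case using A_class_nonneg[of x] by (auto simp: ennreal_eq_0_iff)
    qed
  qed
  have "AE x in lebesgue. \<forall>j. j0 \<le> j \<longrightarrow> x \<in> B j \<longrightarrow> w x = 0"
    unfolding AE_all_countable
  proof
    fix j
    show "AE x in lebesgue. j0 \<le> j \<longrightarrow> x \<in> B j \<longrightarrow> w x = 0"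
      using zero[of j] by (cases "j0 \<le> j") auto
  qed
  then have "AE x in lebesgue. w x = 0"
  proof eventually_elim
    case (elim x)
    obtain j1 where "\<forall>j\<ge>j1. x \<in> B j" using big by blast
    then show ?case using elim[rule_format, of "max j0 j1"] by auto
  qed
  then show ?thesis ..
qed simp

lemma max_fun_le_A_one:
  assumes p: "p = 1"
  shows "AE x in lebesgue. max_fun lebesgue dyad (\<lambda>x. ennreal (w x powr q) * indicator E x) x
      \<le> A_const p q w * ennreal (w x powr q)"
proof -
  let ?u = "\<lambda>x. ennreal (w x powr q)"
  have "AE x in lebesgue. \<forall>k m. x \<in> dyad_cube k m \<longrightarrow> avg (dyad_cube k m) ?u \<le> A_const p q w * ?u x"
    using A_one_AE_le[OF p dyad_cube_in_cubes] by (simp add: AE_all_countable)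
  then show ?thesis
  proof eventually_elim
    case (elim x)
    show ?case unfolding max_fun_def
    proof (rule SUP_least)
      fix k
      have "fibre_int lebesgue (dyad k) (\<lambda>x. ?u x * indicator E x) x / fibre_int lebesgue (dyad k) (\<lambda>_. 1) x
        \<le> avg (dyad_cube k (dyad k x)) (\<lambda>x. ?u x * indicator E x)" by (rule fibre_avg_le)
      also have "\<dots> \<le> avg (dyad_cube k (dyad k x)) ?u" by (rule avg_mono) (auto split: split_indicator)
      also have "\<dots> \<le> A_const p q w * ?u x"
        using elim dyad_subset_cube[of k "dyad k x"] by blast
      finally show "fibre_int lebesgue (dyad k) (\<lambda>x. ?u x * indicator E x) x / fibre_int lebesgue (dyad k) (\<lambda>_. 1) x
        \<le> A_const p q w * ?u x" .
    qed
  qed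
qed

end

section \<open>The weak-type inequality\<close>

abbreviation wmass :: "real \<Rightarrow> (real ^ 'n \<Rightarrow> real) \<Rightarrow> (real ^ 'n) set \<Rightarrow> ennreal" where
  "wmass q w E \<equiv> (\<integral>\<^sup>+x. ennreal (w x powr q) * indicator E x \<partial>lebesgue)"

abbreviation wmax :: "real \<Rightarrow> (real ^ 'n \<Rightarrow> real) \<Rightarrow> (real ^ 'n) set \<Rightarrow> real ^ 'n \<Rightarrow> ennreal" where
  "wmax q w E \<equiv> max_fun lebesgue dyad (\<lambda>x. ennreal (w x powr q) * indicator E x)"

abbreviation grad_energy :: "real \<Rightarrow> (real ^ 'n \<Rightarrow> real) \<Rightarrow> (real ^ 'n \<Rightarrow> real) \<Rightarrow> ennreal" where
  "grad_energy p w f \<equiv> (\<integral>\<^sup>+x. ennreal ((norm (grad f x) * w x) powr p) \<partial>lebesgue)"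

lemma sobolev_exponents:
  fixes p q :: real
  assumes p: "1 \<le> p" and q: "1 \<le> q" and eq: "1 / p - 1 / q = 1 / real CARD('n)"
  shows "2 \<le> CARD('n::finite)" "p < q" "p < real CARD('n)"
proof -
  have pos: "0 < 1 / q" "1 / p \<le> 1" "0 < 1 / real CARD('n)" using p q by (auto simp: card_gt_0_iff)
  then have "1 / real CARD('n) < 1 / p" "1 / real CARD('n) < 1" "1 / q < 1 / p" using eq by linarith+
  then show "2 \<le> CARD('n)" "p < q" "p < real CARD('n)" using p q by (auto simp: divide_less_cancel frac_less_eq field_simps)
qed

text \<open>For \<open>p = 1\<close> the maximal function is bounded pointwise by the constant times the weight. For \<open>p > 1\<close> Hoelder's
  inequality separates \<open>G * w\<close> from the maximal function, and Buckley's bound applies with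
  \<open>r = p' * (1 - 1 / n)\<close>. For this \<open>r\<close>, \<open>r - 1 = p' / q\<close>, so that the weights \<open>w powr q\<close> and \<open>w powr (- p')\<close> are dual to
  each other.\<close>
lemma weighted_maximal_bound:
  fixes p q :: real
  assumes p: "1 \<le> p" and q: "1 \<le> q" and eq: "1 / p - 1 / q = 1 / real CARD('n::finite)"
  defines "n \<equiv> real CARD('n)"
  shows "\<exists>K>0::real. \<forall>(w :: real ^ 'n \<Rightarrow> real) E G. w \<in> A_class p q \<longrightarrow> (AE x in lebesgue. 0 < w x) \<longrightarrow>
    E \<in> sets lebesgue \<longrightarrow> G \<in> borel_measurable lebesgue \<longrightarrow>
    0 < wmass q w E \<longrightarrow>
    wmass q w E < top \<longrightarrow>
    (\<integral>\<^sup>+y. G y * wmax q w E y epowr (1 - 1 / n) \<partial>lebesgue)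
    \<le> ennreal K * (A_const p q w epowr (1 - 1 / n) *
        (wmass q w E epowr (1 - 1 / p) *
         (\<integral>\<^sup>+y. (G y * ennreal (w y)) epowr p \<partial>lebesgue) epowr (1 / p)))"
proof (cases "p = 1")
  case True
  have n: "2 \<le> n" using sobolev_exponents[OF p q eq] by (simp add: n_def)
  have nq: "1 - 1 / n = 1 / q" using eq True by (simp add: n_def)
  show ?thesis
  proof (intro exI[of _ 1] conjI allI impI)
    fix w :: "real ^ 'n \<Rightarrow> real" and E :: "(real ^ 'n) set" and G :: "real ^ 'n \<Rightarrow> ennreal"
    assume w: "w \<in> A_class p q" and [measurable]: "E \<in> sets lebesgue" "G \<in> borel_measurable lebesgue"
    let ?u = "\<lambda>x. ennreal (w x powr q)" and ?A = "A_const p q w"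
    note [measurable] = A_class_measurable[OF w]
    assume U: "0 < wmass q w E" "wmass q w E < top"
    have "AE y in lebesgue. G y * wmax q w E y epowr (1 - 1 / n)
        \<le> ?A epowr (1 - 1 / n) * (G y * ennreal (w y))"
      using max_fun_le_A_one[OF w True, of E]
    proof eventually_elim
      case (elim y)
      have "wmax q w E y epowr (1 - 1 / n) \<le> (?A * ?u y) epowr (1 - 1 / n)"
        using n elim by (intro epowr_mono) auto
      also have "\<dots> = ?A epowr (1 - 1 / n) * ennreal (w y)"
        using A_class_nonneg[OF w, of y] q by (simp add: epowr_mult epowr_ennreal nq powr_powr)
      finally have "G y * wmax q w E y epowr (1 - 1 / n)
          \<le> G y * (?A epowr (1 - 1 / n) * ennreal (w y))" by (rule mult_left_mono) simp
      then show ?case by (simp only: mult.left_commute)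
    qed
    then have "(\<integral>\<^sup>+y. G y * wmax q w E y epowr (1 - 1 / n) \<partial>lebesgue)
      \<le> (\<integral>\<^sup>+y. ?A epowr (1 - 1 / n) * (G y * ennreal (w y)) \<partial>lebesgue)"
      by (rule nn_integral_mono_AE)
    also have "\<dots> = ?A epowr (1 - 1 / n) * (\<integral>\<^sup>+y. G y * ennreal (w y) \<partial>lebesgue)"
      by (rule nn_integral_cmult) simp
    finally show "(\<integral>\<^sup>+y. G y * wmax q w E y epowr (1 - 1 / n) \<partial>lebesgue)
    \<le> ennreal 1 * (?A epowr (1 - 1 / n) *
        (wmass q w E epowr (1 - 1 / p) *
         (\<integral>\<^sup>+y. (G y * ennreal (w y)) epowr p \<partial>lebesgue) epowr (1 / p)))"
      using True U by (cases "\<integral>\<^sup>+x. ?u x * indicator E x \<partial>lebesgue") (auto simp: epowr_ennreal)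
  qed simp
next
  case False
  have p1: "1 < p" using p False by simp
  have n: "2 \<le> n" and pn: "p < n" using sobolev_exponents[OF p q eq] by (simp_all add: n_def)
  define p' where "p' = dual_exp p"
  have p': "1 < p'" "1 / p + 1 / p' = 1" using p1 by (auto simp: p'_def dual_exp_def field_simps)
  define r where "r = p' * (1 - 1 / n)"
  have r1: "r - 1 = p' / q"
  proof -
    have "1 - 1 / n = 1 / q + 1 / p'" using eq p' by (simp add: n_def)
    then have "r = p' * (1 / q + 1 / p')" by (simp add: r_def)
    then show ?thesis using p' by (simp add: distrib_left)
  qed
  have r: "1 < r"
  proof -
    have "0 < p' / q" using p' q by simp
    then show ?thesis using r1 by linarith
  qed
  define c where "c = (\<lambda>s. 2 powr (2 * s) * geom (s - 1))"
  have rr: "1 < r / (r - 1)" using r by simp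
  have c: "0 < c r" "0 < c (r / (r - 1))" using r rr by (auto simp: c_def intro!: mult_pos_pos geom_pos)
  define K where "K = (c (r / (r - 1)) * c r) powr (1 / p')"
  have K: "0 < K" using c by (simp add: K_def)
  show ?thesis
  proof (intro exI[of _ K] conjI allI impI K)
    fix w :: "real ^ 'n \<Rightarrow> real" and E :: "(real ^ 'n) set" and G :: "real ^ 'n \<Rightarrow> ennreal"
    assume w: "w \<in> A_class p q" and wpos: "AE x in lebesgue. 0 < w x"
      and [measurable]: "E \<in> sets lebesgue" "G \<in> borel_measurable lebesgue"
    let ?u = "\<lambda>x. ennreal (w x powr q)" and ?A = "A_const p q w"
    let ?\<sigma> = "\<lambda>x. ennreal (w x powr (- p'))"
    let ?M = "wmax q w E"
    let ?U = "\<integral>\<^sup>+x. ?u x * indicator E x \<partial>lebesgue"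
    note [measurable] = A_class_measurable[OF w]
    have [measurable]: "?M \<in> borel_measurable lebesgue"
      by (rule borel_measurable_max_fun[OF measurable_dyad_lebesgue dyad_nested])
    have buckley: "(\<integral>\<^sup>+x. ?M x epowr r * ?\<sigma> x \<partial>lebesgue) \<le> ennreal (c (r / (r - 1))) * ennreal (c r) * (?A epowr r * ?U)"
      unfolding c_def
    proof (rule dyadic_maximal_Buckley[OF _ _ r A_const_finite[OF w]])
      show "AE x in lebesgue. 0 < ?u x \<and> ?u x < top \<and> 0 < ?\<sigma> x \<and> ?\<sigma> x * ?u x epowr (r - 1) = 1"
        using wpos
      proof eventually_elim
        case (elim x)
        then show ?case using q
          by (simp add: epowr_ennreal r1 powr_powr ennreal_mult[symmetric] powr_add[symmetric])
      qed
      fix k :: int and x :: "real ^ 'n"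
      let ?Q = "dyad_cube k (dyad k x)" and ?I = "\<lambda>f. fibre_int lebesgue (dyad k) f x"
      have le: "?\<sigma> x \<le> inverse (ennreal (w x powr dual_exp p))" for x
        using A_class_nonneg[OF w, of x]
        by (cases "w x = 0") (auto simp: p'_def[symmetric] inverse_ennreal powr_minus)
      have "?I ?\<sigma> / ?I (\<lambda>_. 1) \<le> avg ?Q ?\<sigma>" by (rule fibre_avg_le)
      also have "\<dots> \<le> avg ?Q (\<lambda>x. inverse (ennreal (w x powr dual_exp p)))" by (intro avg_mono le)
      finally have "(?I ?\<sigma> / ?I (\<lambda>_. 1)) epowr (1 / (r - 1))
          \<le> avg ?Q (\<lambda>x. inverse (ennreal (w x powr dual_exp p))) epowr (q / dual_exp p)"
        using r by (simp add: r1 p'_def[symmetric]) (intro epowr_mono, use p' q in auto)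
      then have "?I ?u / ?I (\<lambda>_. 1) * (?I ?\<sigma> / ?I (\<lambda>_. 1)) epowr (1 / (r - 1))
         \<le> avg ?Q ?u * avg ?Q (\<lambda>x. inverse (ennreal (w x powr dual_exp p))) epowr (q / dual_exp p)"
        by (intro mult_mono fibre_avg_le) auto
      also have "\<dots> \<le> ?A" by (rule A_pq_le[OF w False dyad_cube_in_cubes])
      finally show "?I ?u / ?I (\<lambda>_. 1) * (?I ?\<sigma> / ?I (\<lambda>_. 1)) epowr (1 / (r - 1)) \<le> ?A" .
    qed auto
    have "(\<integral>\<^sup>+y. G y * ?M y epowr (1 - 1 / n) \<partial>lebesgue)
      = (\<integral>\<^sup>+y. (G y * ennreal (w y)) * (?M y epowr (1 - 1 / n) * ennreal (w y powr (-1))) \<partial>lebesgue)"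
      using wpos
    proof (intro nn_integral_cong_AE, eventually_elim)
      case (elim y)
      have "(G y * ennreal (w y)) * (?M y epowr (1 - 1 / n) * ennreal (w y powr (-1)))
          = G y * ?M y epowr (1 - 1 / n) * (ennreal (w y) * ennreal (w y powr (-1)))"
        by (simp only: mult_ac)
      also have "ennreal (w y) * ennreal (w y powr (-1)) = 1"
        using elim by (simp add: ennreal_mult[symmetric] powr_minus)
      finally show ?case by simp
    qed
    also have "\<dots> \<le> (\<integral>\<^sup>+y. (G y * ennreal (w y)) epowr p \<partial>lebesgue) epowr (1 / p)
       * (\<integral>\<^sup>+y. (?M y epowr (1 - 1 / n) * ennreal (w y powr (-1))) epowr p' \<partial>lebesgue) epowr (1 / p')"
      by (rule nn_integral_Holder[OF p1 p']) auto
    also have "(\<integral>\<^sup>+y. (?M y epowr (1 - 1 / n) * ennreal (w y powr (-1))) epowr p' \<partial>lebesgue)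
        = (\<integral>\<^sup>+x. ?M x epowr r * ?\<sigma> x \<partial>lebesgue)"
    proof (intro nn_integral_cong)
      fix x
      have "(1 - 1 / n) * p' = r" "(- 1) * p' = - p'" by (simp_all add: r_def)
      then show "(?M x epowr (1 - 1 / n) * ennreal (w x powr (- 1))) epowr p' = ?M x epowr r * ?\<sigma> x"
        by (simp only: epowr_mult epowr_epowr epowr_ennreal[OF powr_ge_zero] powr_powr)
    qed
    finally have "(\<integral>\<^sup>+y. G y * ?M y epowr (1 - 1 / n) \<partial>lebesgue)
        \<le> (\<integral>\<^sup>+y. (G y * ennreal (w y)) epowr p \<partial>lebesgue) epowr (1 / p) * (\<integral>\<^sup>+x. ?M x epowr r * ?\<sigma> x \<partial>lebesgue) epowr (1 / p')" .
    also have "\<dots> \<le> (\<integral>\<^sup>+y. (G y * ennreal (w y)) epowr p \<partial>lebesgue) epowr (1 / p)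
        * (ennreal (c (r / (r - 1))) * ennreal (c r) * (?A epowr r * ?U)) epowr (1 / p')"
      using p' by (intro mult_left_mono epowr_mono buckley) auto
    also have "(ennreal (c (r / (r - 1))) * ennreal (c r) * (?A epowr r * ?U)) epowr (1 / p')
        = ennreal K * (?A epowr (1 - 1 / n) * ?U epowr (1 - 1 / p))"
    proof -
      have "r * (1 / p') = 1 - 1 / n" "1 / p' = 1 - 1 / p" using p' by (auto simp: r_def)
      then show ?thesis
        using c by (simp add: epowr_mult epowr_epowr epowr_ennreal K_def ennreal_mult[symmetric] powr_mult)
    qed
    finally show "(\<integral>\<^sup>+y. G y * ?M y epowr (1 - 1 / n) \<partial>lebesgue) \<le> ennreal K * (?A epowr (1 - 1 / n) *
        (?U epowr (1 - 1 / p) * (\<integral>\<^sup>+y. (G y * ennreal (w y)) epowr p \<partial>lebesgue) epowr (1 / p)))"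
      by (simp only: mult_ac)
  qed
qed

text \<open>Integrate the pointwise bound of \<open>f\<close> by the fractional integral of its gradient against the weight
  over the level set, and use duality. The mass \<open>U\<close> of the level set appears on the right with the
  power \<open>1 / n + (1 - 1 / p) = 1 - 1 / q\<close>, and dividing by it gives the claim. This needs \<open>U\<close> to be finite, which
  holds because the level set lies in a cube.\<close>
lemma weak_type_gradient_bound:
  fixes p q :: real
  assumes p: "1 \<le> p" and q: "1 \<le> q" and eq: "1 / p - 1 / q = 1 / real CARD('n::finite)"
  defines "n \<equiv> real CARD('n)"
  shows "\<exists>K>0::real. \<forall>(w :: real ^ 'n \<Rightarrow> real) f L s. w \<in> A_class p q \<longrightarrow> (AE x in lebesgue. 0 < w x) \<longrightarrow>
    L-lipschitz_on UNIV f \<longrightarrow> compact (closure {x. f x \<noteq> 0}) \<longrightarrow> 0 < s \<longrightarrow>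
    ennreal s * wmass q w {x. s \<le> \<bar>f x\<bar>} epowr (1 / q)
    \<le> ennreal K * (A_const p q w epowr (1 - 1 / n) *
        grad_energy p w f epowr (1 / p))"
proof -
  have N: "2 \<le> CARD('n)" using sobolev_exponents[OF p q eq] by simp
  then have n: "2 \<le> n" by (simp add: n_def)
  obtain K0 where K0: "0 < K0" and bound: "\<And>(w :: real ^ 'n \<Rightarrow> real) E G. w \<in> A_class p q \<Longrightarrow> (AE x in lebesgue. 0 < w x) \<Longrightarrow>
    E \<in> sets lebesgue \<Longrightarrow> G \<in> borel_measurable lebesgue \<Longrightarrow>
    0 < wmass q w E \<Longrightarrow>
    wmass q w E < top \<Longrightarrow>
    (\<integral>\<^sup>+y. G y * wmax q w E y epowr (1 - 1 / n) \<partial>lebesgue)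
    \<le> ennreal K0 * (A_const p q w epowr (1 - 1 / n) *
        (wmass q w E epowr (1 - 1 / p) *
         (\<integral>\<^sup>+y. (G y * ennreal (w y)) epowr p \<partial>lebesgue) epowr (1 / p)))"
    using weighted_maximal_bound[OF p q eq] unfolding n_def by blast
  define g where "g = geom 1 + geom (n - 1)"
  have g: "0 < g" using n by (auto simp: g_def intro!: add_pos_pos geom_pos)
  define K where "K = 2 ^ (CARD('n) - 1) * g * K0"
  have K: "0 < K" using K0 g by (simp add: K_def)
  show ?thesis
  proof (intro exI[of _ K] conjI allI impI K)
    fix w f :: "real ^ 'n \<Rightarrow> real" and L s :: real
    assume w: "w \<in> A_class p q" and wpos: "AE x in lebesgue. 0 < w x"
      and lip: "L-lipschitz_on UNIV f" and supp: "compact (closure {x. f x \<noteq> 0})" and s: "0 < s"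
    let ?u = "\<lambda>x. ennreal (w x powr q)" and ?A = "A_const p q w"
    define E where "E = {x. s \<le> \<bar>f x\<bar>}"
    define U where "U = wmass q w E"
    define G where "G = (\<lambda>y. ennreal (norm (grad f y)))"
    define X where "X = grad_energy p w f epowr (1 / p)"
    have cont: "continuous_on UNIV f" using lip by (rule lipschitz_on_continuous_on)
    have fm: "f \<in> borel_measurable borel" using cont by (rule borel_measurable_continuous_onI)
    have [measurable]: "f \<in> borel_measurable lebesgue" using fm by (intro measurable_completion) simp
    have [measurable]: "G \<in> borel_measurable lebesgue"
      using borel_measurable_norm_grad[OF cont] unfolding G_def by (intro measurable_completion) simp
    note [measurable] = A_class_measurable[OF w]
    have Em [measurable]: "E \<in> sets lebesgue"
    proof -
      have "{x \<in> space lebesgue. s \<le> \<bar>f x\<bar>} \<in> sets lebesgue" by measurable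
      then show ?thesis by (simp add: E_def)
    qed
    obtain k :: nat where k: "\<And>x. f x \<noteq> 0 \<Longrightarrow> norm x \<le> k"
    proof -
      have "bounded {x. f x \<noteq> 0}" using compact_imp_bounded[OF supp] bounded_subset closure_subset by blast
      then obtain b where "\<And>x. f x \<noteq> 0 \<Longrightarrow> norm x \<le> b" by (auto simp: bounded_iff)
      moreover obtain k :: nat where "b \<le> k" using real_arch_simple by blast
      ultimately show ?thesis using that order_trans by blast
    qed
    define Q :: "(real ^ 'n) set" where "Q = centred_cube (real k + 1)"
    have QC: "Q \<in> cubes" unfolding Q_def by (rule centred_cube_in_cubes) simp
    have fQ: "x \<in> Q" if "f x \<noteq> 0" for x
      unfolding Q_def mem_centred_cube
    proof
      show "\<bar>x $ i\<bar> \<le> real k + 1" for i using component_le_norm_cart[of x i] k[OF that] by linarith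
    qed
    have EQ: "E \<subseteq> Q" using fQ s by (auto simp: E_def)
    have "U \<le> set_nn_integral lebesgue Q ?u"
      unfolding U_def using EQ by (intro nn_integral_mono) (auto split: split_indicator)
    also have "\<dots> < top"
      using avg_power_finite[OF w QC] emeasure_lebesgue_cube[OF QC]
      by (auto simp: avg_def ennreal_divide_eq_top_iff less_top[symmetric])
    finally have Ufin: "U < top" .
    have "bounded (f ` closure {x. f x \<noteq> 0})"
      by (intro compact_imp_bounded compact_continuous_image continuous_on_subset[OF cont] supp) auto
    then obtain b where b: "\<And>x. x \<in> closure {x. f x \<noteq> 0} \<Longrightarrow> \<bar>f x\<bar> \<le> b" by (auto simp: bounded_iff)
    have "(\<integral>\<^sup>+y. ennreal \<bar>f y\<bar> \<partial>lborel) \<le> (\<integral>\<^sup>+y. ennreal b * indicator Q y \<partial>lborel)"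
    proof (intro nn_integral_mono)
      fix y
      show "ennreal \<bar>f y\<bar> \<le> ennreal b * indicator Q y"
        using fQ[of y] b[of y] closure_subset[of "{x. f x \<noteq> 0}"]
        by (cases "f y = 0") (auto simp: ennreal_leI subset_eq)
    qed
    also have "\<dots> = ennreal b * emeasure lborel Q" by (rule nn_integral_cmult_indicator) (simp add: Q_def centred_cube_def)
    also have "\<dots> < top" by (simp add: Q_def centred_cube_def emeasure_lborel_cbox_eq ennreal_mult_less_top)
    finally have ffin: "(\<integral>\<^sup>+y. ennreal \<bar>f y\<bar> \<partial>lborel) < top" .
    have Xeq: "(\<integral>\<^sup>+y. (G y * ennreal (w y)) epowr p \<partial>lebesgue) epowr (1 / p) = X"
      using A_class_nonneg[OF w] by (simp add: X_def G_def ennreal_mult[symmetric] epowr_ennreal)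
    have "ennreal s * U epowr (1 / q) \<le> ennreal K * (?A epowr (1 - 1 / n) * X)"
    proof (cases "U = 0")
      case False
      then have Upos: "0 < U" by (simp add: zero_less_iff_neq_zero)
      define R where "R = ?A epowr (1 - 1 / n) * X"
      let ?pot = "\<lambda>x. \<Sum>\<^sup>+k. ennreal (2 powr (real_of_int k * (1 - real CARD('n)))) * fibre_int lebesgue (dyad k) G x"
      have "ennreal s * U = (\<integral>\<^sup>+x. ennreal s * (?u x * indicator E x) \<partial>lebesgue)"
        unfolding U_def by (simp add: nn_integral_cmult)
      also have "\<dots> \<le> (\<integral>\<^sup>+x. 2 ^ (CARD('n) - 1) * ((?u x * indicator E x) * ?pot x) \<partial>lebesgue)"
      proof (intro nn_integral_mono)
        fix x
        have "ennreal s \<le> 2 ^ (CARD('n) - 1) * ?pot x" if "x \<in> E"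
        proof -
          have "ennreal s \<le> ennreal \<bar>f x\<bar>" using that by (auto simp: E_def intro: ennreal_leI)
          also have "\<dots> \<le> 2 ^ (CARD('n) - 1) * ?pot x"
            unfolding fibre_int_lebesgue G_def by (rule abs_le_dyadic_potential[OF lip ffin])
          finally show ?thesis .
        qed
        then show "ennreal s * (?u x * indicator E x) \<le> 2 ^ (CARD('n) - 1) * ((?u x * indicator E x) * ?pot x)"
          using mult_right_mono[of "ennreal s" "2 ^ (CARD('n) - 1) * ?pot x" "?u x"]
          by (cases "x \<in> E") (auto simp: mult_ac)
      qed
      also have "\<dots> = 2 ^ (CARD('n) - 1) * (\<integral>\<^sup>+x. (?u x * indicator E x) * ?pot x \<partial>lebesgue)"
      proof (rule nn_integral_cmult)
        have [measurable]: "fibre_int lebesgue (dyad k) G \<in> borel_measurable lebesgue" for k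
          by (rule borel_measurable_fibre_int[OF measurable_dyad_lebesgue])
        have "?pot x = (\<Sum>i. ennreal (2 powr (real_of_int (int_decode i) * (1 - real CARD('n)))) * fibre_int lebesgue (dyad (int_decode i)) G x)" for x
          by (subst nn_integral_bij_count_space[OF bij_int_decode, symmetric]) (rule nn_integral_count_space_nat)
        then have [measurable]: "?pot \<in> borel_measurable lebesgue" by simp
        show "(\<lambda>x. (?u x * indicator E x) * ?pot x) \<in> borel_measurable lebesgue" by measurable
      qed
      also have "(\<integral>\<^sup>+x. (?u x * indicator E x) * ?pot x \<partial>lebesgue) \<le>
          ennreal g * (U epowr (1 / n) * (\<integral>\<^sup>+y. G y * wmax q w E y epowr (1 - 1 / n) \<partial>lebesgue))"
        unfolding g_def n_def U_def using Ufin N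
        by (intro dyadic_potential_duality) (auto simp: U_def)
      also have "(\<integral>\<^sup>+y. G y * wmax q w E y epowr (1 - 1 / n) \<partial>lebesgue)
          \<le> ennreal K0 * (?A epowr (1 - 1 / n) * (U epowr (1 - 1 / p) * X))"
        unfolding Xeq[symmetric] U_def using Upos Ufin
        by (intro bound[OF w wpos]) (auto simp: U_def)
      finally have "ennreal s * U \<le> 2 ^ (CARD('n) - 1) * (ennreal g * (U epowr (1 / n) * (ennreal K0 * (?A epowr (1 - 1 / n) * (U epowr (1 - 1 / p) * X)))))"
        by (auto simp: mult_left_mono)
      also have "\<dots> = ennreal K * (U epowr (1 / n + (1 - 1 / p)) * R)"
      proof -
        have "ennreal K = 2 ^ (CARD('n) - 1) * ennreal g * ennreal K0"
          using g K0 by (simp add: K_def ennreal_mult ennreal_power[symmetric])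
        then show ?thesis by (simp only: R_def epowr_add mult_ac)
      qed
      also have "1 / n + (1 - 1 / p) = 1 - 1 / q" using eq by (simp add: n_def)
      finally have le: "ennreal s * U \<le> ennreal K * (U epowr (1 - 1 / q) * R)" .
      have "U epowr (1 / q - 1) * (ennreal s * U) \<le> U epowr (1 / q - 1) * (ennreal K * (U epowr (1 - 1 / q) * R))"
        using le by (rule mult_left_mono) simp
      moreover have "U epowr (1 / q - 1) * (ennreal s * U) = ennreal s * U epowr (1 / q)"
        using epowr_add[of U "1 / q - 1" 1] by (simp add: mult_ac)
      moreover have "U epowr (1 / q - 1) * (ennreal K * (U epowr (1 - 1 / q) * R)) = ennreal K * R * (U epowr (1 / q - 1) * U epowr (1 - 1 / q))"
        by (simp only: mult_ac)
      moreover have "U epowr (1 / q - 1) * U epowr (1 - 1 / q) = 1"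
        using Upos Ufin unfolding epowr_add[symmetric] by (cases U) (auto simp: epowr_ennreal)
      ultimately show ?thesis by (simp add: R_def)
    qed simp
    then show "ennreal s * wmass q w {x. s \<le> \<bar>f x\<bar>} epowr (1 / q)
      \<le> ennreal K * (?A epowr (1 - 1 / n) * grad_energy p w f epowr (1 / p))"
      by (simp add: U_def E_def X_def)
  qed
qed

section \<open>From weak to strong type by truncation\<close>

lemma band_lipschitz:
  assumes "L-lipschitz_on S f"
  shows "L-lipschitz_on S (\<lambda>x. band s (f x))"
proof (rule lipschitz_onI)
  fix x y assume "x \<in> S" "y \<in> S"
  have "dist (band s (f x)) (band s (f y)) \<le> dist (f x) (f y)"
    unfolding band_def dist_real_def by linarith
  also have "\<dots> \<le> L * dist x y" by (rule lipschitz_onD[OF assms]) fact+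
  finally show "dist (band s (f x)) (band s (f y)) \<le> L * dist x y" .
qed (rule lipschitz_on_nonneg[OF assms])

lemma band_ge_iff: "0 < s \<Longrightarrow> s \<le> \<bar>band s y\<bar> \<longleftrightarrow> 2 * s \<le> \<bar>y\<bar>"
  by (auto simp: band_def)

theorem theorem2p7:
  fixes p q :: real
  assumes "1 \<le> p" and "1 \<le> q"
    and "1 / p - 1 / q = 1 / real CARD('n::finite)"
  shows "\<exists>c>0::real. \<forall>(w :: real ^ 'n \<Rightarrow> real) (f :: real ^ 'n \<Rightarrow> real).
    w \<in> A_class p q \<longrightarrow> (\<exists>L. L-lipschitz_on UNIV f) \<longrightarrow> compact (closure {x. f x \<noteq> 0}) \<longrightarrow>
    (\<integral>\<^sup>+ x. ennreal ((\<bar>f x\<bar> * w x) powr q) \<partial>lebesgue) epowr (1 / q)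
      \<le> ennreal c * A_const p q w epowr (1 - 1 / real CARD('n)) *
        (\<integral>\<^sup>+ x. ennreal ((norm (grad f x) * w x) powr p) \<partial>lebesgue) epowr (1 / p)"
proof -
  note p = assms(1) and q = assms(2) and eq = assms(3)
  define n where "n = real CARD('n)"
  have pq: "p < q" using sobolev_exponents[OF p q eq] by simp
  obtain K where K: "0 < K" and weak: "\<And>(w :: real ^ 'n \<Rightarrow> real) f L s. w \<in> A_class p q \<Longrightarrow> (AE x in lebesgue. 0 < w x) \<Longrightarrow>
    L-lipschitz_on UNIV f \<Longrightarrow> compact (closure {x. f x \<noteq> 0}) \<Longrightarrow> 0 < s \<Longrightarrow>
    ennreal s * wmass q w {x. s \<le> \<bar>f x\<bar>} epowr (1 / q)
    \<le> ennreal K * (A_const p q w epowr (1 - 1 / n) *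
        grad_energy p w f epowr (1 / p))"
    using weak_type_gradient_bound[OF p q eq] unfolding n_def by blast
  show ?thesis
  proof (intro exI[of _ "4 * K"] conjI allI impI)
    show "0 < 4 * K" using K by simp
    fix w f :: "real ^ 'n \<Rightarrow> real"
    assume w: "w \<in> A_class p q" and "\<exists>L. L-lipschitz_on UNIV f" and supp: "compact (closure {x. f x \<noteq> 0})"
    then obtain L where lip: "L-lipschitz_on UNIV f" by blast
    let ?u = "\<lambda>x. ennreal (w x powr q)"
    define R where "R = ennreal K * A_const p q w epowr (1 - 1 / n)"
    define X where "X = grad_energy p w f"
    have cont: "continuous_on UNIV f" using lip by (rule lipschitz_on_continuous_on)
    have [measurable]: "f \<in> borel_measurable lebesgue"
      using borel_measurable_continuous_onI[OF cont] by (intro measurable_completion) simp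
    have [measurable]: "(\<lambda>x. norm (grad f x)) \<in> borel_measurable lebesgue"
      using borel_measurable_norm_grad[OF cont] by (intro measurable_completion) simp
    note [measurable] = A_class_measurable[OF w]
    have w0: "0 \<le> w x" for x by (rule A_class_nonneg[OF w])
    have "(\<integral>\<^sup>+ x. ennreal ((\<bar>f x\<bar> * w x) powr q) \<partial>lebesgue) \<le> (ennreal 4 * R) epowr q * X epowr (q / p)"
    proof (cases "AE x in lebesgue. 0 < w x")
      case False
      then have "AE x in lebesgue. w x = 0" using A_class_positive_or_zero[OF w] by blast
      then have "(\<integral>\<^sup>+ x. ennreal ((\<bar>f x\<bar> * w x) powr q) \<partial>lebesgue) = nn_integral (lebesgue :: (real ^ 'n) measure) (\<lambda>_. 0)"
        by (intro nn_integral_cong_AE) (auto elim: eventually_mono)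
      then show ?thesis by simp
    next
      case wpos: True
      \<comment> \<open>The weak-type bound is applied to the part of \<open>\<bar>f\<bar>\<close> between the heights \<open>s j\<close> and \<open>2 * s j\<close>,
        which reaches the value \<open>s j\<close> exactly where \<open>\<bar>f x\<bar> \<ge> 2 powr j\<close>.\<close>
      define s where "s j = pow2 j / 2" for j
      have s: "0 < s j" "2 * s j = pow2 j" for j by (simp_all add: s_def)
      define S where "S j = {x. s j < \<bar>f x\<bar> \<and> \<bar>f x\<bar> < 2 * s j}" for j
      have [measurable]: "S j \<in> sets lebesgue" for j
      proof -
        have "{x \<in> space lebesgue. s j < \<bar>f x\<bar> \<and> \<bar>f x\<bar> < 2 * s j} \<in> sets lebesgue" by measurable
        then show ?thesis by (simp add: S_def)
      qed
      define U where "U j = wmass q w {x. pow2 j \<le> \<bar>f x\<bar>}" for j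
      define Y where "Y j = (\<integral>\<^sup>+x. ennreal ((norm (grad f x) * w x) powr p) * indicator (S j) x \<partial>lebesgue)" for j
      have level: "ennreal (s j) * U j epowr (1 / q) \<le> R * Y j epowr (1 / p)" for j
      proof -
        define g where "g x = band (s j) (f x)" for x
        have lipg: "L-lipschitz_on UNIV g" unfolding g_def by (rule band_lipschitz[OF lip])
        have "closure {x. g x \<noteq> 0} \<subseteq> closure {x. f x \<noteq> 0}"
          using s(1)[of j] by (intro closure_mono) (auto simp: g_def band_def)
        then have suppg: "compact (closure {x. g x \<noteq> 0})"
          using compact_Int_closed[OF supp closed_closure[of "{x. g x \<noteq> 0}"]] by (simp add: Int_absorb1)
        have "ennreal (s j) * U j epowr (1 / q) = ennreal (s j) * wmass q w {x. s j \<le> \<bar>g x\<bar>} epowr (1 / q)"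
          unfolding U_def g_def band_ge_iff[OF s(1)] s(2) ..
        also have "\<dots> \<le> ennreal K * (A_const p q w epowr (1 - 1 / n) *
            grad_energy p w g epowr (1 / p))"
          by (rule weak[OF w wpos lipg suppg s(1)])
        also have "\<dots> \<le> ennreal K * (A_const p q w epowr (1 - 1 / n) * Y j epowr (1 / p))"
          unfolding Y_def
        proof (intro mult_left_mono epowr_mono nn_integral_mono)
          fix y
          have "norm (grad g y) \<le> norm (grad f y) * indicator (S j) y"
            unfolding g_def S_def by (rule norm_grad_band_le[OF cont s(1)])
          then have "norm (grad g y) * w y \<le> norm (grad f y) * w y * indicator (S j) y"
            using mult_right_mono[of "norm (grad g y)" "norm (grad f y) * indicator (S j) y" "w y"] w0[of y]
            by (simp add: mult_ac)
          then have "(norm (grad g y) * w y) powr p \<le> (norm (grad f y) * w y * indicator (S j) y) powr p"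
            using p w0[of y] by (intro powr_mono2) auto
          then have "ennreal ((norm (grad g y) * w y) powr p) \<le> ennreal ((norm (grad f y) * w y * indicator (S j) y) powr p)"
            by (rule ennreal_leI)
          then show "ennreal ((norm (grad g y) * w y) powr p) \<le> ennreal ((norm (grad f y) * w y) powr p) * indicator (S j) y"
            by (auto split: split_indicator_asm split_indicator)
        qed (use p in auto)
        finally show ?thesis by (simp add: R_def mult.assoc)
      qed
      \<comment> \<open>The gradients of these parts live on disjoint sets, so their energies add up.\<close>
      have disjoint: "(\<Sum>\<^sup>+j. indicator (S j) x) \<le> (1 :: ennreal)" for x
      proof (cases "\<exists>j. x \<in> S j")
        case True
        then obtain j where j: "x \<in> S j" by blast
        have uniq: "i = j" if "x \<in> S i" for i
        proof -
          have *: "real_of_int a - 1 < b" if "pow2 a / 2 < pow2 b" for a b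
          proof -
            have "2 powr (real_of_int a - 1) < pow2 b" using that by (simp add: powr_diff)
            then show ?thesis by simp
          qed
          have "pow2 i / 2 < pow2 j" "pow2 j / 2 < pow2 i"
            using that j unfolding S_def s(2) by (auto simp: s_def)
          from *[OF this(1)] *[OF this(2)] show ?thesis by linarith
        qed
        have "(\<Sum>\<^sup>+j. indicator (S j) x) \<le> (\<Sum>\<^sup>+i. (indicator {j} i :: ennreal))"
        proof (rule nn_integral_mono)
          show "indicator (S i) x \<le> (indicator {j} i :: ennreal)" for i
            using uniq[of i] by (cases "x \<in> S i") auto
        qed
        also have "\<dots> = 1" by (subst nn_integral_indicator) auto
        finally show ?thesis .
      qed simp
      have sumY: "(\<Sum>\<^sup>+j. Y j) \<le> X"
      proof -
        have "(\<Sum>\<^sup>+j. Y j)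
          = (\<integral>\<^sup>+x. (\<Sum>\<^sup>+j. ennreal ((norm (grad f x) * w x) powr p) * indicator (S j) x) \<partial>lebesgue)"
          unfolding Y_def by (subst nn_integral_count_space_nn_integral) auto
        also have "\<dots> = (\<integral>\<^sup>+x. ennreal ((norm (grad f x) * w x) powr p) * (\<Sum>\<^sup>+j. indicator (S j) x) \<partial>lebesgue)"
          by (simp add: nn_integral_cmult)
        also have "\<dots> \<le> (\<integral>\<^sup>+x. ennreal ((norm (grad f x) * w x) powr p) * 1 \<partial>lebesgue)"
          by (intro nn_integral_mono mult_left_mono disjoint) auto
        finally show ?thesis by (simp add: X_def)
      qed
      have summand: "ennreal (2 powr (real_of_int (j + 1) * q)) * U j \<le> (ennreal 4 * R) epowr q * Y j epowr (q / p)" for j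
      proof -
        have "(ennreal 4 * (ennreal (s j) * U j epowr (1 / q))) epowr q \<le> (ennreal 4 * (R * Y j epowr (1 / p))) epowr q"
          using q by (intro epowr_mono mult_left_mono level) auto
        moreover have "(ennreal 4 * (ennreal (s j) * U j epowr (1 / q))) epowr q = ennreal (2 powr (real_of_int (j + 1) * q)) * U j"
        proof -
          have "4 * s j = pow2 (j + 1)" by (simp add: s_def powr_add)
          then have "ennreal 4 * ennreal (s j) = ennreal (pow2 (j + 1))"
            using s(1)[of j] by (metis ennreal_mult less_imp_le zero_le_numeral)
          then show ?thesis
            using q by (simp only: mult.assoc[symmetric]) (simp add: epowr_mult epowr_epowr epowr_ennreal powr_powr)
        qed
        moreover have "(ennreal 4 * (R * Y j epowr (1 / p))) epowr q = (ennreal 4 * R) epowr q * Y j epowr (q / p)"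
          by (simp only: mult.assoc[symmetric] epowr_mult epowr_epowr) simp
        ultimately show ?thesis by simp
      qed
      have "(\<integral>\<^sup>+ x. ennreal ((\<bar>f x\<bar> * w x) powr q) \<partial>lebesgue) = (\<integral>\<^sup>+x. ennreal \<bar>f x\<bar> epowr q * ?u x \<partial>lebesgue)"
        using w0 by (intro nn_integral_cong) (simp add: epowr_ennreal powr_mult ennreal_mult)
      also have "\<dots> \<le> (\<integral>\<^sup>+x. (\<Sum>\<^sup>+j. ennreal (2 powr (real_of_int (j + 1) * q)) * (?u x * indicator {x. pow2 j \<le> \<bar>f x\<bar>} x)) \<partial>lebesgue)"
      proof (rule nn_integral_mono)
        fix x
        have "ennreal \<bar>f x\<bar> epowr q \<le> (\<Sum>\<^sup>+j. ennreal (2 powr (real_of_int (j + 1) * q)) * indicator {j. ennreal (pow2 j) < ennreal \<bar>f x\<bar>} j)"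
          using q by (intro epowr_le_dyadic_sum) linarith
        also have "\<dots> \<le> (\<Sum>\<^sup>+j. ennreal (2 powr (real_of_int (j + 1) * q)) * indicator {x. pow2 j \<le> \<bar>f x\<bar>} x)"
          by (intro nn_integral_mono mult_left_mono) (auto simp: ennreal_less_iff split: split_indicator)
        finally have "ennreal \<bar>f x\<bar> epowr q * ?u x \<le> (\<Sum>\<^sup>+j. ennreal (2 powr (real_of_int (j + 1) * q)) * indicator {x. pow2 j \<le> \<bar>f x\<bar>} x) * ?u x"
          by (rule mult_right_mono) simp
        also have "\<dots> = (\<Sum>\<^sup>+j. ennreal (2 powr (real_of_int (j + 1) * q)) * (?u x * indicator {x. pow2 j \<le> \<bar>f x\<bar>} x))"
          by (subst nn_integral_multc[symmetric]) (auto intro!: nn_integral_cong simp: mult_ac)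
        finally show "ennreal \<bar>f x\<bar> epowr q * ?u x \<le> (\<Sum>\<^sup>+j. ennreal (2 powr (real_of_int (j + 1) * q)) * (?u x * indicator {x. pow2 j \<le> \<bar>f x\<bar>} x))" .
      qed
      also have "\<dots> = (\<Sum>\<^sup>+j. ennreal (2 powr (real_of_int (j + 1) * q)) * U j)"
        unfolding U_def by (subst nn_integral_count_space_nn_integral) (auto simp: nn_integral_cmult)
      also have "\<dots> \<le> (\<Sum>\<^sup>+j. (ennreal 4 * R) epowr q * Y j epowr (q / p))"
        by (intro nn_integral_mono summand)
      also have "\<dots> = (ennreal 4 * R) epowr q * (\<Sum>\<^sup>+j. Y j epowr (q / p))"
        by (rule nn_integral_cmult) simp
      \<comment> \<open>Here \<open>q \<ge> p\<close> turns the weak-type bounds into a strong one.\<close>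
      also have "\<dots> \<le> (ennreal 4 * R) epowr q * (\<Sum>\<^sup>+j. Y j) epowr (q / p)"
        using p pq by (intro mult_left_mono sum_epowr_le_epowr_sum) auto
      also have "\<dots> \<le> (ennreal 4 * R) epowr q * X epowr (q / p)"
        using p q by (intro mult_left_mono epowr_mono sumY) auto
      finally show ?thesis .
    qed
    then have "(\<integral>\<^sup>+ x. ennreal ((\<bar>f x\<bar> * w x) powr q) \<partial>lebesgue) epowr (1 / q)
        \<le> ((ennreal 4 * R) epowr q * X epowr (q / p)) epowr (1 / q)"
      using q by (intro epowr_mono) auto
    also have "\<dots> = ennreal 4 * R * X epowr (1 / p)"
      using q by (simp add: epowr_mult[of _ _ "1 / q"] epowr_epowr)
    also have "ennreal 4 * R = ennreal (4 * K) * A_const p q w epowr (1 - 1 / n)"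
      using K by (simp add: R_def ennreal_mult mult.assoc)
    finally show "(\<integral>\<^sup>+ x. ennreal ((\<bar>f x\<bar> * w x) powr q) \<partial>lebesgue) epowr (1 / q)
      \<le> ennreal (4 * K) * A_const p q w epowr (1 - 1 / real CARD('n)) *
        grad_energy p w f epowr (1 / p)"
      by (simp add: n_def X_def)
  qed
qed

end
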